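(* Let $d\ge 2$ and $N\ge 2$ be integers and let $k\in\mathbb N\setminus\{0\}$. For all $0\le p<1$, the fractal percolation set $E(\omega)\subset\mathbb R^d$ is purely $k$-unrectifiable for $\mathbb P_p$-almost all $\omega\in\Omega$.
   Context: Fractal percolation model. Let $\mathbb N=\{0,1,2,\dots\}$. For $n\in\mathbb N$, let $\mathcal Q_n$ be the collection of closed grid cubes $\prod_{i=1}^d[(l_i-1)N^{-n},l_iN^{-n}]$, $l_i\in\{1,\dots,N^n\}$, of $[0,1]^d$. Let $\Omega=\{0,1\}^{\bigcup_{n\in\mathbb N}\mathcal Q_n}$ (equivalently, the set of $\{0,1\}$-labellings of the vertices of the rooted $N^d$-branching tree), equipped with the completion of the product measure $\mathbb P_p$ under which the coordinates $\omega(Q)$ are independent and each equals $1$ with probability $p$ and $0$ with probability $1-p$. Let $\mathcal C_n(\omega)=\{Q\in\mathcal Q_n\mid\omega(Q)=1\}$ and $$E(\omega)=\bigcap_{n=0}^\infty\ \bigcup_{Q\in\mathcal C_n(\omega)}Q .$$ A set $F\subset\mathbb R^d$ is purely $k$-unrectifiable if $\mathcal H^k(f(\mathbb R^k)\cap F)=0$ for all Lipschitz maps $f\colon\mathbb R^k\to\mathbb R^d$, where $\mathcal H^k$ is the $k$-dimensional Hausdorff measure. *)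

theory Defs
  imports "HOL-Probability.Probability"
begin

text \<open>
  The Hausdorff (outer) measure is taken without a normalising constant. Covering sets are
  required to be bounded because \<^const>\<open>diameter\<close> carries no information about unbounded
  sets. The case distinction on the empty set only matters for \<open>k = 0\<close>: there \<open>0 ^ 0 = 1\<close> is
  right for singletons, but the empty set must contribute nothing.
\<close>

definition hausdorff_premeasure :: "nat \<Rightarrow> real \<Rightarrow> 'a::metric_space set \<Rightarrow> ennreal" where
  "hausdorff_premeasure k \<delta> A =
     Inf {\<Sum>i. (if C i = {} then 0 else ennreal (diameter (C i) ^ k)) | C :: nat \<Rightarrow> 'a set.
            A \<subseteq> (\<Union>i. C i) \<and> (\<forall>i. bounded (C i) \<and> diameter (C i) \<le> \<delta>)}"

definition hausdorff_measure :: "nat \<Rightarrow> 'a::metric_space set \<Rightarrow> ennreal" where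
  "hausdorff_measure k A = (SUP \<delta>\<in>{0<..}. hausdorff_premeasure k \<delta> A)"

text \<open>The dimension \<open>k\<close> is the cardinality of the index type \<open>'k\<close>.\<close>

definition purely_unrectifiable :: "'k::finite itself \<Rightarrow> (real ^ 'd) set \<Rightarrow> bool" where
  "purely_unrectifiable _ F \<longleftrightarrow>
     (\<forall>f :: real ^ 'k \<Rightarrow> real ^ 'd. (\<exists>L. L-lipschitz_on UNIV f) \<longrightarrow>
        hausdorff_measure CARD('k) (range f \<inter> F) = 0)"

definition grid_cubes :: "nat \<Rightarrow> nat \<Rightarrow> (real ^ 'd) set set" where
  "grid_cubes N n =
     {cbox (\<chi> i. (real (l i) - 1) / real N ^ n) (\<chi> i. real (l i) / real N ^ n) | l :: 'd \<Rightarrow> nat.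
        \<forall>i. l i \<in> {1..N ^ n}}"

text \<open>
  Labels are Booleans, with \<^const>\<open>True\<close> for \<open>1\<close>. A configuration labels the cubes
  themselves, as sets; for \<open>N \<ge> 2\<close> cubes of different levels have different side lengths, so
  no cube occurs at two levels.
\<close>

definition percolation_space :: "nat \<Rightarrow> real \<Rightarrow> ((real ^ 'd) set \<Rightarrow> bool) measure" where
  "percolation_space N p =
     completion (\<Pi>\<^sub>M Q\<in>(\<Union>n. grid_cubes N n). measure_pmf (bernoulli_pmf p))"

definition chosen_cubes :: "nat \<Rightarrow> ((real ^ 'd) set \<Rightarrow> bool) \<Rightarrow> nat \<Rightarrow> (real ^ 'd) set set" where
  "chosen_cubes N \<omega> n = {Q \<in> grid_cubes N n. \<omega> Q}"

definition fractal_percolation :: "nat \<Rightarrow> ((real ^ 'd) set \<Rightarrow> bool) \<Rightarrow> (real ^ 'd) set" where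
  "fractal_percolation N \<omega> = (\<Inter>n. \<Union>Q\<in>chosen_cubes N \<omega> n. Q)"

end

theory Submission
  imports Defs "HOL-Real_Asymp.Real_Asymp"
begin

text \<open>
  The proof avoids differentiability and Lebesgue measure. Fix a Lipschitz map \<open>f\<close> and cut the domain
  into \<open>N\<close>-adic cells. The slopes of \<open>f\<close> along lines in one coordinate direction form a bounded
  martingale, so by pigeonhole there is a scale \<open>n\<close> at which, on most cells of side \<open>N ^ (-n)\<close>, \<open>f\<close> is nearly
  affine along densely many lines, down to scale \<open>n + m\<close>. If all these lines have small slope,
  the image of the cell is covered cheaply. If one is steep, its image passes close to about
  \<open>N ^ m\<close> vertices of the grid of level \<open>n + m\<close>. Unless all these vertices touch a chosen cube, a piece of
  the cell is mapped off the percolation set.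

  Call a cube of level \<open>n\<close> bad if, for some steep line near it, every such vertex touches a chosen
  cube. Up to discretisation there are only polynomially many lines in \<open>N ^ m\<close>, so bad cubes have
  probability tending to \<open>0\<close> as \<open>m\<close> grows. There are exponentially many chains of level \<open>n\<close> cubes
  of a given length, so a union bound and the Borel-Cantelli lemma show that almost surely, for fixed
  scale of the domain and all large \<open>n\<close>, every discretised Lipschitz curve meets few bad cubes. Hence either
  few cells are mapped near bad cubes, or many cells are mapped near few bad cubes and are
  covered cheaply by those. In all cases the best constant \<open>B\<close> in ``the Hausdorff premeasure
  of the image of a cell within the percolation set is at most \<open>B\<close> times the volume of the cell''
  improves to \<open>B - c * (B - \<epsilon>)\<close>, where \<open>c > 0\<close> does not depend on \<open>B\<close>; so it is \<open>0\<close>.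
\<close>

section \<open>Hitting probabilities for blocks of cubes\<close>

text \<open>The map \<open>f\<close> may depend on \<omega>, and the pigeonhole produces the scale
  \<open>n\<close> only after both are given. All random statements are therefore about integer data
  (\<open>bad\<close>, \<open>typical\<close>) and hold for all chains and all large
  \<open>n\<close> at once. The constants come in a fixed order: \<open>D\<close> from the Lipschitz
  constant; \<open>q = N ^ m'\<close> and \<open>T\<close> from \<epsilon>; last the depth
  \<open>m\<close>. A chain of \<open>M\<close> cubes with a marked subset can be chosen in at most
  \<open>(2 * (2 * D + 1) ^ d) ^ M\<close> ways per starting cube. If \<open>S\<close> is bad with
  probability at most \<open>x ^ (T * card S)\<close>, then more than \<open>M / T\<close> bad cubes
  cost \<open>x ^ M\<close>, and \<open>x = 1 / (4 * (2 * D + 1) ^ d)\<close> leaves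
  \<open>2 ^ -M\<close>. Such an \<open>m\<close> exists because the factor per cube is a polynomial
  in \<open>W = N ^ m\<close> times \<open>r ^ (W div q)\<close> with \<open>r < 1\<close>. Only
  distinct bad cubes can be counted, since a curve may linger in a single one; this is the origin of
  the case in which many cells share few bad cubes.\<close>

lemma measure_bernoulli_product_none:
  fixes p :: real
  assumes "0 \<le> p" "p \<le> 1" "finite C" "C \<subseteq> I"
  defines "M \<equiv> (\<Pi>\<^sub>M i\<in>I. measure_pmf (bernoulli_pmf p))"
  shows "measure M {\<omega> \<in> space M. \<forall>i\<in>C. \<not> \<omega> i} = (1 - p) ^ card C"
proof -
  interpret product_prob_space "\<lambda>i. measure_pmf (bernoulli_pmf p)" I
    by unfold_locales
  have "{\<omega> \<in> space M. \<forall>i\<in>C. \<not> \<omega> i} = prod_emb I (\<lambda>_. measure_pmf (bernoulli_pmf p)) C (Pi\<^sub>E C (\<lambda>_. {False}))"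
    using assms by (subst prod_emb_PiE) (auto simp: M_def space_PiM PiE_iff extensional_def split: if_splits)
  then have "measure M {\<omega> \<in> space M. \<forall>i\<in>C. \<not> \<omega> i}
      = (\<Prod>i\<in>C. measure (measure_pmf (bernoulli_pmf p)) {False})"
    unfolding M_def using assms by (subst measure_PiM_emb[symmetric]) (auto simp: M_def)
  also have "\<dots> = (1 - p) ^ card C"
    using assms by (simp add: measure_pmf_single)
  finally show ?thesis .
qed

text \<open>With \<open>count_space UNIV\<close> as target, a coordinate is a measurable predicate,
  so the \<open>pred_intros\<close> rules apply to hit events.\<close>

lemma measurable_bernoulli_coordinate:
  assumes "i \<in> I"
  shows "(\<lambda>\<omega>. \<omega> i) \<in> measurable (\<Pi>\<^sub>M i\<in>I. measure_pmf (bernoulli_pmf p)) (count_space UNIV)"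
proof -
  have "(\<lambda>\<omega>. \<omega> i) \<in> measurable (\<Pi>\<^sub>M i\<in>I. measure_pmf (bernoulli_pmf p)) (measure_pmf (bernoulli_pmf p))"
    using assms by (rule measurable_component_singleton)
  then show ?thesis
    by (simp add: measurable_def)
qed

text \<open>
  Induction on \<open>V\<close>: the event that \<open>B w\<close> is hit is the complement of a cylinder, which is absorbed
  into \<open>C\<close>. This replaces an appeal to independence.
\<close>

lemma measure_bernoulli_product_hit:
  fixes p :: real and B :: "'v \<Rightarrow> 'i set"
  assumes p: "0 \<le> p" "p \<le> 1" and V: "finite V" and C: "finite C" "C \<subseteq> I"
    and B: "\<And>v. v \<in> V \<Longrightarrow> finite (B v) \<and> B v \<subseteq> I \<and> B v \<inter> C = {}"
    and disj: "disjoint_family_on B V"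
  defines "M \<equiv> (\<Pi>\<^sub>M i\<in>I. measure_pmf (bernoulli_pmf p))"
  shows "measure M {\<omega> \<in> space M. (\<forall>v\<in>V. \<exists>i\<in>B v. \<omega> i) \<and> (\<forall>i\<in>C. \<not> \<omega> i)}
    = (1 - p) ^ card C * (\<Prod>v\<in>V. 1 - (1 - p) ^ card (B v))"
  using V C B disj
proof (induction V arbitrary: C rule: finite_induct)
  case empty
  then show ?case
    using measure_bernoulli_product_none[OF p, of C I] by (simp add: M_def)
next
  case (insert w V)
  interpret product_prob_space "\<lambda>i. measure_pmf (bernoulli_pmf p)" I
    by unfold_locales
  interpret M: prob_space M
    unfolding M_def by unfold_locales
  define G where "G D = {\<omega> \<in> space M. (\<forall>v\<in>V. \<exists>i\<in>B v. \<omega> i) \<and> (\<forall>i\<in>D. \<not> \<omega> i)}" for D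
  have comp: "(\<lambda>\<omega>. \<omega> i) \<in> measurable M (count_space UNIV)" if "i \<in> I" for i
    unfolding M_def using that by (rule measurable_bernoulli_coordinate)
  have G_sets: "G D \<in> sets M" if "finite D" "D \<subseteq> I" for D
  proof -
    have "Measurable.pred M (\<lambda>\<omega>. (\<forall>v\<in>V. \<exists>i\<in>B v. \<omega> i) \<and> (\<forall>i\<in>D. \<not> \<omega> i))"
      using insert.prems(3) insert.hyps that
      by (intro pred_intros_logic pred_intros_finite comp) auto
    then show ?thesis
      unfolding G_def by (rule predE)
  qed
  have wC: "card (C \<union> B w) = card C + card (B w)"
    using insert.prems by (subst card_Un_disjoint) (auto)
  have IH: "measure M (G D) = (1 - p) ^ card D * (\<Prod>v\<in>V. 1 - (1 - p) ^ card (B v))"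
    if "finite D" "D \<subseteq> I" "\<And>v. v \<in> V \<Longrightarrow> B v \<inter> D = {}" for D
    unfolding G_def using that insert.prems
    by (intro insert.IH) (auto simp: disjoint_family_on_def)
  have "{\<omega> \<in> space M. (\<forall>v\<in>insert w V. \<exists>i\<in>B v. \<omega> i) \<and> (\<forall>i\<in>C. \<not> \<omega> i)} = G C - G (C \<union> B w)"
    by (auto simp: G_def)
  moreover have "G (C \<union> B w) \<subseteq> G C"
    by (auto simp: G_def)
  moreover have "finite (C \<union> B w)" "C \<union> B w \<subseteq> I"
    using insert.prems by auto
  moreover have "B v \<inter> (C \<union> B w) = {}" if "v \<in> V" for v
    using insert.prems insert.hyps that unfolding disjoint_family_on_def
    by (metis Int_Un_distrib Un_empty insert_iff)
  ultimately have "measure M {\<omega> \<in> space M. (\<forall>v\<in>insert w V. \<exists>i\<in>B v. \<omega> i) \<and> (\<forall>i\<in>C. \<not> \<omega> i)}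
      = measure M (G C) - measure M (G (C \<union> B w))"
    using G_sets insert.prems by (simp add: M.finite_measure_Diff)
  also have "\<dots> = (1 - p) ^ card C * (\<Prod>v\<in>V. 1 - (1 - p) ^ card (B v))
      - (1 - p) ^ card (C \<union> B w) * (\<Prod>v\<in>V. 1 - (1 - p) ^ card (B v))"
    using insert.prems \<open>finite (C \<union> B w)\<close> \<open>C \<union> B w \<subseteq> I\<close> \<open>\<And>v. v \<in> V \<Longrightarrow> B v \<inter> (C \<union> B w) = {}\<close>
    by (subst (1 2) IH) auto
  also have "\<dots> = (1 - p) ^ card C * (\<Prod>v\<in>insert w V. 1 - (1 - p) ^ card (B v))"
    using insert.hyps by (simp add: wC power_add algebra_simps)
  finally show ?case .
qed

section \<open>Grid cubes and the cubes that meet at a grid vertex\<close>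

definition grid_cube :: "nat \<Rightarrow> nat \<Rightarrow> ('d::finite \<Rightarrow> nat) \<Rightarrow> (real ^ 'd) set" where
  "grid_cube N h l = cbox (\<chi> i. (real (l i) - 1) / real N ^ h) (\<chi> i. real (l i) / real N ^ h)"

text \<open>In units of \<open>N ^ -h\<close> the cube \<open>l\<close> occupies
  \<open>[l i - 1, l i]\<close> in coordinate \<open>i\<close>, so the integer point
  \<open>v\<close> lies in it exactly when each \<open>l i\<close> is \<open>v i\<close> or
  \<open>v i + 1\<close>. Points \<open>v\<close> outside the unit cube are allowed and have no
  cubes.\<close>

definition vertex_cubes :: "nat \<Rightarrow> nat \<Rightarrow> ('d::finite \<Rightarrow> int) \<Rightarrow> (real ^ 'd) set set" where
  "vertex_cubes N h v =
     grid_cube N h ` {l. \<forall>i. l i \<in> {1..N ^ h} \<and> (int (l i) = v i \<or> int (l i) = v i + 1)}"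

definition hit :: "nat \<Rightarrow> nat \<Rightarrow> ((real ^ 'd) set \<Rightarrow> bool) \<Rightarrow> ('d::finite \<Rightarrow> int) \<Rightarrow> bool" where
  "hit N h \<omega> v \<longleftrightarrow> (\<exists>Q\<in>vertex_cubes N h v. \<omega> Q)"

abbreviation percolation_product :: "nat \<Rightarrow> real \<Rightarrow> ((real ^ 'd::finite) set \<Rightarrow> bool) measure" where
  "percolation_product N p \<equiv> (\<Pi>\<^sub>M Q\<in>(\<Union>n. grid_cubes N n). measure_pmf (bernoulli_pmf p))"

lemma grid_cubes_eq: "grid_cubes N n = {grid_cube N n l | l. \<forall>i. l i \<in> {1..N ^ n}}"
  by (simp add: grid_cubes_def grid_cube_def)

text \<open>Labels belong to cubes as sets, so disjoint sets of indices give disjoint sets of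
  coordinates only through this injectivity.\<close>

lemma grid_cube_inj:
  assumes "N > 0" "grid_cube N h l = grid_cube N h l'"
  shows "l = l'"
proof -
  have pos: "real N ^ h > 0"
    using assms by simp
  have ne: "grid_cube N h l \<noteq> {}"
    using pos by (auto simp: grid_cube_def interval_ne_empty_cart divide_right_mono)
  then have "(\<chi> i. real (l i) / real N ^ h) = (\<chi> i. real (l' i) / real N ^ h)"
    using assms(2) eq_cbox unfolding grid_cube_def by metis
  then show ?thesis
    using pos by (auto simp: vec_eq_iff fun_eq_iff)
qed

lemma card_pair_choices_le:
  fixes v :: "'d::finite \<Rightarrow> int"
  shows "finite {l::'d \<Rightarrow> nat. \<forall>i. P (l i) \<and> (int (l i) = v i \<or> int (l i) = v i + 1)}"
    and "card {l::'d \<Rightarrow> nat. \<forall>i. P (l i) \<and> (int (l i) = v i \<or> int (l i) = v i + 1)} \<le> 2 ^ CARD('d)"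
proof -
  let ?S = "{l::'d \<Rightarrow> nat. \<forall>i. P (l i) \<and> (int (l i) = v i \<or> int (l i) = v i + 1)}"
  let ?T = "PiE (UNIV :: 'd set) (\<lambda>i. {nat (v i), nat (v i + 1)})"
  have sub: "?S \<subseteq> ?T"
    by (auto simp: PiE_iff) (metis nat_int)
  have fin: "finite ?T"
    by (intro finite_PiE) auto
  have "card ?T = (\<Prod>i\<in>UNIV. card {nat (v i), nat (v i + 1)})"
    by (simp add: card_PiE)
  also have "\<dots> \<le> (\<Prod>i\<in>(UNIV::'d set). 2)"
    by (intro prod_mono) (auto simp: card_insert_if)
  finally have "card ?T \<le> 2 ^ CARD('d)"
    by simp
  then show "card ?S \<le> 2 ^ CARD('d)"
    using card_mono[OF fin sub] by linarith
  show "finite ?S"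
    using sub fin by (rule finite_subset)
qed

lemma finite_vertex_cubes: "finite (vertex_cubes N h v)"
  unfolding vertex_cubes_def by (intro finite_imageI card_pair_choices_le)

lemma card_vertex_cubes_le: "card (vertex_cubes N h (v :: 'd::finite \<Rightarrow> int)) \<le> 2 ^ CARD('d)"
  unfolding vertex_cubes_def
  by (rule order_trans[OF card_image_le[OF card_pair_choices_le(1)] card_pair_choices_le(2)])

lemma vertex_cubes_subset: "vertex_cubes N h v \<subseteq> (\<Union>n. grid_cubes N n)"
  unfolding vertex_cubes_def grid_cubes_eq by auto

text \<open>Two vertices of a common cube differ by at most 1 in each coordinate; with equal
  parities they coincide.\<close>

lemma vertex_cubes_disjoint:
  assumes "N > 0" "v \<noteq> v'" "\<And>i. v i mod 2 = v' i mod 2"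
  shows "vertex_cubes N h v \<inter> vertex_cubes N h v' = {}"
proof -
  have False if l: "\<And>i. int (l i) = v i \<or> int (l i) = v i + 1" "\<And>i. int (l i) = v' i \<or> int (l i) = v' i + 1"
    for l
  proof -
    have "v i = v' i" for i
      using l(1)[of i] l(2)[of i] assms(3)[of i] by presburger
    then show False
      using assms(2) by (auto simp: fun_eq_iff)
  qed
  then show ?thesis
    unfolding vertex_cubes_def by (fastforce dest!: grid_cube_inj[OF assms(1)])
qed

lemma hit_measurable [measurable]: "Measurable.pred (percolation_product N p) (\<lambda>\<omega>. hit N h \<omega> v)"
proof -
  have "(\<lambda>\<omega>. \<omega> Q) \<in> measurable (percolation_product N p) (count_space UNIV)" if "Q \<in> vertex_cubes N h v" for Q
    using that vertex_cubes_subset[of N h v] by (intro measurable_bernoulli_coordinate) auto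
  then show ?thesis
    unfolding hit_def using finite_vertex_cubes by (intro pred_intros_finite) auto
qed

lemma prob_space_percolation_product: "prob_space (percolation_product N p)"
  by (intro prob_space_PiM prob_space_measure_pmf)

text \<open>
  Blocks of cubes at vertices of equal parity are disjoint, and some parity class contains a fraction
  of at least \<open>2 ^ (-d)\<close> of the vertices.
\<close>

lemma prob_all_hit_le:
  fixes V :: "('d::finite \<Rightarrow> int) set"
  assumes N: "N > 0" and p: "0 \<le> p" "p \<le> 1" and V: "finite V"
    and r: "0 \<le> r" "r \<le> 1" "1 - (1 - p) ^ (2 ^ CARD('d)) \<le> r ^ (2 ^ CARD('d))"
  shows "measure (percolation_product N p) {\<omega> \<in> space (percolation_product N p). \<forall>v\<in>V. hit N h \<omega> v} \<le> r ^ card V"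
proof -
  let ?M = "percolation_product N p :: ((real ^ 'd) set \<Rightarrow> bool) measure"
  interpret prob_space ?M
    by (rule prob_space_percolation_product)
  define par where "par = (\<lambda>(v :: 'd \<Rightarrow> int) i. v i mod 2)"
  let ?P = "PiE (UNIV :: 'd set) (\<lambda>_. {0, 1 :: int})"
  have par: "par \<in> V \<rightarrow> ?P"
    by (auto simp: par_def PiE_def) 
  have finP: "finite ?P" and cardP: "card ?P = 2 ^ CARD('d)"
    by (auto intro!: finite_PiE simp: card_PiE numeral_2_eq_2)
  have "\<exists>e\<in>?P. card V \<le> card (par -` {e} \<inter> V) * card ?P"
  proof (rule ccontr)
    assume "\<not> ?thesis"
    then have less: "card (par -` {e} \<inter> V) * card ?P < card V" if "e \<in> ?P" for e
      using that by (meson not_le)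
    have ne: "?P \<noteq> {}"
      by auto
    have "card V = (\<Sum>e\<in>?P. card (par -` {e} \<inter> V))"
    proof -
      have "V = (\<Union>e\<in>?P. par -` {e} \<inter> V)"
        using par by auto
      then have "card V = card (\<Union>e\<in>?P. par -` {e} \<inter> V)"
        by simp
      also have "\<dots> = (\<Sum>e\<in>?P. card (par -` {e} \<inter> V))"
        using V finP by (intro card_UN_disjoint) auto
      finally show ?thesis .
    qed
    then have "card V * card ?P = (\<Sum>e\<in>?P. card (par -` {e} \<inter> V) * card ?P)"
      by (simp add: sum_distrib_right)
    also have "\<dots> < (\<Sum>e\<in>?P. card V)"
      using less finP ne by (intro sum_strict_mono) auto
    finally show False
      by (simp add: mult.commute)
  qed
  then obtain e where e: "card V \<le> card (par -` {e} \<inter> V) * 2 ^ CARD('d)"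
    using cardP by auto
  define V' where "V' = par -` {e} \<inter> V"
  have disj: "disjoint_family_on (vertex_cubes N h) V'"
    unfolding disjoint_family_on_def V'_def par_def
    using vertex_cubes_disjoint[OF N] by (smt (verit) IntE vimage_singleton_eq)
  have "measure ?M {\<omega> \<in> space ?M. \<forall>v\<in>V. hit N h \<omega> v} \<le> measure ?M {\<omega> \<in> space ?M. \<forall>v\<in>V'. hit N h \<omega> v}"
    using V by (intro finite_measure_mono) (auto simp: V'_def)
  also have "\<dots> = (\<Prod>v\<in>V'. 1 - (1 - p) ^ card (vertex_cubes N h v))"
  proof -
    have "measure ?M {\<omega> \<in> space ?M. (\<forall>v\<in>V'. \<exists>Q\<in>vertex_cubes N h v. \<omega> Q) \<and> (\<forall>Q\<in>{}. \<not> \<omega> Q)}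
        = (1 - p) ^ card ({} :: (real ^ 'd) set set) * (\<Prod>v\<in>V'. 1 - (1 - p) ^ card (vertex_cubes N h v))"
      using disj V
      by (intro measure_bernoulli_product_hit[OF p]) (auto simp: V'_def finite_vertex_cubes vertex_cubes_subset[THEN subsetD, simplified])
    then show ?thesis
      by (simp add: hit_def)
  qed
  \<comment> \<open>A vertex has at most \<open>2 ^ CARD('d)\<close> cubes, fewer at the boundary,
    where a hit is even less likely. The exponent on \<open>r\<close> pays for keeping only the
    class \<open>V'\<close>.\<close>
  also have "\<dots> \<le> (\<Prod>v\<in>V'. r ^ (2 ^ CARD('d)))"
  proof (intro prod_mono conjI)
    fix v :: "'d \<Rightarrow> int"
    show "0 \<le> 1 - (1 - p) ^ card (vertex_cubes N h v)"
      using p by (simp add: power_le_one)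
    have "(1 - p) ^ (2 ^ CARD('d)) \<le> (1 - p) ^ card (vertex_cubes N h v)"
      using p card_vertex_cubes_le[of N h v] by (intro power_decreasing) auto
    then show "1 - (1 - p) ^ card (vertex_cubes N h v) \<le> r ^ (2 ^ CARD('d))"
      using r by linarith
  qed
  also have "\<dots> = r ^ (card V' * 2 ^ CARD('d))"
    by (simp add: power_mult[symmetric] mult.commute)
  also have "\<dots> \<le> r ^ card V"
    using r e by (intro power_decreasing) (auto simp: V'_def)
  finally show ?thesis .
qed

section \<open>Bad cubes\<close>

text \<open>
  In units of the fine grid of level \<open>n + m\<close>, with \<open>W = N ^ m\<close>, the pair \<open>(b, c)\<close> encodes the points
  \<open>(b + j * c / W) / 16\<close>, \<open>j < W\<close>, on a line segment, and \<^term>\<open>track W b c j\<close> is a nearest grid vertex. The cube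
  of index \<open>z\<close> and level \<open>n\<close> is \<open>W * z + [0, W]\<close> in these units. The last condition in \<open>params\<close>
  makes the vertices for multiples \<open>j\<close> of \<open>q\<close> distinct.
\<close>

definition track :: "nat \<Rightarrow> ('d \<Rightarrow> int) \<Rightarrow> ('d \<Rightarrow> int) \<Rightarrow> nat \<Rightarrow> 'd \<Rightarrow> int" where
  "track W b c j = (\<lambda>i. round ((real_of_int (b i) + real j * real_of_int (c i) / real W) / 16))"

definition params :: "nat \<Rightarrow> nat \<Rightarrow> nat \<Rightarrow> ('d \<Rightarrow> int) \<Rightarrow> (('d \<Rightarrow> int) \<times> ('d \<Rightarrow> int)) set" where
  "params W D q z = {(b, c).
     (\<forall>i. \<bar>b i - 16 * int W * z i\<bar> \<le> 16 * int W * int D \<and> \<bar>c i\<bar> \<le> 16 * int W * int D) \<and>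
     (\<exists>i. 32 * int W \<le> int q * \<bar>c i\<bar>)}"

definition traces :: "nat \<Rightarrow> nat \<Rightarrow> nat \<Rightarrow> ('d \<Rightarrow> int) \<Rightarrow> ('d \<Rightarrow> int) set set" where
  "traces W D q z = (\<lambda>(b, c). (\<lambda>r. track W b c (q * r)) ` {..<W div q}) ` params W D q z"

text \<open>Segments count as near the cube if start and displacement are at most \<open>D\<close>
  sides of the cube per coordinate. If \<open>z\<close> is not bad, every steep segment near it has
  an untouched vertex, whichever map the segment came from.\<close>

definition bad :: "nat \<Rightarrow> nat \<Rightarrow> nat \<Rightarrow> nat \<Rightarrow> nat \<Rightarrow> ((real ^ 'd) set \<Rightarrow> bool) \<Rightarrow> ('d::finite \<Rightarrow> int) \<Rightarrow> bool" where
  "bad N n m D q \<omega> z \<longleftrightarrow> (\<exists>V\<in>traces (N ^ m) D q z. \<forall>v\<in>V. hit N (n + m) \<omega> v)"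

text \<open>Consecutive samples move by at least 2 in the steep coordinate, while rounding moves
  each by at most 1/2, so no two samples share a vertex.\<close>

lemma card_trace:
  assumes "V \<in> traces W D q z" "W > 0"
  shows "card V = W div q"
proof -
  obtain b c where V: "V = (\<lambda>r. track W b c (q * r)) ` {..<W div q}" and "(b, c) \<in> params W D q z"
    using assms unfolding traces_def by auto
  then obtain i where i: "32 * int W \<le> int q * \<bar>c i\<bar>"
    by (auto simp: params_def)
  have "32 * real W \<le> real q * \<bar>real_of_int (c i)\<bar>"
    using i by (metis (mono_tags, opaque_lifting) of_int_abs of_int_le_iff of_int_mult of_int_numeral of_int_of_nat_eq)
  then have step: "2 \<le> real q * \<bar>real_of_int (c i)\<bar> / real W / 16"
    using assms by (simp add: field_simps)
  have neq: "track W b c (q * r) \<noteq> track W b c (q * s)" if "r < s" for r s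
  proof -
    define x where "x r = (real_of_int (b i) + real (q * r) * real_of_int (c i) / real W) / 16" for r :: nat
    have "x s - x r = real (s - r) * (real q * real_of_int (c i) / real W / 16)"
      using that by (simp add: x_def of_nat_diff diff_divide_distrib add_divide_distrib algebra_simps)
    then have "\<bar>x s - x r\<bar> = real (s - r) * (real q * \<bar>real_of_int (c i)\<bar> / real W / 16)"
      by (simp add: abs_mult)
    also have "\<dots> \<ge> 1 * 2"
      using that step by (intro mult_mono) auto
    finally have "\<bar>x s - x r\<bar> \<ge> 2"
      by simp
    then have "round (x s) \<noteq> round (x r)"
      using of_int_round_abs_le[of "x s"] of_int_round_abs_le[of "x r"] by (auto simp: abs_le_iff abs_if split: if_splits)
    then show ?thesis
      unfolding track_def x_def by metis
  qed
  have "inj (\<lambda>r. track W b c (q * r))"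
    by (rule injI) (metis neq linorder_neqE_nat)
  then show ?thesis
    by (simp add: V card_image inj_on_subset)
qed

lemma params_bounds:
  fixes z :: "'d::finite \<Rightarrow> int"
  shows finite_params: "finite (params W D q z)"
    and card_params_le: "card (params W D q z) \<le> (32 * W * D + 1) ^ (2 * CARD('d))"
proof -
  let ?B = "PiE (UNIV :: 'd set) (\<lambda>i. {16 * int W * z i - 16 * int W * int D..16 * int W * z i + 16 * int W * int D})"
  let ?C = "PiE (UNIV :: 'd set) (\<lambda>i. {- (16 * int W * int D)..16 * int W * int D})"
  have sub: "params W D q z \<subseteq> ?B \<times> ?C"
  proof (rule subsetI, clarify)
    fix b c assume bc: "(b, c) \<in> params W D q z"
    have "\<bar>b i - 16 * int W * z i\<bar> \<le> 16 * int W * int D" "\<bar>c i\<bar> \<le> 16 * int W * int D" for i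
      using bc by (auto simp: params_def)
    then show "b \<in> ?B \<and> c \<in> ?C"
      by (simp add: PiE_iff abs_le_iff) (smt (verit))
  qed
  have fin: "finite (?B \<times> ?C)"
    by (intro finite_SigmaI finite_PiE) auto
  have "card (?B \<times> ?C) = (32 * W * D + 1) ^ CARD('d) * (32 * W * D + 1) ^ CARD('d)"
    by (simp add: card_cartesian_product card_PiE nat_add_distrib nat_mult_distrib algebra_simps)
  also have "\<dots> = (32 * W * D + 1) ^ (2 * CARD('d))"
    by (simp add: power_add[symmetric] mult_2)
  finally show "card (params W D q z) \<le> (32 * W * D + 1) ^ (2 * CARD('d))"
    using card_mono[OF fin sub] by simp
  show "finite (params W D q z)"
    using sub fin by (rule finite_subset)
qed

lemma finite_traces: "finite (traces W D q (z :: 'd::finite \<Rightarrow> int))"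
  unfolding traces_def by (intro finite_imageI finite_params)

lemma card_traces_le: "card (traces W D q (z :: 'd::finite \<Rightarrow> int)) \<le> (32 * W * D + 1) ^ (2 * CARD('d))"
  unfolding traces_def by (rule order_trans[OF card_image_le[OF finite_params] card_params_le])

lemma finite_trace: "V \<in> traces W D q z \<Longrightarrow> finite V"
  unfolding traces_def by auto

text \<open>The start is within \<open>W * D\<close> of \<open>W * z\<close>, the displacement is at
  most \<open>W * D\<close>, and rounding costs at most \<open>W\<close>. This locality bounds how
  many cubes can compete for one vertex.\<close>

lemma trace_near:
  assumes "V \<in> traces W D q z" "v \<in> V" "W > 0"
  shows "\<bar>v i - int W * z i\<bar> \<le> int W * (2 * int D + 1)"
proof -
  obtain b c r where v: "v = track W b c (q * r)" and bc: "(b, c) \<in> params W D q z" and r: "r < W div q"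
    using assms unfolding traces_def by auto
  have jW: "q * r \<le> W"
    using r mult_le_mono2[of r "W div q" q] times_div_less_eq_dividend[of q W] by linarith
  define x where "x = (real_of_int (b i) + real (q * r) * real_of_int (c i) / real W) / 16"
  have "\<bar>b i - 16 * int W * z i\<bar> \<le> 16 * int W * int D" "\<bar>c i\<bar> \<le> 16 * int W * int D"
    using bc by (auto simp: params_def)
  then have "real_of_int \<bar>b i - 16 * int W * z i\<bar> \<le> real_of_int (16 * int W * int D)"
    "real_of_int \<bar>c i\<bar> \<le> real_of_int (16 * int W * int D)"
    unfolding of_int_le_iff .
  then have b: "\<bar>real_of_int (b i) - 16 * real W * real_of_int (z i)\<bar> \<le> 16 * real W * real D"
    and c: "\<bar>real_of_int (c i)\<bar> \<le> 16 * real W * real D"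
    by simp_all
  have "\<bar>real (q * r) * real_of_int (c i) / real W\<bar> = real (q * r) / real W * \<bar>real_of_int (c i)\<bar>"
    by (simp add: abs_mult)
  also have "\<dots> \<le> 1 * \<bar>real_of_int (c i)\<bar>"
    using jW assms(3) by (intro mult_right_mono) (auto simp: divide_le_eq simp flip: of_nat_mult)
  finally have "\<bar>real (q * r) * real_of_int (c i) / real W\<bar> \<le> 16 * real W * real D"
    using c by linarith
  have "\<bar>x - real W * real_of_int (z i)\<bar> \<le> 2 * (real W * real D)"
  proof -
    have "\<bar>(B + Y) / 16 - V\<bar> \<le> 2 * E" if "\<bar>Y\<bar> \<le> 16 * E" "\<bar>B - 16 * V\<bar> \<le> 16 * E" for B Y V E :: real
      using that by argo
    then show ?thesis
      using b \<open>\<bar>real (q * r) * real_of_int (c i) / real W\<bar> \<le> 16 * real W * real D\<close>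
      unfolding x_def mult.assoc by blast
  qed
  moreover have "\<bar>real_of_int (v i) - x\<bar> \<le> 1 / 2"
    using of_int_round_abs_le[of x] by (simp add: v track_def x_def)
  moreover have "1 \<le> real W"
    using assms(3) by simp
  ultimately have "\<bar>real_of_int (v i) - real W * real_of_int (z i)\<bar> \<le> 2 * (real W * real D) + real W"
    by linarith
  then have "real_of_int \<bar>v i - int W * z i\<bar> \<le> real_of_int (int W * (2 * int D + 1))"
    by (simp add: algebra_simps)
  then show ?thesis
    by linarith
qed

text \<open>Each \<open>z i\<close> is within \<open>2 * D + 1\<close> of \<open>v i div W\<close>,
  an interval of \<open>4 * D + 3\<close> integers.\<close>

lemma card_near_le:
  fixes v :: "'d::finite \<Rightarrow> int"
  assumes "W > 0"
  shows "finite {z. \<forall>i. \<bar>v i - int W * z i\<bar> \<le> int W * (2 * int D + 1)}"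
    and "card {z. \<forall>i. \<bar>v i - int W * z i\<bar> \<le> int W * (2 * int D + 1)} \<le> (4 * D + 3) ^ CARD('d)"
proof -
  let ?Z = "{z. \<forall>i. \<bar>v i - int W * z i\<bar> \<le> int W * (2 * int D + 1)}"
  let ?P = "PiE (UNIV :: 'd set) (\<lambda>i. {v i div int W - (2 * int D + 1)..v i div int W + (2 * int D + 1)})"
  have "v i div int W - (2 * int D + 1) \<le> z i \<and> z i \<le> v i div int W + (2 * int D + 1)"
    if "\<bar>v i - int W * z i\<bar> \<le> int W * (2 * int D + 1)" for z i
  proof
    have "int W * (z i - (2 * int D + 1)) \<le> v i" "v i \<le> int W * (z i + (2 * int D + 1))"
      using that by (simp_all add: algebra_simps abs_le_iff)
    then have "int W * (z i - (2 * int D + 1)) div int W \<le> v i div int W"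
      "v i div int W \<le> int W * (z i + (2 * int D + 1)) div int W"
      using assms by (intro zdiv_mono1; simp)+
    then show "v i div int W - (2 * int D + 1) \<le> z i" "z i \<le> v i div int W + (2 * int D + 1)"
      using assms by simp_all
  qed
  then have sub: "?Z \<subseteq> ?P"
    by (auto simp: PiE_iff)
  have fin: "finite ?P"
    by (intro finite_PiE) auto
  have "card ?P = (4 * D + 3) ^ CARD('d)"
    by (simp add: card_PiE nat_add_distrib nat_mult_distrib algebra_simps)
  then show "card ?Z \<le> (4 * D + 3) ^ CARD('d)"
    using card_mono[OF fin sub] by simp
  show "finite ?Z"
    using sub fin by (rule finite_subset)
qed

text \<open>Traces of neighbouring cubes may share vertices. Counting incidences of cubes and
  vertices in both ways bounds the loss, since a vertex is near at most
  \<open>(4 * D + 3) ^ CARD('d)\<close> cubes.\<close>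

lemma card_UN_traces_ge:
  fixes S :: "('d::finite \<Rightarrow> int) set"
  assumes "finite S" "W > 0" "\<And>z. z \<in> S \<Longrightarrow> \<sigma> z \<in> traces W D q z"
  shows "card S * (W div q) \<le> (4 * D + 3) ^ CARD('d) * card (\<Union>z\<in>S. \<sigma> z)"
proof -
  let ?U = "\<Union>z\<in>S. \<sigma> z"
  let ?F = "\<lambda>v. {z \<in> S. v \<in> \<sigma> z}"
  have finU: "finite ?U"
    using assms finite_trace by blast
  have le: "card (?F v) \<le> (4 * D + 3) ^ CARD('d)" for v
  proof -
    have "?F v \<subseteq> {z. \<forall>i. \<bar>v i - int W * z i\<bar> \<le> int W * (2 * int D + 1)}"
      using trace_near[OF assms(3) _ assms(2)] by blast
    then show ?thesis
      by (rule order_trans[OF card_mono[OF card_near_le(1)[OF assms(2)]] card_near_le(2)[OF assms(2)]])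
  qed
  have "card S * (W div q) = (\<Sum>z\<in>S. card (\<sigma> z))"
    using assms card_trace by (simp add: card_trace[OF assms(3) assms(2)])
  also have "\<dots> = card (SIGMA z:S. \<sigma> z)"
    using assms(1) finite_trace[OF assms(3)] by (subst card_SigmaI) auto
  also have "\<dots> \<le> card (SIGMA v:?U. ?F v)"
    using finU assms(1) by (intro card_inj_on_le[of prod.swap]) auto
  also have "\<dots> = (\<Sum>v\<in>?U. card (?F v))"
    using finU assms(1) by (subst card_SigmaI) auto
  also have "\<dots> \<le> (\<Sum>v\<in>?U. (4 * D + 3) ^ CARD('d))"
    using le by (intro sum_mono) auto
  finally show ?thesis
    by (simp add: mult.commute)
qed

lemma bad_measurable [measurable]: "Measurable.pred (percolation_product N p) (\<lambda>\<omega>. bad N n m D q \<omega> z)"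
  unfolding bad_def by (intro pred_intros_finite finite_traces finite_trace hit_measurable)

text \<open>Union bound over all choices of one trace for each cube of \<open>S\<close>. For a fixed
  choice, the exponent \<open>(4 * D + 3) ^ CARD('d)\<close> in the condition on \<open>r\<close>
  compensates the vertices shared between traces.\<close>

lemma prob_all_bad_le:
  fixes S :: "('d::finite \<Rightarrow> int) set"
  assumes N: "N > 0" and p: "0 \<le> p" "p \<le> 1" and S: "finite S"
    and r: "0 \<le> r" "r \<le> 1"
      "1 - (1 - p) ^ (2 ^ CARD('d)) \<le> (r ^ ((4 * D + 3) ^ CARD('d))) ^ (2 ^ CARD('d))"
  shows "measure (percolation_product N p) {\<omega> \<in> space (percolation_product N p). \<forall>z\<in>S. bad N n m D q \<omega> z}
    \<le> (real ((32 * N ^ m * D + 1) ^ (2 * CARD('d))) * r ^ (N ^ m div q)) ^ card S"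
proof -
  let ?M = "percolation_product N p :: ((real ^ 'd) set \<Rightarrow> bool) measure"
  interpret prob_space ?M
    by (rule prob_space_percolation_product)
  let ?T = "traces (N ^ m) D q :: ('d \<Rightarrow> int) \<Rightarrow> ('d \<Rightarrow> int) set set"
  define R :: nat where "R = (4 * D + 3) ^ CARD('d)"
  define H where "H \<sigma> = {\<omega> \<in> space ?M. \<forall>v\<in>(\<Union>z\<in>S. \<sigma> z). hit N (n + m) \<omega> v}" for \<sigma>
  have W: "N ^ m > 0"
    using N by simp
  have fin: "finite (PiE S ?T)"
    using S finite_traces by (intro finite_PiE)
  have finU: "finite (\<Union>z\<in>S. \<sigma> z)" if "\<sigma> \<in> PiE S ?T" for \<sigma>
    using that S finite_trace by (force simp: PiE_iff)
  have H_sets: "H \<sigma> \<in> sets ?M" if "\<sigma> \<in> PiE S ?T" for \<sigma>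
    unfolding H_def using finU[OF that] by (intro predE pred_intros_finite hit_measurable)
  have "{\<omega> \<in> space ?M. \<forall>z\<in>S. bad N n m D q \<omega> z} \<subseteq> (\<Union>\<sigma>\<in>PiE S ?T. H \<sigma>)"
  proof
    fix \<omega> assume \<omega>: "\<omega> \<in> {\<omega> \<in> space ?M. \<forall>z\<in>S. bad N n m D q \<omega> z}"
    then have "\<forall>z\<in>S. \<exists>V\<in>?T z. \<forall>v\<in>V. hit N (n + m) \<omega> v"
      by (auto simp: bad_def)
    then obtain \<sigma> where "\<sigma> \<in> PiE S ?T" "\<forall>z\<in>S. \<forall>v\<in>\<sigma> z. hit N (n + m) \<omega> v"
      unfolding PiE_choice by blast
    then show "\<omega> \<in> (\<Union>\<sigma>\<in>PiE S ?T. H \<sigma>)"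
      using \<omega> by (auto simp: H_def)
  qed
  then have "prob {\<omega> \<in> space ?M. \<forall>z\<in>S. bad N n m D q \<omega> z} \<le> prob (\<Union>\<sigma>\<in>PiE S ?T. H \<sigma>)"
    using fin H_sets by (intro finite_measure_mono sets.finite_UN)
  also have "\<dots> \<le> (\<Sum>\<sigma>\<in>PiE S ?T. prob (H \<sigma>))"
    using fin H_sets by (intro finite_measure_subadditive_finite) auto
  also have "\<dots> \<le> (\<Sum>\<sigma>\<in>PiE S ?T. r ^ (card S * (N ^ m div q)))"
  proof (rule sum_mono)
    fix \<sigma> assume \<sigma>: "\<sigma> \<in> PiE S ?T"
    then have U: "card S * (N ^ m div q) \<le> R * card (\<Union>z\<in>S. \<sigma> z)"
      unfolding R_def using S W by (intro card_UN_traces_ge) (auto simp: PiE_iff)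
    have "prob (H \<sigma>) \<le> (r ^ R) ^ card (\<Union>z\<in>S. \<sigma> z)"
      unfolding H_def using N p r finU[OF \<sigma>]
      by (intro prob_all_hit_le) (auto simp: R_def power_le_one)
    also have "\<dots> \<le> r ^ (card S * (N ^ m div q))"
      unfolding power_mult[symmetric] using U r by (intro power_decreasing) auto
    finally show "prob (H \<sigma>) \<le> r ^ (card S * (N ^ m div q))" .
  qed
  also have "\<dots> = real (card (PiE S ?T)) * (r ^ (N ^ m div q)) ^ card S"
    by (simp add: power_mult[symmetric] mult.commute)
  also have "\<dots> \<le> real ((32 * N ^ m * D + 1) ^ (2 * CARD('d))) ^ card S * (r ^ (N ^ m div q)) ^ card S"
  proof (intro mult_right_mono zero_le_power r)
    have "card (PiE S ?T) = (\<Prod>z\<in>S. card (?T z))"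
      using S by (rule card_PiE)
    also have "\<dots> \<le> (\<Prod>z\<in>S. (32 * N ^ m * D + 1) ^ (2 * CARD('d)))"
      using card_traces_le by (intro prod_mono) auto
    finally show "real (card (PiE S ?T)) \<le> real ((32 * N ^ m * D + 1) ^ (2 * CARD('d))) ^ card S"
      unfolding of_nat_power[symmetric] of_nat_le_iff by simp
  qed
  finally show ?thesis
    by (simp add: power_mult_distrib)
qed

section \<open>Chains of cubes\<close>

text \<open>Chains are listed with the last cube first.\<close>

fun paths :: "nat \<Rightarrow> nat \<Rightarrow> nat \<Rightarrow> ('d::finite \<Rightarrow> int) list set" where
  "paths D G 0 = {[]}"
| "paths D G (Suc 0) = (\<lambda>z. [z]) ` {z. \<forall>i. \<bar>z i\<bar> \<le> int G}"
| "paths D G (Suc (Suc M)) =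
    (\<lambda>(xs, e). (\<lambda>i. hd xs i + e i) # xs) ` (paths D G (Suc M) \<times> {e. \<forall>i. \<bar>e i\<bar> \<le> int D})"

lemma int_box_eq: "{z :: 'd::finite \<Rightarrow> int. \<forall>i. \<bar>z i\<bar> \<le> int G} = PiE UNIV (\<lambda>_. {- int G..int G})"
  by (simp add: set_eq_iff PiE_iff abs_le_iff) (metis minus_le_iff)

lemma finite_int_box: "finite {z :: 'd::finite \<Rightarrow> int. \<forall>i. \<bar>z i\<bar> \<le> int G}"
  unfolding int_box_eq by (intro finite_PiE) auto

lemma card_int_box: "card {z :: 'd::finite \<Rightarrow> int. \<forall>i. \<bar>z i\<bar> \<le> int G} = (2 * G + 1) ^ CARD('d)"
  unfolding int_box_eq by (simp add: card_PiE nat_add_distrib nat_mult_distrib)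

lemma paths_bounds:
  shows finite_paths: "finite (paths D G M :: ('d::finite \<Rightarrow> int) list set)"
    and card_paths_le: "card (paths D G M :: ('d \<Rightarrow> int) list set)
      \<le> (2 * G + 1) ^ CARD('d) * ((2 * D + 1) ^ CARD('d)) ^ M"
proof -
  have "finite (paths D G M :: ('d \<Rightarrow> int) list set) \<and> card (paths D G M :: ('d \<Rightarrow> int) list set)
      \<le> (2 * G + 1) ^ CARD('d) * ((2 * D + 1) ^ CARD('d)) ^ M"
  proof (induction D G M rule: paths.induct)
    case (1 D G)
    then show ?case by simp
  next
    case (2 D G)
    have "card (paths D G (Suc 0) :: ('d \<Rightarrow> int) list set) \<le> (2 * G + 1) ^ CARD('d) * 1"
      by (simp, rule order_trans[OF card_image_le[OF finite_int_box]]) (simp add: card_int_box)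
    also have "\<dots> \<le> (2 * G + 1) ^ CARD('d) * ((2 * D + 1) ^ CARD('d)) ^ Suc 0"
      by (intro mult_left_mono) auto
    finally show ?case
      by (simp add: finite_int_box)
  next
    case (3 D G M)
    let ?A = "(paths D G (Suc M) :: ('d \<Rightarrow> int) list set) \<times> {e :: 'd \<Rightarrow> int. \<forall>i. \<bar>e i\<bar> \<le> int D}"
    have fin: "finite ?A"
      using 3 by (intro finite_cartesian_product finite_int_box) blast
    have "card (paths D G (Suc (Suc M)) :: ('d \<Rightarrow> int) list set) \<le> card ?A"
      unfolding paths.simps by (rule card_image_le[OF fin])
    also have "\<dots> = card (paths D G (Suc M) :: ('d \<Rightarrow> int) list set) * (2 * D + 1) ^ CARD('d)"
      by (simp add: card_cartesian_product card_int_box)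
    also have "\<dots> \<le> ((2 * G + 1) ^ CARD('d) * ((2 * D + 1) ^ CARD('d)) ^ Suc M) * (2 * D + 1) ^ CARD('d)"
      using 3 by (intro mult_right_mono) auto
    finally show ?case
      using fin by (simp add: algebra_simps)
  qed
  then show "finite (paths D G M :: ('d \<Rightarrow> int) list set)"
    "card (paths D G M :: ('d \<Rightarrow> int) list set) \<le> (2 * G + 1) ^ CARD('d) * ((2 * D + 1) ^ CARD('d)) ^ M"
    by auto
qed

lemma length_paths: "xs \<in> paths D G M \<Longrightarrow> length xs = M"
  by (induction D G M arbitrary: xs rule: paths.induct) auto

lemma map_rev_in_paths:
  assumes "\<And>i. \<bar>z 0 i\<bar> \<le> int G" "\<And>t i. Suc t < M \<Longrightarrow> \<bar>z (Suc t) i - z t i\<bar> \<le> int D" "M > 0"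
  shows "map z (rev [0..<M]) \<in> paths D G M"
  using assms
proof (induction M)
  case (Suc M)
  show ?case
  proof (cases M)
    case 0
    then show ?thesis
      using Suc.prems by simp
  next
    case (Suc M')
    then have "map z (rev [0..<Suc M']) \<in> paths D G (Suc M')"
      using Suc.IH Suc.prems by simp
    moreover have "map z (rev [0..<Suc M]) = (\<lambda>i. hd (map z (rev [0..<Suc M'])) i + (z M i - z M' i)) # map z (rev [0..<Suc M'])"
      using Suc by simp
    moreover have "\<bar>z M i - z M' i\<bar> \<le> int D" for i
      using Suc.prems Suc by simp
    ultimately show ?thesis
      unfolding \<open>M = Suc M'\<close> paths.simps
      by (intro image_eqI[of _ _ "(map z (rev [0..<Suc M']), \<lambda>i. z (Suc M') i - z M' i)"]) auto
  qed
qed simp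

text \<open>The events are indexed by sets of distinct cubes: a repeated visit to a bad cube yields
  no further factor of probability.\<close>

definition path_sets :: "nat \<Rightarrow> nat \<Rightarrow> nat \<Rightarrow> nat \<Rightarrow> ('d::finite \<Rightarrow> int) set set" where
  "path_sets D G M k = (\<Union>xs\<in>paths D G M. {S. S \<subseteq> set xs \<and> card S = k})"

lemma path_sets_bounds:
  shows finite_path_sets: "finite (path_sets D G M k :: ('d::finite \<Rightarrow> int) set set)"
    and card_path_sets_le: "card (path_sets D G M k :: ('d \<Rightarrow> int) set set)
      \<le> (2 * G + 1) ^ CARD('d) * (2 * (2 * D + 1) ^ CARD('d)) ^ M"
proof -
  let ?P = "paths D G M :: ('d \<Rightarrow> int) list set"
  show "finite (path_sets D G M k :: ('d \<Rightarrow> int) set set)"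
    unfolding path_sets_def using finite_paths by (intro finite_UN_I) (auto)
  have le: "card {S. S \<subseteq> set xs \<and> card S = k} \<le> 2 ^ M" if "xs \<in> ?P" for xs
  proof -
    have "card {S. S \<subseteq> set xs \<and> card S = k} \<le> card (Pow (set xs))"
      by (intro card_mono) auto
    also have "\<dots> \<le> 2 ^ M"
      using length_paths[OF that] card_length[of xs] by (simp add: card_Pow)
    finally show ?thesis .
  qed
  have "card (path_sets D G M k :: ('d \<Rightarrow> int) set set) \<le> (\<Sum>xs\<in>?P. card {S. S \<subseteq> set xs \<and> card S = k})"
    unfolding path_sets_def using finite_paths by (rule card_UN_le)
  also have "\<dots> \<le> (\<Sum>xs\<in>?P. 2 ^ M)"
    using le by (rule sum_mono)
  also have "\<dots> \<le> ((2 * G + 1) ^ CARD('d) * ((2 * D + 1) ^ CARD('d)) ^ M) * 2 ^ M"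
    using card_paths_le[where 'd = 'd, of D G M] by (simp add: mult_right_mono)
  finally show "card (path_sets D G M k :: ('d \<Rightarrow> int) set set)
      \<le> (2 * G + 1) ^ CARD('d) * (2 * (2 * D + 1) ^ CARD('d)) ^ M"
    by (simp add: power_mult_distrib algebra_simps)
qed

text \<open>More than \<open>M / T\<close> bad cubes have probability at most \<open>x ^ M\<close>.
  The number of sets grows like \<open>(2 * (2 * D + 1) ^ CARD('d)) ^ M\<close>, where 2 counts
  subsets and the rest steps; the 4 in the bound on \<open>x\<close> leaves \<open>1 / 2\<close> per
  step.\<close>

lemma prob_some_path_set_bad_le:
  fixes T :: nat
  assumes Q: "\<And>S :: ('d::finite \<Rightarrow> int) set. finite S \<Longrightarrow>
      measure (percolation_product N p) {\<omega> \<in> space (percolation_product N p). \<forall>z\<in>S. bad N n m D q \<omega> z} \<le> x ^ (T * card S)"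
    and x: "0 \<le> x" "x \<le> 1 / real (4 * (2 * D + 1) ^ CARD('d))" and T: "T > 0"
  shows "measure (percolation_product N p) {\<omega> \<in> space (percolation_product N p).
      \<exists>S\<in>path_sets D G M (Suc (M div T)) :: ('d \<Rightarrow> int) set set. \<forall>z\<in>S. bad N n m D q \<omega> z}
    \<le> real ((2 * G + 1) ^ CARD('d)) * (1 / 2) ^ M"
proof -
  let ?M = "percolation_product N p :: ((real ^ 'd) set \<Rightarrow> bool) measure"
  let ?S = "path_sets D G M (Suc (M div T)) :: ('d \<Rightarrow> int) set set"
  interpret prob_space ?M
    by (rule prob_space_percolation_product)
  have fin: "finite S" and card: "card S = Suc (M div T)" if "S \<in> ?S" for S
    using that by (auto simp: path_sets_def intro: finite_subset)
  have x1: "x \<le> 1"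
  proof -
    have "1 / real (4 * K) \<le> 1" if "K > 0" for K :: nat
      using that by simp
    moreover have "(2 * D + 1) ^ CARD('d) > 0"
      by simp
    ultimately show ?thesis
      using x(2) order_trans by blast
  qed
  have "prob {\<omega> \<in> space ?M. \<exists>S\<in>?S. \<forall>z\<in>S. bad N n m D q \<omega> z}
      = prob (\<Union>S\<in>?S. {\<omega> \<in> space ?M. \<forall>z\<in>S. bad N n m D q \<omega> z})"
    by (intro arg_cong[where f = prob]) auto
  also have "\<dots> \<le> (\<Sum>S\<in>?S. prob {\<omega> \<in> space ?M. \<forall>z\<in>S. bad N n m D q \<omega> z})"
    using finite_path_sets fin by (intro finite_measure_subadditive_finite) (auto intro!: predE pred_intros_finite)
  also have "\<dots> \<le> (\<Sum>S\<in>?S. x ^ M)"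
  proof (rule sum_mono)
    fix S assume S: "S \<in> ?S"
    have "M \<le> T * card S"
      using dividend_less_times_div[OF T, of M] by (simp add: card[OF S])
    then have "x ^ (T * card S) \<le> x ^ M"
      using x x1 by (intro power_decreasing) auto
    then show "prob {\<omega> \<in> space ?M. \<forall>z\<in>S. bad N n m D q \<omega> z} \<le> x ^ M"
      using Q[OF fin[OF S]] by linarith
  qed
  also have "\<dots> \<le> real ((2 * G + 1) ^ CARD('d) * (2 * (2 * D + 1) ^ CARD('d)) ^ M) * x ^ M"
    using card_path_sets_le[where 'd = 'd, of D G M "Suc (M div T)"] x
    by (simp only: sum_constant of_nat_le_iff mult_right_mono zero_le_power)
  also have "\<dots> = real ((2 * G + 1) ^ CARD('d)) * (real (2 * (2 * D + 1) ^ CARD('d)) * x) ^ M"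
    by (simp only: of_nat_mult of_nat_power power_mult_distrib mult.assoc)
  also have "\<dots> \<le> real ((2 * G + 1) ^ CARD('d)) * (1 / 2) ^ M"
  proof (intro mult_left_mono power_mono)
    have "real (2 * (2 * D + 1) ^ CARD('d)) * x
        \<le> real (2 * (2 * D + 1) ^ CARD('d)) * (1 / real (4 * (2 * D + 1) ^ CARD('d)))"
      using x by (intro mult_left_mono) auto
    moreover have "real (2 * K) * (1 / real (4 * K)) = 1 / 2" if "K > 0" for K :: nat
      using that by simp
    moreover have "(2 * D + 1) ^ CARD('d) > 0"
      by simp
    ultimately show "real (2 * (2 * D + 1) ^ CARD('d)) * x \<le> 1 / 2"
      by metis
  qed (use x in auto)
  finally show ?thesis .
qed

section \<open>Almost sure scarcity of bad cubes along chains\<close>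

text \<open>A nonempty trace of a bad cube contains a vertex of a cube in the unit cube, and the
  trace is near \<open>z\<close>. Hence only chains that start in a bounded box can meet bad cubes,
  which keeps the union bound finite.\<close>

lemma bad_bound:
  fixes z :: "'d::finite \<Rightarrow> int"
  assumes "bad N n m D q \<omega> z" "N > 0" "N ^ m div q > 0"
  shows "\<bar>z i\<bar> \<le> int (N ^ n) + 2 * int D + 1"
proof -
  obtain V where V: "V \<in> traces (N ^ m) D q z" and hit: "\<And>v. v \<in> V \<Longrightarrow> hit N (n + m) \<omega> v"
    using assms(1) unfolding bad_def by blast
  have W: "N ^ m > 0"
    using assms(2) by simp
  have "card V > 0"
    using card_trace[OF V W] assms(3) by simp
  then obtain v where v: "v \<in> V"
    by (metis card.empty equals0I less_irrefl)
  obtain l :: "'d \<Rightarrow> nat" where "\<forall>i. l i \<in> {1..N ^ (n + m)} \<and> (int (l i) = v i \<or> int (l i) = v i + 1)"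
    using hit[OF v] unfolding hit_def vertex_cubes_def by blast
  then have "l i \<in> {1..N ^ (n + m)}" "int (l i) = v i \<or> int (l i) = v i + 1"
    by auto
  then have "1 \<le> int (l i)" "int (l i) \<le> int (N ^ (n + m))" "int (l i) = v i \<or> int (l i) = v i + 1"
    by (simp_all only: of_nat_le_iff atLeastAtMost_iff) auto
  then have vi: "0 \<le> v i" "v i \<le> int (N ^ (n + m))"
    by linarith+
  have eq: "int (N ^ (n + m)) = int (N ^ m) * int (N ^ n)"
    by (simp add: power_add mult.commute)
  have near: "\<bar>v i - int (N ^ m) * z i\<bar> \<le> int (N ^ m) * (2 * int D + 1)"
    using trace_near[OF V v W] .
  have "int (N ^ m) * z i \<le> int (N ^ m) * (int (N ^ n) + 2 * int D + 1)"
    using near vi(2) unfolding eq by (simp add: algebra_simps abs_le_iff)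
  moreover have "int (N ^ m) * (- (2 * int D + 1)) \<le> int (N ^ m) * z i"
    using near vi(1) by (simp add: algebra_simps abs_le_iff)
  moreover have "0 < int (N ^ m)"
    using W by simp
  ultimately have "z i \<le> int (N ^ n) + 2 * int D + 1" "- (2 * int D + 1) \<le> z i"
    using mult_le_cancel_left_pos by blast+
  moreover have "0 \<le> int (N ^ n)"
    by (rule of_nat_0_le_iff)
  ultimately show ?thesis
    by linarith
qed

lemma chain_start_bound:
  fixes z :: "nat \<Rightarrow> 'd \<Rightarrow> int"
  assumes "\<And>t. Suc t < M \<Longrightarrow> \<bar>z (Suc t) i - z t i\<bar> \<le> D" "t < M"
  shows "\<bar>z 0 i\<bar> \<le> \<bar>z t i\<bar> + int t * D"
  using assms(2)
proof (induction t)
  case (Suc t)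
  then show ?case
    using assms(1)[of t] by (simp add: algebra_simps)
qed simp

lemma summable_poly_half_power:
  fixes a :: real
  shows "summable (\<lambda>x. (a * real x + 1) ^ k * (1 / 2) ^ x)"
proof (rule summable_comparison_test_bigo)
  show "summable (\<lambda>x. norm (1 / real x ^ 2))"
    using inverse_power_summable[of 2, where 'a = real] by (simp add: field_simps)
  have "(\<lambda>x. real x ^ k * (1 / 2) ^ x) \<in> O(\<lambda>x. 1 / real x ^ 2)"
    by real_asymp
  moreover have "(\<lambda>x. (a * real x + 1) ^ k) \<in> O(\<lambda>x. real x ^ k)"
    by (intro landau_o.big_power) real_asymp
  ultimately show "(\<lambda>x. (a * real x + 1) ^ k * (1 / 2) ^ x) \<in> O(\<lambda>x. 1 / real x ^ 2)"
    using landau_o.big.trans landau_o.big.mult_right by blast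
qed

lemma AE_eventually_few_bad:
  fixes p :: real and D q T :: nat
  assumes N: "N \<ge> 2" and p: "0 \<le> p" "p \<le> 1" and T: "T > 0" and W: "N ^ m div q > 0"
    and Q: "\<And>n S. finite (S :: ('d::finite \<Rightarrow> int) set) \<Longrightarrow>
      measure (percolation_product N p) {\<omega> \<in> space (percolation_product N p). \<forall>z\<in>S. bad N n m D q \<omega> z} \<le> x ^ (T * card S)"
    and x: "0 \<le> x" "x \<le> 1 / real (4 * (2 * D + 1) ^ CARD('d))"
  shows "AE \<omega> in percolation_product N p. \<forall>\<^sub>F n in sequentially. \<forall>z :: nat \<Rightarrow> 'd \<Rightarrow> int.
    (\<forall>t i. Suc t < N ^ (n - n1) \<longrightarrow> \<bar>z (Suc t) i - z t i\<bar> \<le> int D) \<longrightarrow>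
    T * card {z t | t. t < N ^ (n - n1) \<and> bad N n m D q \<omega> (z t)} \<le> N ^ (n - n1)"
proof -
  let ?M = "percolation_product N p :: ((real ^ 'd) set \<Rightarrow> bool) measure"
  interpret prob_space ?M
    by (rule prob_space_percolation_product)
  \<comment> \<open>A bad cube is within \<open>N ^ n + 2 * D + 1\<close> of the origin, and walking
    back to the start of the chain adds at most \<open>N ^ n * D\<close>; the sum is at most
    \<open>(3 * D + 2) * N ^ n\<close>.\<close>
  define G where "G n = (3 * D + 2) * N ^ n" for n
  define P where "P n = (path_sets D (G n) (N ^ (n - n1)) (Suc (N ^ (n - n1) div T)) :: ('d \<Rightarrow> int) set set)" for n
  define A where "A n = {\<omega> \<in> space ?M. \<exists>S\<in>P n. \<forall>z\<in>S. bad N n m D q \<omega> z}" for n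
  have P_fin: "finite (P n)" "\<And>S. S \<in> P n \<Longrightarrow> finite S" for n
    unfolding P_def using finite_path_sets by (auto simp: path_sets_def intro: finite_subset)
  have A_sets: "A n \<in> sets ?M" for n
    unfolding A_def using P_fin by (intro predE pred_intros_finite bad_measurable)
  have A_le: "measure ?M (A n) \<le> real ((2 * G n + 1) ^ CARD('d)) * (1 / 2) ^ (N ^ (n - n1))" for n
    unfolding A_def P_def by (rule prob_some_path_set_bad_le[OF Q x T])
  have "summable (\<lambda>n. measure ?M (A n))"
  proof -
    \<comment> \<open>The bound on \<open>A (k + n1)\<close> is a polynomial in the chain length
      \<open>N ^ k\<close> times \<open>(1 / 2) ^ (N ^ k)\<close>, so it forms a subseries of the
      one in \<open>summable_poly_half_power\<close>.\<close>
    define a where "a = real (2 * (3 * D + 2) * N ^ n1)"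
    have "inj (\<lambda>k. N ^ k)"
      using N by (intro injI) (auto dest: power_inject_exp[THEN iffD1, rotated])
    then have "summable ((\<lambda>x. (a * real x + 1) ^ CARD('d) * (1 / 2) ^ x) \<circ> (\<lambda>k. N ^ k))"
      by (intro summable_reindex summable_poly_half_power) (auto simp: a_def)
    then have "summable (\<lambda>k. measure ?M (A (k + n1)))"
    proof (rule summable_comparison_test'[where N = 0])
      fix k :: nat
      have "real ((2 * G (k + n1) + 1) ^ CARD('d)) = (a * real (N ^ k) + 1) ^ CARD('d)"
        by (simp add: G_def a_def power_add algebra_simps)
      then show "norm (measure ?M (A (k + n1))) \<le> ((\<lambda>x. (a * real x + 1) ^ CARD('d) * (1 / 2) ^ x) \<circ> (\<lambda>k. N ^ k)) k"
        using A_le[of "k + n1"] by simp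
    qed
    then show ?thesis
      using summable_iff_shift[of "\<lambda>n. measure ?M (A n)" n1] by blast
  qed
  then have "AE \<omega> in ?M. \<forall>\<^sub>F n in sequentially. \<omega> \<in> space ?M - A n"
    using A_sets by (intro borel_cantelli_AE1) (auto simp: emeasure_eq_measure)
  then show ?thesis
  proof (rule AE_mp, intro AE_I2 impI)
    fix \<omega> assume "\<forall>\<^sub>F n in sequentially. \<omega> \<in> space ?M - A n"
    then show "\<forall>\<^sub>F n in sequentially. \<forall>z :: nat \<Rightarrow> 'd \<Rightarrow> int.
        (\<forall>t i. Suc t < N ^ (n - n1) \<longrightarrow> \<bar>z (Suc t) i - z t i\<bar> \<le> int D) \<longrightarrow>
        T * card {z t | t. t < N ^ (n - n1) \<and> bad N n m D q \<omega> (z t)} \<le> N ^ (n - n1)"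
    proof (rule eventually_mono)
      fix n
      assume \<omega>: "\<omega> \<in> space ?M - A n"
      show "\<forall>z :: nat \<Rightarrow> 'd \<Rightarrow> int.
        (\<forall>t i. Suc t < N ^ (n - n1) \<longrightarrow> \<bar>z (Suc t) i - z t i\<bar> \<le> int D) \<longrightarrow>
        T * card {z t | t. t < N ^ (n - n1) \<and> bad N n m D q \<omega> (z t)} \<le> N ^ (n - n1)"
      proof (intro allI impI, rule ccontr)
        fix z :: "nat \<Rightarrow> 'd \<Rightarrow> int"
        let ?m = "N ^ (n - n1)"
        let ?B = "{z t | t. t < ?m \<and> bad N n m D q \<omega> (z t)}"
        assume step: "\<forall>t i. Suc t < ?m \<longrightarrow> \<bar>z (Suc t) i - z t i\<bar> \<le> int D"
          and "\<not> T * card ?B \<le> ?m"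
        then have "?m div T < card ?B"
          by (intro less_mult_imp_div_less) (simp add: mult.commute)
        \<comment> \<open>One more than \<open>?m div T\<close> bad cubes form a member of
          \<open>P n\<close> as soon as the chain starts in the box; any of these bad cubes proves
          that it does.\<close>
        then obtain S where S: "S \<subseteq> ?B" "card S = Suc (?m div T)"
          using obtain_subset_with_card_n[of "Suc (?m div T)" ?B] by auto
        then obtain t where t: "t < ?m" "bad N n m D q \<omega> (z t)"
          by (cases "S = {}") auto
        have "\<bar>z 0 i\<bar> \<le> int (G n)" for i
        proof -
          have "\<bar>z 0 i\<bar> \<le> \<bar>z t i\<bar> + int t * int D"
            using step t by (intro chain_start_bound[where M = ?m]) auto
          moreover have "\<bar>z t i\<bar> \<le> int (N ^ n) + 2 * int D + 1"
            using t W N by (intro bad_bound) auto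
          moreover have "int t * int D \<le> int (N ^ n * D)"
            unfolding of_nat_mult[symmetric] of_nat_le_iff
          proof (rule mult_right_mono)
            have "N ^ (n - n1) \<le> N ^ n"
              using N by (intro power_increasing) auto
            then show "t \<le> N ^ n"
              using t(1) by linarith
          qed simp
          moreover have "int (N ^ n) + 2 * int D + 1 + int (N ^ n * D) \<le> int (G n)"
          proof -
            have "1 \<le> N ^ n"
              using N by simp
            then have "(2 * D + 1) * 1 \<le> (2 * D + 1) * N ^ n"
              by (rule mult_left_mono) simp
            then have "N ^ n + 2 * D + 1 + N ^ n * D \<le> G n"
              by (simp add: G_def algebra_simps)
            then have "int (N ^ n + 2 * D + 1 + N ^ n * D) \<le> int (G n)"
              by (simp only: of_nat_le_iff)
            then show ?thesis
              by (simp only: of_nat_add of_nat_mult of_nat_1 of_nat_numeral)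
          qed
          ultimately show ?thesis
            by linarith
        qed
        then have "map z (rev [0..<?m]) \<in> paths D (G n) ?m"
          using step N by (intro map_rev_in_paths) auto
        moreover have "S \<subseteq> set (map z (rev [0..<?m]))"
          using S by auto
        ultimately have "S \<in> P n"
          using S unfolding P_def path_sets_def by blast
        moreover have "\<forall>y\<in>S. bad N n m D q \<omega> y"
          using S by auto
        ultimately show False
          using \<omega> by (auto simp: A_def)
      qed
    qed
  qed
qed

text \<open>The only almost sure property of \<omega> that is used. A cell of level
  \<open>n1\<close> contributes rows of \<open>N ^ (n - n1)\<close> cells of level \<open>n\<close>,
  and the chains are the cubes near the images of such a row.\<close>

definition typical :: "nat \<Rightarrow> ((real ^ 'd) set \<Rightarrow> bool) \<Rightarrow> nat \<Rightarrow> nat \<Rightarrow> nat \<Rightarrow> nat \<Rightarrow> bool" where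
  "typical N \<omega> D q T m \<longleftrightarrow> (\<forall>n1. \<forall>\<^sub>F n in sequentially. \<forall>z :: nat \<Rightarrow> 'd::finite \<Rightarrow> int.
    (\<forall>t i. Suc t < N ^ (n - n1) \<longrightarrow> \<bar>z (Suc t) i - z t i\<bar> \<le> int D) \<longrightarrow>
    T * card {z t | t. t < N ^ (n - n1) \<and> bad N n m D q \<omega> (z t)} \<le> N ^ (n - n1))"

lemma exists_root_bound:
  fixes a :: real
  assumes "a < 1" "R > 0"
  obtains r where "0 < r" "r < 1" "a \<le> r ^ R"
proof
  \<comment> \<open>The maximum keeps the root positive when \<open>a\<close> is 0, as happens for
    \<open>p = 0\<close>.\<close>
  define b where "b = max a (1 / 2)"
  have b: "0 < b" "b < 1" "a \<le> b"
    using assms by (auto simp: b_def)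
  show "0 < root R b" "root R b < 1" "a \<le> root R b ^ R"
    using b assms by (simp_all add: real_root_pow_pos2)
qed

lemma exists_depth:
  fixes r y :: real
  assumes "N \<ge> 2" "q > 0" "0 < r" "r < 1" "y > 0"
  obtains m where "m \<ge> m0" "N ^ m div q > 0" "real ((32 * N ^ m * D + 1) ^ k) * r ^ (N ^ m div q) \<le> y"
proof -
  define C where "C = real (32 * q * D + 1) ^ k"
  have "(\<lambda>w. C * (real (w + 1) ^ k * r ^ w)) \<longlonglongrightarrow> C * 0"
    using assms by (intro tendsto_mult_left) real_asymp
  then have "\<forall>\<^sub>F w in sequentially. C * (real (w + 1) ^ k * r ^ w) < y"
    using assms by (simp add: order_tendsto_iff)
  then obtain w0 where w0: "\<And>w. w \<ge> w0 \<Longrightarrow> C * (real (w + 1) ^ k * r ^ w) < y"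
    by (auto simp: eventually_sequentially)
  \<comment> \<open>From \<open>m < 2 ^ m \<le> N ^ m\<close> the quotient \<open>w\<close> is at
    least \<open>Suc w0\<close>, so it is large and also nonzero.\<close>
  define m where "m = q * Suc w0 + m0"
  define w where "w = N ^ m div q"
  have "m < 2 ^ m"
    by (rule less_exp)
  also have "(2 :: nat) ^ m \<le> N ^ m"
    using assms by (intro power_mono) auto
  finally have "q * Suc w0 \<le> N ^ m"
    by (simp add: m_def)
  then have w: "w \<ge> Suc w0"
    unfolding w_def using assms by (simp add: less_eq_div_iff_mult_less_eq mult.commute)
  have "N ^ m \<le> q * (w + 1)"
    using dividend_less_times_div[OF assms(2), of "N ^ m"] by (simp add: w_def)
  then have "32 * N ^ m * D + 1 \<le> 32 * (q * (w + 1)) * D + (w + 1)"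
    by (intro add_mono mult_right_mono mult_left_mono) auto
  then have "(32 * N ^ m * D + 1) ^ k \<le> ((32 * q * D + 1) * (w + 1)) ^ k"
    by (intro power_mono) (auto simp: algebra_simps)
  then have "real ((32 * N ^ m * D + 1) ^ k) \<le> real (((32 * q * D + 1) * (w + 1)) ^ k)"
    by (simp only: of_nat_le_iff)
  then have "real ((32 * N ^ m * D + 1) ^ k) * r ^ w \<le> real (((32 * q * D + 1) * (w + 1)) ^ k) * r ^ w"
    using assms by (intro mult_right_mono) auto
  also have "\<dots> = C * (real (w + 1) ^ k * r ^ w)"
    by (simp only: C_def of_nat_power of_nat_mult power_mult_distrib mult.assoc)
  also have "\<dots> < y"
    using w by (intro w0) simp
  finally show thesis
    using w by (intro that[of m]) (auto simp: m_def w_def)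
qed

lemma AE_typical:
  fixes p :: real
  assumes N: "N \<ge> 2" and p: "0 \<le> p" "p < 1" and q: "q > 0" and T: "T > 0"
  shows "\<exists>m\<ge>m0. N ^ m div q > 0 \<and>
    (AE \<omega> in (percolation_product N p :: ((real ^ 'd::finite) set \<Rightarrow> bool) measure). typical N \<omega> D q T m)"
proof -
  \<comment> \<open>The first factor pays for vertices shared by traces, the second for cubes shared
    by vertices.\<close>
  define R where "R = (4 * D + 3) ^ CARD('d) * 2 ^ CARD('d)"
  have "1 - (1 - p) ^ (2 ^ CARD('d)) < 1" "R > 0"
    using p by (auto simp: R_def)
  then obtain r where r: "0 < r" "r < 1" "1 - (1 - p) ^ (2 ^ CARD('d)) \<le> r ^ R"
    by (rule exists_root_bound)
  define x where "x = 1 / real (4 * (2 * D + 1) ^ CARD('d))"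
  have x: "0 < x"
    by (simp add: x_def)
  then have xT: "x ^ T > 0"
    by simp
  obtain m where m: "m \<ge> m0" "N ^ m div q > 0"
    "real ((32 * N ^ m * D + 1) ^ (2 * CARD('d))) * r ^ (N ^ m div q) \<le> x ^ T"
    by (rule exists_depth[OF N q r(1,2) xT])
  have "AE \<omega> in (percolation_product N p :: ((real ^ 'd::finite) set \<Rightarrow> bool) measure). typical N \<omega> D q T m"
    unfolding typical_def AE_all_countable
  proof (intro allI AE_eventually_few_bad[OF N _ _ T m(2)])
    fix n and S :: "('d \<Rightarrow> int) set"
    assume S: "finite S"
    have "measure (percolation_product N p) {\<omega> \<in> space (percolation_product N p). \<forall>z\<in>S. bad N n m D q \<omega> z}
      \<le> (real ((32 * N ^ m * D + 1) ^ (2 * CARD('d))) * r ^ (N ^ m div q)) ^ card S"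
      using N p r S by (intro prob_all_bad_le) (auto simp: R_def power_mult)
    also have "\<dots> \<le> (x ^ T) ^ card S"
      using m r by (intro power_mono) auto
    finally show "measure (percolation_product N p) {\<omega> \<in> space (percolation_product N p). \<forall>z\<in>S. bad N n m D q \<omega> z}
      \<le> x ^ (T * card S)"
      by (simp add: power_mult)
  qed (use p x in \<open>auto simp: x_def\<close>)
  then show ?thesis
    using m by blast
qed

section \<open>Hausdorff premeasure\<close>

lemma hausdorff_premeasure_mono:
  "A \<subseteq> B \<Longrightarrow> hausdorff_premeasure k \<delta> A \<le> hausdorff_premeasure k \<delta> B"
  unfolding hausdorff_premeasure_def by (rule Inf_superset_mono) blast

lemma hausdorff_premeasure_le_cover:
  assumes "A \<subseteq> (\<Union>i. C i)" "\<And>i. bounded (C i)" "\<And>i. diameter (C i) \<le> \<delta>"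
  shows "hausdorff_premeasure k \<delta> A \<le> (\<Sum>i. if C i = {} then 0 else ennreal (diameter (C i) ^ k))"
  unfolding hausdorff_premeasure_def using assms by (intro Inf_lower) blast

lemma hausdorff_premeasure_empty:
  assumes "\<delta> \<ge> 0"
  shows "hausdorff_premeasure k \<delta> {} = 0"
  using hausdorff_premeasure_le_cover[of "{}" "\<lambda>_. {}" \<delta> k] assms by simp

lemma hausdorff_premeasure_le_diameter:
  assumes "bounded A" "diameter A \<le> \<delta>" "\<delta> \<ge> 0"
  shows "hausdorff_premeasure k \<delta> A \<le> ennreal (diameter A ^ k)"
proof -
  define C where "C i = (if i = 0 then A else {})" for i :: nat
  have "hausdorff_premeasure k \<delta> A \<le> (\<Sum>i. if C i = {} then 0 else ennreal (diameter (C i) ^ k))"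
    using assms by (intro hausdorff_premeasure_le_cover) (auto simp: C_def)
  also have "\<dots> = (\<Sum>i\<in>{0}. if C i = {} then 0 else ennreal (diameter (C i) ^ k))"
    by (intro suminf_finite) (auto simp: C_def)
  also have "\<dots> \<le> ennreal (diameter A ^ k)"
    by (simp add: C_def)
  finally show ?thesis .
qed

text \<open>Near-optimal covers with errors \<open>e / 2 ^ (i + 1)\<close>, merged along
  \<open>prod_decode\<close>. Finiteness of the sum, provided by \<open>ennreal_le_epsilon\<close>,
  makes the slack strict.\<close>

lemma hausdorff_premeasure_UN_le:
  fixes A :: "nat \<Rightarrow> 'a::metric_space set"
  shows "hausdorff_premeasure k \<delta> (\<Union>i. A i) \<le> (\<Sum>i. hausdorff_premeasure k \<delta> (A i))"
proof (rule ennreal_le_epsilon)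
  fix e :: real
  assume fin: "(\<Sum>i. hausdorff_premeasure k \<delta> (A i)) < top" and e: "0 < e"
  let ?H = "hausdorff_premeasure k \<delta>"
  let ?c = "\<lambda>X :: 'a set. if X = {} then 0 else ennreal (diameter X ^ k)"
  have "\<exists>C. A i \<subseteq> (\<Union>j. C j) \<and> (\<forall>j. bounded (C j) \<and> diameter (C j) \<le> \<delta>) \<and>
      (\<Sum>j. ?c (C j)) \<le> ?H (A i) + ennreal (e * (1 / 2) ^ Suc i)" for i
  proof -
    have "?H (A i) < top"
      using fin ennreal_suminf_lessD by blast
    then have "?H (A i) < ?H (A i) + ennreal (e * (1 / 2) ^ Suc i)"
      using e by (simp add: ennreal_add_left_cancel_less[of _ 0, simplified] less_top)
    then show ?thesis
      unfolding hausdorff_premeasure_def[of k \<delta> "A i"] Inf_less_iff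
      by (smt (verit, best) less_imp_le mem_Collect_eq)
  qed
  then have "\<exists>C. \<forall>i. A i \<subseteq> (\<Union>j. C i j) \<and> (\<forall>j. bounded (C i j) \<and> diameter (C i j) \<le> \<delta>) \<and>
      (\<Sum>j. ?c (C i j)) \<le> ?H (A i) + ennreal (e * (1 / 2) ^ Suc i)"
    by (intro choice allI)
  then obtain C where C: "\<And>i. A i \<subseteq> (\<Union>j. C i j)" "\<And>i j. bounded (C i j)" "\<And>i j. diameter (C i j) \<le> \<delta>"
      "\<And>i. (\<Sum>j. ?c (C i j)) \<le> ?H (A i) + ennreal (e * (1 / 2) ^ Suc i)"
    by blast
  define F where "F n = (case prod_decode n of (i, j) \<Rightarrow> C i j)" for n
  have "(\<Union>i. A i) \<subseteq> (\<Union>n. F n)"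
  proof
    fix x assume "x \<in> (\<Union>i. A i)"
    then obtain i j where "x \<in> C i j"
      using C(1) by blast
    then have "x \<in> F (prod_encode (i, j))"
      by (simp add: F_def)
    then show "x \<in> (\<Union>n. F n)"
      by blast
  qed
  then have "?H (\<Union>i. A i) \<le> (\<Sum>n. ?c (F n))"
    using C(2,3) by (intro hausdorff_premeasure_le_cover) (auto simp: F_def split: prod.split)
  also have "\<dots> = (\<Sum>i. \<Sum>j. ?c (C i j))"
  proof -
    have "?c (F n) = (\<lambda>(i, j). ?c (C i j)) (prod_decode n)" for n
      by (simp add: F_def split: prod.split)
    then have "(\<Sum>n. ?c (F n)) = (\<Sum>n. (\<lambda>(i, j). ?c (C i j)) (prod_decode n))"
      by presburger
    also have "\<dots> = (\<Sum>i. \<Sum>j. ?c (C i j))"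
      by (rule suminf_ennreal_2dimen) simp
    finally show ?thesis .
  qed
  also have "\<dots> \<le> (\<Sum>i. ?H (A i) + ennreal (e * (1 / 2) ^ Suc i))"
    using C(4) by (intro suminf_le) auto
  also have "\<dots> = (\<Sum>i. ?H (A i)) + (\<Sum>i. ennreal (e * (1 / 2) ^ Suc i))"
    by (intro suminf_add[symmetric]) auto
  also have "(\<Sum>i. ennreal (e * (1 / 2) ^ Suc i)) = ennreal e"
    using sums_mult[OF power_half_series, of e] e
    by (intro suminf_ennreal_eq) auto
  finally show "?H (\<Union>i. A i) \<le> (\<Sum>i. ?H (A i)) + ennreal e" .
qed

lemma hausdorff_premeasure_finite_UN_le:
  fixes A :: "'b \<Rightarrow> 'a::metric_space set"
  assumes "finite I" "\<delta> \<ge> 0"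
  shows "hausdorff_premeasure k \<delta> (\<Union>i\<in>I. A i) \<le> (\<Sum>i\<in>I. hausdorff_premeasure k \<delta> (A i))"
proof -
  obtain h n where h: "bij_betw h {..<n :: nat} I"
    using assms(1) by (metis bij_betw_from_nat_into_finite lessThan_atLeast0 ex_bij_betw_nat_finite)
  define A' where "A' j = (if j < n then A (h j) else {})" for j
  have "(\<Union>i\<in>I. A i) = (\<Union>j. A' j)"
    using h by (auto simp: A'_def bij_betw_def split: if_splits)
  then have "hausdorff_premeasure k \<delta> (\<Union>i\<in>I. A i) \<le> (\<Sum>j. hausdorff_premeasure k \<delta> (A' j))"
    by (simp add: hausdorff_premeasure_UN_le)
  also have "\<dots> = (\<Sum>j<n. hausdorff_premeasure k \<delta> (A' j))"
    using assms(2) by (intro suminf_finite) (auto simp: A'_def hausdorff_premeasure_empty)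
  also have "\<dots> = (\<Sum>j<n. hausdorff_premeasure k \<delta> (A (h j)))"
    by (simp add: A'_def)
  also have "\<dots> = (\<Sum>i\<in>I. hausdorff_premeasure k \<delta> (A i))"
    using h by (rule sum.reindex_bij_betw)
  finally show ?thesis .
qed

lemma hausdorff_premeasure_sum_le:
  fixes A :: "'b \<Rightarrow> 'a::metric_space set"
  assumes "finite I" "\<delta> \<ge> 0" "X \<subseteq> (\<Union>i\<in>I. A i)"
    and "\<And>i. i \<in> I \<Longrightarrow> hausdorff_premeasure k \<delta> (A i) \<le> ennreal (c i)" "\<And>i. i \<in> I \<Longrightarrow> 0 \<le> c i"
  shows "hausdorff_premeasure k \<delta> X \<le> ennreal (\<Sum>i\<in>I. c i)"
proof -
  have "hausdorff_premeasure k \<delta> X \<le> (\<Sum>i\<in>I. hausdorff_premeasure k \<delta> (A i))"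
    using hausdorff_premeasure_mono[OF assms(3)] hausdorff_premeasure_finite_UN_le[OF assms(1,2)]
    by (rule order_trans)
  also have "\<dots> \<le> (\<Sum>i\<in>I. ennreal (c i))"
    using assms(4) by (rule sum_mono)
  also have "\<dots> = ennreal (\<Sum>i\<in>I. c i)"
    using assms(5) by (rule sum_ennreal)
  finally show ?thesis .
qed

lemma hausdorff_premeasure_le_box:
  fixes A :: "(real ^ 'd) set"
  assumes A: "\<And>y i. y \<in> A \<Longrightarrow> \<bar>y $ i - c i\<bar> \<le> \<rho>" and \<rho>: "0 \<le> \<rho>" "2 * real CARD('d) * \<rho> \<le> \<delta>"
  shows "hausdorff_premeasure k \<delta> A \<le> ennreal ((2 * real CARD('d) * \<rho>) ^ k)"
proof -
  have dist: "dist x y \<le> 2 * real CARD('d) * \<rho>" if "x \<in> A" "y \<in> A" for x y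
  proof -
    have "dist x y \<le> (\<Sum>i\<in>UNIV. \<bar>(x - y) $ i\<bar>)"
      unfolding dist_norm by (rule norm_le_l1_cart)
    also have "\<dots> \<le> (\<Sum>i\<in>(UNIV :: 'd set). 2 * \<rho>)"
    proof (rule sum_mono)
      fix i
      show "\<bar>(x - y) $ i\<bar> \<le> 2 * \<rho>"
        using A[OF that(1), of i] A[OF that(2), of i] unfolding vector_minus_component by linarith
    qed
    finally show ?thesis
      by simp
  qed
  have "bounded A"
    using dist bounded_two_points by blast
  have nonneg: "0 \<le> 2 * real CARD('d) * \<rho>"
    using \<rho> by simp
  then have diam: "diameter A \<le> 2 * real CARD('d) * \<rho>"
    using dist by (cases "A = {}") (auto intro!: diameter_le simp: dist_norm)
  have "hausdorff_premeasure k \<delta> A \<le> ennreal (diameter A ^ k)"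
    using \<open>bounded A\<close> diam \<rho> nonneg by (intro hausdorff_premeasure_le_diameter) linarith+
  also have "\<dots> \<le> ennreal ((2 * real CARD('d) * \<rho>) ^ k)"
    using diam \<open>bounded A\<close> by (intro ennreal_leI power_mono diameter_ge_0)
  finally show ?thesis .
qed

section \<open>Slopes along curves\<close>

text \<open>Rounding the nearly straight samples \<open>X\<close> yields a pair in
  \<open>params\<close>. As \<open>z\<close> is not bad, some sampled vertex is not hit, and near
  the corresponding \<open>X j\<close> every grid cube has that vertex and is not chosen.\<close>

lemma untouched_spot:
  fixes X :: "nat \<Rightarrow> real ^ 'd" and s :: "real ^ 'd" and z :: "'d::finite \<Rightarrow> int"
  assumes N: "N > 0" and q: "N ^ m div q > 0" and D: "L + 1 \<le> D"
    and straight: "\<And>j i. j < N ^ m \<Longrightarrow> \<bar>real N ^ (n + m) * (X j $ i - X 0 $ i) - real j * s $ i\<bar> \<le> 1 / 16"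
    and start: "\<And>i. \<bar>real N ^ n * X 0 $ i - real_of_int (z i)\<bar> \<le> real D"
    and slope: "\<And>i. \<bar>s $ i\<bar> \<le> real L"
    and steep: "4 \<le> real q * \<bar>s $ i0\<bar>"
    and not_bad: "\<not> bad N n m D q \<omega> z"
  obtains j where "j < N ^ m"
    "\<And>y. (\<And>i. \<bar>real N ^ (n + m) * (y $ i - X j $ i)\<bar> \<le> 1 / 4) \<Longrightarrow> y \<notin> fractal_percolation N \<omega>"
proof -
  define W where "W = N ^ m"
  have W: "W > 0"
    using N by (simp add: W_def)
  then have W1: "1 \<le> real W"
    by simp
  have qW: "q \<le> W"
    using q by (cases "W < q") (auto simp: W_def)
  define U where "U = real N ^ (n + m)"
  have U: "U = real W * real N ^ n"
    by (simp add: U_def W_def power_add mult.commute)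
  \<comment> \<open>The start is rounded to multiples of 1/16, the slope to multiples of
    \<open>1 / (16 * W)\<close>, because up to \<open>W\<close> steps multiply the error of the
    slope.\<close>
  define b c where "b i = \<lfloor>16 * (U * X 0 $ i)\<rfloor>" and "c i = \<lfloor>16 * real W * s $ i\<rfloor>" for i
  have b: "\<bar>U * X 0 $ i - real_of_int (b i) / 16\<bar> \<le> 1 / 16" for i
    unfolding b_def using of_int_floor_le[of "16 * (U * X 0 $ i)"] real_of_int_floor_add_one_gt[of "16 * (U * X 0 $ i)"]
    by argo
  have c: "\<bar>16 * real W * s $ i - real_of_int (c i)\<bar> \<le> 1" for i
    unfolding c_def using of_int_floor_le[of "16 * real W * s $ i"] real_of_int_floor_add_one_gt[of "16 * real W * s $ i"]
    by argo
  have "\<bar>b i - 16 * int W * z i\<bar> \<le> 16 * int W * int D" for i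
  proof -
    have "\<bar>real W * (real N ^ n * X 0 $ i - real_of_int (z i))\<bar> \<le> real W * real D"
      unfolding abs_mult using start[of i] by (simp add: mult_left_mono)
    then have "\<bar>U * X 0 $ i - real W * real_of_int (z i)\<bar> \<le> real W * real D"
      by (simp add: U algebra_simps)
    then have "real_of_int (16 * int W * (z i - int D)) \<le> 16 * (U * X 0 $ i)"
      "16 * (U * X 0 $ i) \<le> real_of_int (16 * int W * (z i + int D))"
      by (simp_all add: algebra_simps abs_le_iff)
    then have "16 * int W * (z i - int D) \<le> b i" "b i \<le> 16 * int W * (z i + int D)"
      unfolding b_def by (simp_all only: le_floor_iff) (metis floor_mono floor_of_int)
    then show ?thesis
      by (simp add: algebra_simps abs_le_iff)
  qed
  moreover have "\<bar>c i\<bar> \<le> 16 * int W * int D" for i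
  proof -
    have "\<bar>real W * s $ i\<bar> \<le> real W * real L"
      using slope[of i] by (simp add: abs_mult mult_left_mono)
    moreover have "real W * (real L + 1) \<le> real W * real D"
      using D by (intro mult_left_mono) auto
    ultimately have "\<bar>real_of_int (c i)\<bar> \<le> 16 * (real W * real D)"
      using c[of i] W1 unfolding mult.assoc distrib_left by linarith
    then have "real_of_int \<bar>c i\<bar> \<le> real_of_int (16 * int W * int D)"
      by simp
    then show ?thesis
      by (simp only: of_int_le_iff)
  qed
  moreover have "32 * int W \<le> int q * \<bar>c i0\<bar>"
  proof -
    \<comment> \<open>Rounding the slope costs at most \<open>q \<le> W\<close> out of
      \<open>64 * W\<close>, so the threshold \<open>32 * W\<close> of \<open>params\<close> is
      met.\<close>
    have "real W * 4 \<le> real W * (real q * \<bar>s $ i0\<bar>)"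
      using steep by (intro mult_left_mono) auto
    then have "64 * real W \<le> real q * \<bar>16 * real W * s $ i0\<bar>"
      by (simp add: abs_mult algebra_simps)
    moreover have "real q * \<bar>16 * real W * s $ i0\<bar> \<le> real q * (\<bar>real_of_int (c i0)\<bar> + 1)"
      using c[of i0] by (intro mult_left_mono) auto
    moreover have "real q \<le> real W"
      using qW by simp
    ultimately have "32 * real W \<le> real q * \<bar>real_of_int (c i0)\<bar>"
      using W1 by (simp add: algebra_simps)
    then have "real_of_int (32 * int W) \<le> real_of_int (int q * \<bar>c i0\<bar>)"
      by simp
    then show ?thesis
      by (simp only: of_int_le_iff)
  qed
  ultimately have "(b, c) \<in> params W D q z"
    by (auto simp: params_def)
  then have "(\<lambda>r. track W b c (q * r)) ` {..<W div q} \<in> traces W D q z"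
    unfolding traces_def by force
  then have "\<not> (\<forall>v\<in>(\<lambda>r. track W b c (q * r)) ` {..<W div q}. hit N (n + m) \<omega> v)"
    using not_bad unfolding bad_def W_def[symmetric] by (meson bexI)
  then obtain r where r: "r < W div q" "\<not> hit N (n + m) \<omega> (track W b c (q * r))"
    by auto
  define j v where "j = q * r" and "v = track W b c (q * r)"
  have "q > 0"
    using q by (cases q) auto
  have "q * Suc r \<le> q * (W div q)"
    using r(1) by (intro mult_left_mono) auto
  then have jW: "j < W"
    using times_div_less_eq_dividend[of q W] \<open>q > 0\<close> unfolding j_def mult_Suc_right by linarith
  show thesis
  proof (rule that[of j])
    show "j < N ^ m"
      using jW by (simp add: W_def)
    fix y :: "real ^ 'd"
    assume y: "\<And>i. \<bar>real N ^ (n + m) * (y $ i - X j $ i)\<bar> \<le> 1 / 4"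
    \<comment> \<open>Error budget: 1/16 each for rounding the start, rounding the slope and the
      deviation from a line; 1/4 for \<open>y\<close>; 1/2 for \<open>track\<close>. The sum 15/16
      is below 1, so the cube of \<open>y\<close> has vertex \<open>v\<close>.\<close>
    have near: "\<bar>U * y $ i - real_of_int (v i)\<bar> < 1" for i
    proof -
      define x where "x = (real_of_int (b i) + real j * real_of_int (c i) / real W) / 16"
      have "\<bar>real j * (16 * real W * s $ i - real_of_int (c i))\<bar> \<le> real W * 1"
        unfolding abs_mult using c[of i] jW by (intro mult_mono) auto
      moreover have "real j * s $ i - real j * real_of_int (c i) / real W / 16
          = real j * (16 * real W * s $ i - real_of_int (c i)) / (16 * real W)"
        using W by (simp add: field_simps)
      ultimately have "\<bar>real j * s $ i - real j * real_of_int (c i) / real W / 16\<bar> \<le> 1 / 16"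
        using W by (simp add: divide_le_eq)
      moreover have "x = real_of_int (b i) / 16 + real j * real_of_int (c i) / real W / 16"
        by (simp add: x_def add_divide_distrib)
      moreover have "\<bar>U * X j $ i - U * X 0 $ i - real j * s $ i\<bar> \<le> 1 / 16"
        using straight[of j i] jW by (simp add: W_def U_def algebra_simps)
      moreover have "\<bar>U * y $ i - U * X j $ i\<bar> \<le> 1 / 4"
        using y[of i] by (simp add: U_def algebra_simps)
      moreover have "\<bar>real_of_int (v i) - x\<bar> \<le> 1 / 2"
        using of_int_round_abs_le[of x] by (simp add: v_def track_def x_def j_def)
      ultimately show ?thesis
        using b[of i] by linarith
    qed
    show "y \<notin> fractal_percolation N \<omega>"
    proof
      assume "y \<in> fractal_percolation N \<omega>"
      then obtain Q where Q: "Q \<in> grid_cubes N (n + m)" "\<omega> Q" "y \<in> Q"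
        unfolding fractal_percolation_def chosen_cubes_def by blast
      then obtain l where l: "Q = grid_cube N (n + m) l" "\<And>i. l i \<in> {1..N ^ (n + m)}"
        unfolding grid_cubes_eq by blast
      have Upos: "U > 0"
        using N by (simp add: U_def)
      have "int (l i) = v i \<or> int (l i) = v i + 1" for i
      proof -
        have "(real (l i) - 1) / U \<le> y $ i" "y $ i \<le> real (l i) / U"
          using Q(3) unfolding l(1) grid_cube_def by (simp_all add: mem_box_cart U_def)
        then have "real (l i) - 1 \<le> U * y $ i" "U * y $ i \<le> real (l i)"
          using Upos by (simp_all add: field_simps)
        then have "real_of_int (int (l i)) < real_of_int (v i + 2)" "real_of_int (v i) < real_of_int (int (l i) + 1)"
          using near[of i] by auto
        then have "int (l i) < v i + 2" "v i < int (l i) + 1"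
          by (simp_all only: of_int_less_iff)
        then show ?thesis
          by linarith
      qed
      then have "Q \<in> vertex_cubes N (n + m) v"
        unfolding vertex_cubes_def l(1) using l(2) by blast
      then show False
        using r(2) Q(2) unfolding hit_def v_def by blast
    qed
  qed
qed

section \<open>Slopes on N-adic intervals as a bounded martingale\<close>

definition slope :: "nat \<Rightarrow> (real \<Rightarrow> 'b::real_inner) \<Rightarrow> nat \<Rightarrow> nat \<Rightarrow> 'b" where
  "slope N \<gamma> n \<tau> = real N ^ n *\<^sub>R (\<gamma> (real (Suc \<tau>) / real N ^ n) - \<gamma> (real \<tau> / real N ^ n))"

text \<open>By \<open>sum_slope_block\<close> the fine slopes average to the coarse one, so this is
  \<open>N ^ m\<close> times their variance: a squared martingale increment.\<close>

definition oscillation :: "nat \<Rightarrow> (real \<Rightarrow> 'b::real_inner) \<Rightarrow> nat \<Rightarrow> nat \<Rightarrow> nat \<Rightarrow> real" where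
  "oscillation N \<gamma> n m \<tau> =
     (\<Sum>j<N ^ m. (norm (slope N \<gamma> (n + m) (\<tau> * N ^ m + j) - slope N \<gamma> n \<tau>))\<^sup>2)"

lemma sum_slope:
  assumes "N > 0"
  shows "(\<Sum>j<i. slope N \<gamma> (n + m) (\<tau> * N ^ m + j)) =
    real N ^ (n + m) *\<^sub>R (\<gamma> (real (\<tau> * N ^ m + i) / real N ^ (n + m)) - \<gamma> (real \<tau> / real N ^ n))"
proof -
  have "(\<Sum>j<i. slope N \<gamma> (n + m) (\<tau> * N ^ m + j)) =
    real N ^ (n + m) *\<^sub>R (\<Sum>j<i. \<gamma> (real (\<tau> * N ^ m + Suc j) / real N ^ (n + m)) - \<gamma> (real (\<tau> * N ^ m + j) / real N ^ (n + m)))"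
    by (simp add: slope_def scaleR_sum_right)
  also have "\<dots> = real N ^ (n + m) *\<^sub>R (\<gamma> (real (\<tau> * N ^ m + i) / real N ^ (n + m)) - \<gamma> (real (\<tau> * N ^ m + 0) / real N ^ (n + m)))"
    by (subst sum_lessThan_telescope[of "\<lambda>j. \<gamma> (real (\<tau> * N ^ m + j) / real N ^ (n + m))"]) simp
  also have "real (\<tau> * N ^ m + 0) / real N ^ (n + m) = real \<tau> / real N ^ n"
    using assms by (simp add: power_add)
  finally show ?thesis .
qed

lemma sum_slope_block:
  assumes "N > 0"
  shows "(\<Sum>j<N ^ m. slope N \<gamma> (n + m) (\<tau> * N ^ m + j)) = real N ^ m *\<^sub>R slope N \<gamma> n \<tau>"
proof -
  have "real (\<tau> * N ^ m + N ^ m) / real N ^ (n + m) = real (Suc \<tau>) / real N ^ n"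
    using assms by (simp add: power_add field_simps)
  moreover have "real N ^ (n + m) = real N ^ m * real N ^ n"
    by (simp add: power_add)
  ultimately show ?thesis
    unfolding sum_slope[OF assms] by (simp only: slope_def scaleR_scaleR)
qed

lemma oscillation_eq:
  assumes "N > 0"
  shows "oscillation N \<gamma> n m \<tau> =
    (\<Sum>j<N ^ m. (norm (slope N \<gamma> (n + m) (\<tau> * N ^ m + j)))\<^sup>2) - real N ^ m * (norm (slope N \<gamma> n \<tau>))\<^sup>2"
proof -
  let ?a = "\<lambda>j. slope N \<gamma> (n + m) (\<tau> * N ^ m + j)" and ?b = "slope N \<gamma> n \<tau>"
  have "oscillation N \<gamma> n m \<tau> = (\<Sum>j<N ^ m. (norm (?a j))\<^sup>2 - 2 * (?a j \<bullet> ?b) + (norm ?b)\<^sup>2)"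
    unfolding oscillation_def
    by (intro sum.cong refl) (simp add: power2_norm_eq_inner inner_diff inner_commute algebra_simps)
  also have "\<dots> = (\<Sum>j<N ^ m. (norm (?a j))\<^sup>2) - 2 * ((\<Sum>j<N ^ m. ?a j) \<bullet> ?b) + real N ^ m * (norm ?b)\<^sup>2"
    by (simp add: sum.distrib sum_subtractf inner_sum_left sum_distrib_left)
  also have "(\<Sum>j<N ^ m. ?a j) \<bullet> ?b = real N ^ m * (norm ?b)\<^sup>2"
    by (simp add: sum_slope_block[OF assms] power2_norm_eq_inner)
  finally show ?thesis
    by simp
qed

text \<open>Squared L2 norm, on an interval of length \<open>N ^ -n1\<close>, of the step function
  of slopes; the divisor \<open>N ^ n\<close> supplies the length of the steps.\<close>

definition energy :: "nat \<Rightarrow> (real \<Rightarrow> 'b::real_inner) \<Rightarrow> nat \<Rightarrow> nat \<Rightarrow> real" where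
  "energy N \<gamma> n1 n = (\<Sum>\<tau><N ^ (n - n1). (norm (slope N \<gamma> n \<tau>))\<^sup>2) / real N ^ n"

lemma sum_oscillation:
  assumes "N > 0" "n1 \<le> n"
  shows "(\<Sum>\<tau><N ^ (n - n1). oscillation N \<gamma> n m \<tau>) =
    real N ^ (n + m) * (energy N \<gamma> n1 (n + m) - energy N \<gamma> n1 n)"
proof -
  let ?g = "\<lambda>\<tau>. (norm (slope N \<gamma> (n + m) \<tau>))\<^sup>2"
  have "(\<Sum>\<tau><N ^ (n - n1). \<Sum>j<N ^ m. ?g (\<tau> * N ^ m + j)) = (\<Sum>\<tau><N ^ (n - n1). sum ?g {\<tau> * N ^ m..<\<tau> * N ^ m + N ^ m})"
    by (rule sum.cong[OF refl], subst sum.atLeastLessThan_shift_0) (simp add: lessThan_atLeast0 comp_def)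
  also have "\<dots> = (\<Sum>\<tau><N ^ (n - n1) * N ^ m. ?g \<tau>)"
    by (rule sum.nat_group)
  also have "N ^ (n - n1) * N ^ m = N ^ (n + m - n1)"
    using assms by (simp add: power_add[symmetric])
  finally have "(\<Sum>\<tau><N ^ (n - n1). \<Sum>j<N ^ m. ?g (\<tau> * N ^ m + j)) = (\<Sum>\<tau><N ^ (n + m - n1). ?g \<tau>)" .
  then show ?thesis
    using assms
    by (simp add: oscillation_eq energy_def sum_subtractf sum_distrib_left[symmetric] power_add right_diff_distrib)
qed

lemma norm_slope_le:
  assumes "N > 0" "L-lipschitz_on UNIV \<gamma>"
  shows "norm (slope N \<gamma> n \<tau>) \<le> L"
proof -
  have "norm (\<gamma> (real (Suc \<tau>) / real N ^ n) - \<gamma> (real \<tau> / real N ^ n))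
      \<le> L * \<bar>real (Suc \<tau>) / real N ^ n - real \<tau> / real N ^ n\<bar>"
    using lipschitz_onD[OF assms(2), of "real (Suc \<tau>) / real N ^ n" "real \<tau> / real N ^ n"]
    by (simp add: dist_norm)
  also have "real (Suc \<tau>) / real N ^ n - real \<tau> / real N ^ n = 1 / real N ^ n"
    by (simp add: diff_divide_distrib[symmetric])
  finally have "norm (\<gamma> (real (Suc \<tau>) / real N ^ n) - \<gamma> (real \<tau> / real N ^ n)) \<le> L / real N ^ n"
    by simp
  then show ?thesis
    unfolding slope_def norm_scaleR using assms(1) by (simp add: pos_le_divide_eq mult.commute)
qed

lemma energy_le:
  assumes "N > 0" "L-lipschitz_on UNIV \<gamma>" "n1 \<le> n"
  shows "energy N \<gamma> n1 n \<le> L\<^sup>2 / real N ^ n1"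
proof -
  have "(\<Sum>\<tau><N ^ (n - n1). (norm (slope N \<gamma> n \<tau>))\<^sup>2) \<le> (\<Sum>\<tau><N ^ (n - n1). L\<^sup>2)"
    using norm_slope_le[OF assms(1,2)] by (intro sum_mono power_mono) auto
  then have "energy N \<gamma> n1 n \<le> real N ^ (n - n1) * L\<^sup>2 / real N ^ n"
    unfolding energy_def by (intro divide_right_mono) auto
  also have "\<dots> = L\<^sup>2 / real N ^ n1"
    using assms by (simp add: power_diff field_simps)
  finally show ?thesis .
qed

lemma energy_nonneg: "0 \<le> energy N \<gamma> n1 n"
  unfolding energy_def by (intro divide_nonneg_nonneg sum_nonneg) auto

text \<open>Energies are nonnegative and at most \<open>L\<^sup>2 / N ^ n1\<close> per curve, so
  among \<open>K\<close> successive steps of \<open>m\<close> levels one gains at most a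
  \<open>K\<close>-th of that. Summing over \<open>Y\<close> before the pigeonhole gives one scale
  for all curves.\<close>

lemma exists_scale_small_oscillation:
  fixes \<gamma> :: "'y \<Rightarrow> real \<Rightarrow> 'b::real_inner"
  assumes N: "N > 0" and Y: "finite Y" "Y \<noteq> {}" and lip: "\<And>y. L-lipschitz_on UNIV (\<gamma> y)"
    and "n1 \<le> n2" and K: "K > 0"
  obtains i where "i < K"
    "(\<Sum>y\<in>Y. \<Sum>\<tau><N ^ (n2 + i * m - n1). oscillation N (\<gamma> y) (n2 + i * m) m \<tau>)
      \<le> real (card Y) * L\<^sup>2 * real N ^ (n2 + i * m + m - n1) / real K"
proof -
  define e where "e i = (\<Sum>y\<in>Y. energy N (\<gamma> y) n1 (n2 + i * m))" for i
  have "\<exists>i<K. e (Suc i) - e i \<le> real (card Y) * L\<^sup>2 / real N ^ n1 / real K"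
  proof (rule ccontr)
    assume "\<not> ?thesis"
    then have "(\<Sum>i<K. real (card Y) * L\<^sup>2 / real N ^ n1 / real K) < (\<Sum>i<K. e (Suc i) - e i)"
      using K by (intro sum_strict_mono) auto
    also have "\<dots> = e K - e 0"
      by (rule sum_lessThan_telescope)
    also have "\<dots> \<le> e K"
      by (simp add: e_def sum_nonneg energy_nonneg)
    also have "\<dots> \<le> (\<Sum>y\<in>Y. L\<^sup>2 / real N ^ n1)"
      unfolding e_def using energy_le[OF N lip] \<open>n1 \<le> n2\<close> by (intro sum_mono) auto
    finally show False
      using K by simp
  qed
  then obtain i where i: "i < K" "e (Suc i) - e i \<le> real (card Y) * L\<^sup>2 / real N ^ n1 / real K"
    by blast
  have "(\<Sum>y\<in>Y. \<Sum>\<tau><N ^ (n2 + i * m - n1). oscillation N (\<gamma> y) (n2 + i * m) m \<tau>)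
      = (\<Sum>y\<in>Y. real N ^ (n2 + i * m + m) * (energy N (\<gamma> y) n1 (n2 + i * m + m) - energy N (\<gamma> y) n1 (n2 + i * m)))"
    using \<open>n1 \<le> n2\<close> by (intro sum.cong refl sum_oscillation N) auto
  also have "\<dots> = real N ^ (n2 + i * m + m) * (e (Suc i) - e i)"
    by (simp add: e_def sum_distrib_left[symmetric] sum_subtractf[symmetric] add_ac)
  also have "\<dots> \<le> real N ^ (n2 + i * m + m) * (real (card Y) * L\<^sup>2 / real N ^ n1 / real K)"
    using i(2) by (intro mult_left_mono) auto
  also have "\<dots> = real (card Y) * L\<^sup>2 * real N ^ (n2 + i * m + m - n1) / real K"
    using N \<open>n1 \<le> n2\<close> by (simp add: power_diff)
  finally show thesis
    using i(1) that by blast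
qed

text \<open>The threshold puts each fine slope within \<open>1 / (16 * N ^ m)\<close> of the coarse
  slope, and at most \<open>N ^ m\<close> such errors add up.\<close>

lemma small_oscillation_imp_straight:
  assumes N: "N > 0" and osc: "oscillation N \<gamma> n m \<tau> \<le> (1 / (16 * real N ^ m))\<^sup>2" and j: "j \<le> N ^ m"
  shows "norm (real N ^ (n + m) *\<^sub>R (\<gamma> (real (\<tau> * N ^ m + j) / real N ^ (n + m)) - \<gamma> (real \<tau> / real N ^ n))
    - real j *\<^sub>R slope N \<gamma> n \<tau>) \<le> 1 / 16"
proof -
  let ?d = "\<lambda>i. slope N \<gamma> (n + m) (\<tau> * N ^ m + i) - slope N \<gamma> n \<tau>"
  have le: "norm (?d i) \<le> 1 / (16 * real N ^ m)" if "i < N ^ m" for i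
  proof -
    have "(norm (?d i))\<^sup>2 \<le> oscillation N \<gamma> n m \<tau>"
      unfolding oscillation_def using that by (intro member_le_sum) auto
    also note osc
    finally show ?thesis
      by (rule power2_le_imp_le) simp
  qed
  have "real N ^ (n + m) *\<^sub>R (\<gamma> (real (\<tau> * N ^ m + j) / real N ^ (n + m)) - \<gamma> (real \<tau> / real N ^ n))
    - real j *\<^sub>R slope N \<gamma> n \<tau> = (\<Sum>i<j. ?d i)"
    by (simp only: sum_subtractf sum_slope[OF N] sum_constant_scaleR card_lessThan)
  also have "norm \<dots> \<le> (\<Sum>i<j. 1 / (16 * real N ^ m))"
    using le j by (intro sum_norm_le) auto
  also have "\<dots> = real j / real N ^ m / 16"
    by simp
  also have "\<dots> \<le> 1 / 16"
  proof -
    have "real j \<le> real (N ^ m)"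
      using j by (simp only: of_nat_le_iff)
    then have "real j / real N ^ m \<le> 1"
      using N by (simp add: divide_le_eq)
    then show ?thesis
      by simp
  qed
  finally show ?thesis .
qed

section \<open>Cells of the domain\<close>

definition subcells :: "nat \<Rightarrow> nat \<Rightarrow> ('k \<Rightarrow> int) \<Rightarrow> ('k \<Rightarrow> int) set" where
  "subcells N m a = {a'. \<forall>i. a i * int N ^ m \<le> a' i \<and> a' i < (a i + 1) * int N ^ m}"

text \<open>
  A line in direction \<open>i0\<close> is encoded by an integer vector whose coordinate \<open>i0\<close> is irrelevant;
  fixing it to \<open>e\<close> makes the encoding unique.
\<close>

definition slab :: "'k \<Rightarrow> int \<Rightarrow> ('k \<Rightarrow> int) \<Rightarrow> nat \<Rightarrow> ('k \<Rightarrow> int) set" where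
  "slab i0 e lo M = {y. y i0 = e \<and> (\<forall>i. i \<noteq> i0 \<longrightarrow> lo i \<le> y i \<and> y i < lo i + int M)}"

text \<open>Indices of cells are lower corners, whereas \<^const>\<open>grid_cube\<close> uses upper corners.\<close>

definition cell :: "nat \<Rightarrow> nat \<Rightarrow> ('k::finite \<Rightarrow> int) \<Rightarrow> (real ^ 'k) set" where
  "cell N n a = {x. \<forall>i. real_of_int (a i) \<le> real N ^ n * x $ i \<and> real N ^ n * x $ i \<le> real_of_int (a i) + 1}"

definition line_point :: "nat \<Rightarrow> nat \<Rightarrow> 'k \<Rightarrow> ('k::finite \<Rightarrow> int) \<Rightarrow> real \<Rightarrow> real ^ 'k" where
  "line_point N h i0 y t = (\<chi> i. if i = i0 then t else real_of_int (y i) / real N ^ h)"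

lemma subcells_eq: "subcells N m a = PiE UNIV (\<lambda>i. {a i * int N ^ m..<(a i + 1) * int N ^ m})"
  by (auto simp: subcells_def PiE_iff)

lemma finite_subcells: "finite (subcells N m (a :: 'k::finite \<Rightarrow> int))"
  unfolding subcells_eq by (intro finite_PiE) auto

lemma card_subcells: "card (subcells N m (a :: 'k::finite \<Rightarrow> int)) = (N ^ m) ^ CARD('k)"
  unfolding subcells_eq by (simp add: card_PiE algebra_simps nat_power_eq)

lemma slab_eq: "slab i0 e lo M = PiE UNIV (\<lambda>i. if i = i0 then {e} else {lo i..<lo i + int M})"
  by (auto simp: slab_def PiE_iff split: if_splits)

lemma finite_slab: "finite (slab (i0 :: 'k::finite) e lo M)"
  unfolding slab_eq by (intro finite_PiE) auto

lemma card_slab: "card (slab (i0 :: 'k::finite) e lo M) = M ^ (CARD('k) - 1)"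
proof -
  have "card (slab i0 e lo M) = (\<Prod>i\<in>UNIV. if i = i0 then 1 else M)"
    unfolding slab_eq by (subst card_PiE) (auto intro!: prod.cong)
  also have "\<dots> = (\<Prod>i\<in>UNIV - {i0}. M)"
    by (subst prod.remove[of _ i0]) (auto intro!: prod.cong)
  finally show ?thesis
    by simp
qed

lemma cell_dist:
  assumes "N > 0" "x \<in> cell N n a" "y \<in> cell N n (a :: 'k::finite \<Rightarrow> int)"
  shows "dist x y \<le> real CARD('k) / real N ^ n"
proof -
  have "\<bar>(x - y) $ i\<bar> \<le> 1 / real N ^ n" for i
  proof -
    have "\<bar>real N ^ n * x $ i - real N ^ n * y $ i\<bar> \<le> 1"
    proof -
      have "real_of_int (a i) \<le> real N ^ n * x $ i" "real N ^ n * x $ i \<le> real_of_int (a i) + 1"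
        "real_of_int (a i) \<le> real N ^ n * y $ i" "real N ^ n * y $ i \<le> real_of_int (a i) + 1"
        using assms unfolding cell_def by auto
      then show ?thesis
        by linarith
    qed
    then have "real N ^ n * \<bar>(x - y) $ i\<bar> \<le> 1"
      by (simp add: right_diff_distrib[symmetric] abs_mult)
    then show ?thesis
      using assms(1) by (simp add: pos_le_divide_eq mult.commute)
  qed
  then have "(\<Sum>i\<in>UNIV. \<bar>(x - y) $ i\<bar>) \<le> (\<Sum>i\<in>(UNIV :: 'k set). 1 / real N ^ n)"
    by (intro sum_mono) auto
  then show ?thesis
    unfolding dist_norm using norm_le_l1_cart[of "x - y"] by simp
qed

lemma exists_cell: "\<exists>a. x \<in> cell N n a"
proof
  show "x \<in> cell N n (\<lambda>i. \<lfloor>real N ^ n * x $ i\<rfloor>)"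
    by (simp add: cell_def less_imp_le[OF real_of_int_floor_add_one_gt])
qed

lemma cell_subset_subcells:
  assumes "N > 0"
  shows "cell N n a \<subseteq> (\<Union>a'\<in>subcells N m a. cell N (n + m) a')"
proof
  fix x assume x: "x \<in> cell N n a"
  \<comment> \<open>On the upper face of the cell the floor would leave the half-open range of
    \<open>subcells\<close>; the minimum moves it back into the last subcell.\<close>
  define a' where "a' i = min \<lfloor>real N ^ (n + m) * x $ i\<rfloor> ((a i + 1) * int N ^ m - 1)" for i
  have "a i * int N ^ m \<le> a' i \<and> a' i < (a i + 1) * int N ^ m \<and>
      real_of_int (a' i) \<le> real N ^ (n + m) * x $ i \<and> real N ^ (n + m) * x $ i \<le> real_of_int (a' i) + 1" for i
  proof -
    have "real N ^ m * real_of_int (a i) \<le> real N ^ m * (real N ^ n * x $ i)"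
      "real N ^ m * (real N ^ n * x $ i) \<le> real N ^ m * (real_of_int (a i) + 1)"
      using x unfolding cell_def by (intro mult_left_mono; simp)+
    then have le: "real_of_int (a i * int N ^ m) \<le> real N ^ (n + m) * x $ i"
      "real N ^ (n + m) * x $ i \<le> real_of_int ((a i + 1) * int N ^ m)"
      by (simp_all add: power_add algebra_simps)
    have "0 < int N ^ m"
      using assms by simp
    then have "a i * int N ^ m \<le> a' i"
    proof -
      have "a i * int N ^ m \<le> \<lfloor>real N ^ (n + m) * x $ i\<rfloor>"
        using le(1) by (simp only: le_floor_iff)
      moreover have "(a i + 1) * int N ^ m = a i * int N ^ m + int N ^ m"
        by (simp add: algebra_simps)
      ultimately show ?thesis
        using \<open>0 < int N ^ m\<close> unfolding a'_def by linarith
    qed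
    moreover have "a' i < (a i + 1) * int N ^ m"
      unfolding a'_def by linarith
    moreover have "real_of_int (a' i) \<le> real N ^ (n + m) * x $ i"
      unfolding a'_def by (meson le_floor_iff min.cobounded1)
    moreover have "real N ^ (n + m) * x $ i \<le> real_of_int (a' i) + 1"
    proof (cases "\<lfloor>real N ^ (n + m) * x $ i\<rfloor> \<le> (a i + 1) * int N ^ m - 1")
      case True
      then show ?thesis
        unfolding a'_def by (simp add: less_imp_le[OF real_of_int_floor_add_one_gt])
    next
      case False
      then have "a' i = (a i + 1) * int N ^ m - 1"
        unfolding a'_def by simp
      then have "real_of_int (a' i) + 1 = real_of_int ((a i + 1) * int N ^ m)"
        by simp
      then show ?thesis
        using le(2) by simp
    qed
    ultimately show ?thesis
      by blast
  qed
  then have "a' \<in> subcells N m a" "x \<in> cell N (n + m) a'"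
    by (simp_all add: subcells_def cell_def)
  then show "x \<in> (\<Union>a'\<in>subcells N m a. cell N (n + m) a')"
    by blast
qed

lemma floor_in_subcells:
  assumes "N > 0"
    and "\<And>i. real_of_int (a i) \<le> real N ^ n * p $ i" "\<And>i. real N ^ n * p $ i < real_of_int (a i) + 1"
  shows "(\<lambda>i. \<lfloor>real N ^ (n + m) * p $ i\<rfloor>) \<in> subcells N m a"
proof -
  have "a i * int N ^ m \<le> \<lfloor>real N ^ (n + m) * p $ i\<rfloor> \<and> \<lfloor>real N ^ (n + m) * p $ i\<rfloor> < (a i + 1) * int N ^ m" for i
  proof -
    have "real N ^ m * real_of_int (a i) \<le> real N ^ m * (real N ^ n * p $ i)"
      using assms by (intro mult_left_mono) auto
    moreover have "real N ^ m * (real N ^ n * p $ i) < real N ^ m * (real_of_int (a i) + 1)"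
      using assms by (intro mult_strict_left_mono) auto
    ultimately have "real_of_int (a i * int N ^ m) \<le> real N ^ (n + m) * p $ i"
      "real N ^ (n + m) * p $ i < real_of_int ((a i + 1) * int N ^ m)"
      by (simp_all add: power_add algebra_simps)
    then show ?thesis
      by (simp only: le_floor_iff floor_less_iff)
  qed
  then show ?thesis
    by (simp add: subcells_def)
qed

lemma dist_line_point: "dist (line_point N h i0 y s) (line_point N h i0 y t) = \<bar>s - t\<bar>"
proof -
  have "line_point N h i0 y s - line_point N h i0 y t = axis i0 (s - t)"
    by (simp add: vec_eq_iff line_point_def axis_def)
  then show ?thesis
    by (simp add: dist_norm norm_eq_sqrt_inner inner_axis_axis)
qed

lemma lipschitz_line:
  assumes "L-lipschitz_on UNIV f"
  shows "L-lipschitz_on UNIV (\<lambda>t. f (line_point N h i0 y (c + t)))"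
proof (rule lipschitz_onI)
  fix s t :: real
  show "dist (f (line_point N h i0 y (c + s))) (f (line_point N h i0 y (c + t))) \<le> L * dist s t"
    using lipschitz_onD[OF assms, of "line_point N h i0 y (c + s)" "line_point N h i0 y (c + t)"]
    by (simp add: dist_line_point dist_real_def)
qed (rule lipschitz_on_nonneg[OF assms])

lemma slab_point_bounds:
  assumes "N > 0" "y \<in> slab i0 e (\<lambda>i. a i * int N ^ r) (N ^ r)" "i \<noteq> i0"
  shows "real_of_int (a i) \<le> real N ^ n * (real_of_int (y i) / real N ^ (n + r))"
    and "real N ^ n * (real_of_int (y i) / real N ^ (n + r)) < real_of_int (a i) + 1"
proof -
  have pos: "real N ^ r > 0"
    using assms(1) by simp
  have eq: "real N ^ n * (real_of_int (y i) / real N ^ (n + r)) = real_of_int (y i) / real N ^ r"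
    using assms(1) by (simp add: power_add)
  have "a i * int N ^ r \<le> y i" "y i < (a i + 1) * int N ^ r"
    using assms(2,3) by (auto simp: slab_def algebra_simps)
  then have "real_of_int (a i * int N ^ r) \<le> real_of_int (y i)" "real_of_int (y i) < real_of_int ((a i + 1) * int N ^ r)"
    by (simp_all only: of_int_le_iff of_int_less_iff)
  then have "real_of_int (a i) * real N ^ r \<le> real_of_int (y i)" "real_of_int (y i) < (real_of_int (a i) + 1) * real N ^ r"
    by simp_all
  then show "real_of_int (a i) \<le> real N ^ n * (real_of_int (y i) / real N ^ (n + r))"
    "real N ^ n * (real_of_int (y i) / real N ^ (n + r)) < real_of_int (a i) + 1"
    unfolding eq using pos by (simp_all only: pos_le_divide_eq pos_divide_less_eq)
qed

lemma slab_subcells_subset: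
  assumes "N > 0" "\<sigma> \<in> subcells N m a"
  shows "slab i0 e (\<lambda>i. \<sigma> i * int N ^ r) (N ^ r) \<subseteq> slab i0 e (\<lambda>i. a i * int N ^ (m + r)) (N ^ (m + r))"
proof -
  have pos: "0 \<le> int N ^ r"
    by simp
  have le: "a i * int N ^ (m + r) \<le> \<sigma> i * int N ^ r \<and> \<sigma> i * int N ^ r + int N ^ r \<le> a i * int N ^ (m + r) + int N ^ (m + r)" for i
  proof -
    have "a i * int N ^ m \<le> \<sigma> i" "\<sigma> i + 1 \<le> (a i + 1) * int N ^ m"
      using assms(2) by (auto simp: subcells_def zless_imp_add1_zle)
    then have "a i * int N ^ m * int N ^ r \<le> \<sigma> i * int N ^ r" "(\<sigma> i + 1) * int N ^ r \<le> (a i + 1) * int N ^ m * int N ^ r"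
      using pos by (intro mult_right_mono; simp)+
    then show ?thesis
      by (simp add: power_add algebra_simps)
  qed
  show ?thesis
  proof
    fix y assume y: "y \<in> slab i0 e (\<lambda>i. \<sigma> i * int N ^ r) (N ^ r)"
    have "a i * int N ^ (m + r) \<le> y i \<and> y i < a i * int N ^ (m + r) + int (N ^ (m + r))" if "i \<noteq> i0" for i
    proof -
      have "\<sigma> i * int N ^ r \<le> y i \<and> y i < \<sigma> i * int N ^ r + int (N ^ r)"
        using y that by (simp add: slab_def)
      then show ?thesis
        using le[of i] unfolding of_nat_power by linarith
    qed
    then show "y \<in> slab i0 e (\<lambda>i. a i * int N ^ (m + r)) (N ^ (m + r))"
      using y by (simp add: slab_def)
  qed
qed

section \<open>A fixed Lipschitz map at a fixed covering scale\<close>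

locale lipschitz_image =
  fixes N :: nat and \<omega> :: "(real ^ 'd) set \<Rightarrow> bool" and f :: "real ^ 'k \<Rightarrow> real ^ 'd"
    and L :: nat and \<delta> :: real and i0 :: "'k::finite"
  assumes N: "N \<ge> 2" and lip: "(real L)-lipschitz_on UNIV f" and \<delta>: "\<delta> > 0"
begin

text \<open>The scale \<delta> stays fixed throughout: vanishing of this quantity for every \<delta>
  is all that the Hausdorff measure needs.\<close>

definition H :: "(real ^ 'k) set \<Rightarrow> ennreal" where
  "H A = hausdorff_premeasure CARD('k) \<delta> (f ` A \<inter> fractal_percolation N \<omega>)"

text \<open>In units of \<open>N ^ -n\<close>, the image of a cell varies by at most
  \<open>L * CARD('k)\<close> per coordinate; the floor in \<open>anchor\<close> adds 1.\<close>

definition D :: nat where "D = L * CARD('k) + 1"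

text \<open>\<open>2 * CARD('d)\<close> turns the radius of a box into a diameter bound; the other
  factor is the radius of \<open>thin_box_near_line\<close>.\<close>

definition C :: real where "C = 2 * real CARD('d) * (real (L * CARD('k) + L) + 5)"

definition anchor :: "nat \<Rightarrow> ('k \<Rightarrow> int) \<Rightarrow> 'd \<Rightarrow> int" where
  "anchor n a = (\<lambda>i. \<lfloor>real N ^ n * f (\<chi> i. real_of_int (a i) / real N ^ n) $ i\<rfloor>)"

lemma Npos: "N > 0" "real N > 0"
  using N by auto

lemma f_component: "\<bar>f x $ i - f y $ i\<bar> \<le> real L * dist x y"
proof -
  have "\<bar>f x $ i - f y $ i\<bar> \<le> dist (f x) (f y)"
    unfolding dist_norm using component_le_norm_cart[of "f x - f y" i] by simp
  then show ?thesis
    using lipschitz_onD[OF lip, of x y] by simp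
qed

lemma f_component_cell:
  assumes "x \<in> cell N n a" "y \<in> cell N n a"
  shows "\<bar>f x $ i - f y $ i\<bar> \<le> real (L * CARD('k)) / real N ^ n"
proof -
  have "real L * dist x y \<le> real L * (real CARD('k) / real N ^ n)"
    using cell_dist[OF Npos(1) assms] by (intro mult_left_mono) auto
  then show ?thesis
    using f_component[of x i y] by simp
qed

lemma corner_in_cell: "(\<chi> i. real_of_int (a i) / real N ^ n) \<in> cell N n a"
  using Npos by (simp add: cell_def)

lemma near_anchor:
  assumes "x \<in> cell N n a"
  shows "\<bar>real N ^ n * f x $ i - real_of_int (anchor n a i)\<bar> \<le> real D"
proof -
  let ?c = "\<chi> i. real_of_int (a i) / real N ^ n"
  have "real N ^ n * \<bar>f x $ i - f ?c $ i\<bar> \<le> real (L * CARD('k))"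
    using f_component_cell[OF assms corner_in_cell, of i] Npos by (simp add: pos_le_divide_eq mult.commute)
  then have "\<bar>real N ^ n * f x $ i - real N ^ n * f ?c $ i\<bar> \<le> real (L * CARD('k))"
    by (simp add: right_diff_distrib[symmetric] abs_mult)
  moreover have "real_of_int (anchor n a i) \<le> real N ^ n * f ?c $ i" "real N ^ n * f ?c $ i < real_of_int (anchor n a i) + 1"
    unfolding anchor_def by (rule of_int_floor_le, rule real_of_int_floor_add_one_gt)
  moreover have "real D = real (L * CARD('k)) + 1"
    unfolding D_def by simp
  ultimately show ?thesis
    by linarith
qed

lemma H_sum_le:
  assumes "finite I" "X \<subseteq> (\<Union>i\<in>I. A i)" "\<And>i. i \<in> I \<Longrightarrow> H (A i) \<le> ennreal (c i)" "\<And>i. i \<in> I \<Longrightarrow> 0 \<le> c i"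
  shows "H X \<le> ennreal (\<Sum>i\<in>I. c i)"
proof -
  have "f ` X \<inter> fractal_percolation N \<omega> \<subseteq> (\<Union>i\<in>I. f ` A i \<inter> fractal_percolation N \<omega>)"
    using assms(2) by blast
  then show ?thesis
    using assms(1,4) \<delta> assms(3)[unfolded H_def] unfolding H_def
    by (intro hausdorff_premeasure_sum_le[of I \<delta> _ "\<lambda>i. f ` A i \<inter> fractal_percolation N \<omega>"]) (assumption | simp)+
qed

lemma H_le_box:
  assumes "\<And>x i. x \<in> A \<Longrightarrow> \<bar>f x $ i - c i\<bar> \<le> (real (L * CARD('k) + L) + 5) * \<rho>" "0 \<le> \<rho>" "C * \<rho> \<le> \<delta>"
  shows "H A \<le> ennreal ((C * \<rho>) ^ CARD('k))"
  unfolding H_def C_def mult.assoc[of _ _ \<rho>]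
  using assms by (intro hausdorff_premeasure_le_box) (auto simp: C_def mult.assoc)

text \<open>Intervals are numbered by natural numbers, cells by possibly negative integers. The
  shift \<open>t0\<close> brings the lower face of the large cell to parameter 0.\<close>

abbreviation curve :: "nat \<Rightarrow> ('k \<Rightarrow> int) \<Rightarrow> real \<Rightarrow> real \<Rightarrow> real ^ 'd" where
  "curve h y t0 \<equiv> (\<lambda>t. f (line_point N h i0 y (t0 + t)))"

lemma curve_straight:
  assumes "oscillation N \<gamma> n m \<tau> \<le> (1 / (16 * real N ^ m))\<^sup>2" "j \<le> N ^ m"
  shows "\<bar>real N ^ (n + m) * (\<gamma> (real (\<tau> * N ^ m + j) / real N ^ (n + m)) $ i
    - \<gamma> (real (\<tau> * N ^ m + 0) / real N ^ (n + m)) $ i) - real j * slope N \<gamma> n \<tau> $ i\<bar> \<le> 1 / 16"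
proof -
  have "real (\<tau> * N ^ m + 0) / real N ^ (n + m) = real \<tau> / real N ^ n"
    using Npos by (simp add: power_add)
  then show ?thesis
    using order_trans[OF component_le_norm_cart small_oscillation_imp_straight[OF Npos(1) assms], of i]
    by simp
qed

text \<open>The condition on \<open>t0\<close> says that interval \<tau> is the extent of the cell
  along \<open>i0\<close>. By the choice of \<open>m3\<close>, the image of a subcell varies by at
  most 1/4 fine unit, the tolerance in \<open>untouched_spot\<close>, so a whole subcell misses the
  percolation set.\<close>

lemma hole_in_cell:
  assumes q: "N ^ m div q > 0" and m3: "4 * (L * CARD('k)) \<le> N ^ m3"
    and y: "y \<in> slab i0 0 (\<lambda>i. a i * int N ^ r) (N ^ r)"
    and t0: "real N ^ n * t0 + real \<tau> = real_of_int (a i0)"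
    and osc: "oscillation N (curve (n + r) y t0) n m \<tau> \<le> (1 / (16 * real N ^ m))\<^sup>2"
    and steep: "4 \<le> real q * \<bar>slope N (curve (n + r) y t0) n \<tau> $ i\<bar>"
    and not_bad: "\<not> bad N n m D q \<omega> (anchor n a)"
  obtains a' where "a' \<in> subcells N (m + m3) a" "H (cell N (n + (m + m3)) a') = 0"
proof -
  let ?\<gamma> = "curve (n + r) y t0"
  define p where "p j = line_point N (n + r) i0 y (t0 + real (\<tau> * N ^ m + j) / real N ^ (n + m))" for j
  have p: "real_of_int (a i) \<le> real N ^ n * p j $ i \<and> real N ^ n * p j $ i < real_of_int (a i) + 1"
    if "j < N ^ m" for j i
  proof (cases "i = i0")
    case True
    have "real N ^ n * (t0 + real (\<tau> * N ^ m + j) / real N ^ (n + m)) = real_of_int (a i0) + real j / real N ^ m"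
      using Npos by (simp add: t0[symmetric] power_add field_simps)
    moreover have "real j < real (N ^ m)"
      using that by (simp only: of_nat_less_iff)
    then have "real j / real N ^ m < 1"
      using Npos by (simp add: divide_less_eq)
    ultimately show ?thesis
      using True by (simp add: p_def line_point_def)
  next
    case False
    then show ?thesis
      using slab_point_bounds[OF Npos(1) y False, of n] by (simp add: p_def line_point_def)
  qed
  then have p_cell: "p j \<in> cell N n a" if "j < N ^ m" for j
    using that by (simp add: cell_def less_imp_le)
  have "1 \<le> CARD('k)"
    by (simp add: Suc_le_eq)
  then have "L * 1 \<le> L * CARD('k)"
    by (rule mult_le_mono2)
  then have D: "L + 1 \<le> D"
    by (simp add: D_def)
  obtain j where j: "j < N ^ m"
    "\<And>y. (\<And>i. \<bar>real N ^ (n + m) * (y $ i - f (p j) $ i)\<bar> \<le> 1 / 4) \<Longrightarrow> y \<notin> fractal_percolation N \<omega>"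
  proof (rule untouched_spot[OF Npos(1) q D, of n "\<lambda>j. f (p j)" "slope N ?\<gamma> n \<tau>" "anchor n a" i])
    show "\<bar>real N ^ (n + m) * (f (p j) $ i - f (p 0) $ i) - real j * slope N ?\<gamma> n \<tau> $ i\<bar> \<le> 1 / 16"
      if "j < N ^ m" for j i
      unfolding p_def using that by (intro curve_straight[OF osc]) simp
    show "\<bar>real N ^ n * f (p 0) $ i - real_of_int (anchor n a i)\<bar> \<le> real D" for i
      using Npos by (intro near_anchor p_cell) simp
    show "\<bar>slope N ?\<gamma> n \<tau> $ i\<bar> \<le> real L" for i
      by (rule order_trans[OF component_le_norm_cart norm_slope_le[OF Npos(1) lipschitz_line[OF lip]]])
  qed (use steep not_bad in auto)
  define a' where "a' = (\<lambda>i. \<lfloor>real N ^ (n + (m + m3)) * p j $ i\<rfloor>)"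
  have a': "a' \<in> subcells N (m + m3) a"
    unfolding a'_def using p[OF j(1)] by (intro floor_in_subcells[OF Npos(1)]) auto
  have p_a': "p j \<in> cell N (n + (m + m3)) a'"
    by (simp add: cell_def a'_def less_imp_le[OF real_of_int_floor_add_one_gt])
  have "f x \<notin> fractal_percolation N \<omega>" if x: "x \<in> cell N (n + (m + m3)) a'" for x
  proof (rule j(2))
    fix i
    have "\<bar>real N ^ (n + m) * (f x $ i - f (p j) $ i)\<bar> \<le> real N ^ (n + m) * (real (L * CARD('k)) / real N ^ (n + (m + m3)))"
      unfolding abs_mult by (intro mult_mono f_component_cell[OF x p_a']) auto
    also have "\<dots> = real (L * CARD('k)) / real N ^ m3"
      using Npos by (simp add: power_add)
    also have "\<dots> \<le> 1 / 4"
    proof -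
      have "real (4 * (L * CARD('k))) \<le> real (N ^ m3)"
        using m3 by (simp only: of_nat_le_iff)
      then show ?thesis
        using Npos by (simp add: divide_le_eq)
    qed
    finally show "\<bar>real N ^ (n + m) * (f x $ i - f (p j) $ i)\<bar> \<le> 1 / 4" .
  qed
  then have "f ` cell N (n + (m + m3)) a' \<inter> fractal_percolation N \<omega> = {}"
    by blast
  then have "H (cell N (n + (m + m3)) a') = 0"
    unfolding H_def using \<delta> by (simp add: hausdorff_premeasure_empty)
  then show thesis
    using a' that by blast
qed

lemma C_pos: "C \<ge> 0"
  by (simp add: C_def)

text \<open>With \<open>\<rho> = 1 / N ^ (n + m')\<close>: moving \<open>x\<close> across to the
  line costs \<open>L * CARD('k) * \<rho>\<close>, along it to a sample point
  \<open>L * \<rho>\<close>, and back to the start of the interval \<open>5 * \<rho>\<close>, namely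
  4 for the small slope and 1 for the deviation from a line.\<close>

lemma thin_box_near_line:
  assumes m': "m' \<le> m"
    and y: "y \<in> slab i0 0 (\<lambda>i. \<sigma> i * int N ^ r) (N ^ r)"
    and t0: "real N ^ n * t0 + real \<tau> = real_of_int (a i0)"
    and osc: "oscillation N (curve (n + m' + r) y t0) n m \<tau> \<le> (1 / (16 * real N ^ m))\<^sup>2"
    and gentle: "real N ^ m' * \<bar>slope N (curve (n + m' + r) y t0) n \<tau> $ i\<bar> \<le> 4"
    and x: "x \<in> cell N n a" "\<And>i. i \<noteq> i0 \<Longrightarrow> real_of_int (\<sigma> i) \<le> real N ^ (n + m') * x $ i \<and> real N ^ (n + m') * x $ i \<le> real_of_int (\<sigma> i) + 1"
  shows "\<bar>f x $ i - curve (n + m' + r) y t0 (real (\<tau> * N ^ m + 0) / real N ^ (n + m)) $ i\<bar>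
    \<le> (real (L * CARD('k) + L) + 5) * (1 / real N ^ (n + m'))"
proof -
  let ?\<gamma> = "curve (n + m' + r) y t0"
  define \<rho> where "\<rho> = 1 / real N ^ (n + m')"
  \<comment> \<open>Position along the line in fine units from the lower face; on the upper face
    \<open>j = N ^ m\<close> occurs, which \<open>curve_straight\<close> permits.\<close>
  define T where "T = real N ^ (n + m) * (x $ i0 - t0) - real (\<tau> * N ^ m)"
  define j where "j = nat \<lfloor>T\<rfloor>"
  have \<rho>: "1 / real N ^ (n + m) \<le> \<rho>"
    unfolding \<rho>_def using N m' by (intro divide_left_mono power_increasing) auto
  have T: "0 \<le> T" "T \<le> real (N ^ m)"
  proof -
    have "T = real N ^ m * (real N ^ n * x $ i0 - real_of_int (a i0))"
      by (simp add: T_def t0[symmetric] power_add algebra_simps)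
    moreover have "0 \<le> real N ^ n * x $ i0 - real_of_int (a i0)" "real N ^ n * x $ i0 - real_of_int (a i0) \<le> 1"
      using x(1) by (simp_all add: cell_def algebra_simps)
    ultimately show "0 \<le> T" "T \<le> real (N ^ m)"
      using mult_left_mono[of "real N ^ n * x $ i0 - real_of_int (a i0)" 1 "real N ^ m"] by simp_all
  qed
  have j: "real j \<le> T" "T < real j + 1"
    using T unfolding j_def by (simp_all add: real_of_int_floor_add_one_gt)
  then have jN: "j \<le> N ^ m"
    using T by (metis of_nat_le_iff order_trans)
  define x' where "x' = line_point N (n + m' + r) i0 y (x $ i0)"
  have "\<bar>(x - x') $ i\<bar> \<le> \<rho>" for i
  proof (cases "i = i0")
    case True
    then show ?thesis
      by (simp add: x'_def line_point_def \<rho>_def)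
  next
    case False
    have "\<bar>real N ^ (n + m') * x $ i - real N ^ (n + m') * x' $ i\<bar> \<le> 1"
      using x(2)[OF False] slab_point_bounds[OF Npos(1) y False, of "n + m'"] False
      by (auto simp: x'_def line_point_def)
    then have "real N ^ (n + m') * \<bar>(x - x') $ i\<bar> \<le> 1"
      by (simp add: right_diff_distrib[symmetric] abs_mult)
    then show ?thesis
      using Npos by (simp add: pos_le_divide_eq mult.commute \<rho>_def)
  qed
  then have "(\<Sum>i\<in>UNIV. \<bar>(x - x') $ i\<bar>) \<le> (\<Sum>i\<in>(UNIV :: 'k set). \<rho>)"
    by (intro sum_mono) auto
  then have "dist x x' \<le> real CARD('k) * \<rho>"
    unfolding dist_norm using norm_le_l1_cart[of "x - x'"] by simp
  then have "real L * dist x x' \<le> real L * (real CARD('k) * \<rho>)"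
    by (intro mult_left_mono) auto
  then have 1: "\<bar>f x $ i - f x' $ i\<bar> \<le> real (L * CARD('k)) * \<rho>"
    using f_component[of x i x'] by (simp add: mult.assoc)
  have "x $ i0 - (t0 + real (\<tau> * N ^ m + j) / real N ^ (n + m)) = (T - real j) / real N ^ (n + m)"
    using Npos by (simp add: T_def field_simps)
  then have "\<bar>x $ i0 - (t0 + real (\<tau> * N ^ m + j) / real N ^ (n + m))\<bar> \<le> 1 / real N ^ (n + m)"
    using j by (simp add: divide_right_mono)
  then have "real L * dist x' (line_point N (n + m' + r) i0 y (t0 + real (\<tau> * N ^ m + j) / real N ^ (n + m))) \<le> real L * \<rho>"
    unfolding x'_def dist_line_point using \<rho> by (intro mult_left_mono) auto
  then have 2: "\<bar>f x' $ i - ?\<gamma> (real (\<tau> * N ^ m + j) / real N ^ (n + m)) $ i\<bar> \<le> real L * \<rho>"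
    using f_component order_trans by blast
  have 3: "\<bar>?\<gamma> (real (\<tau> * N ^ m + j) / real N ^ (n + m)) $ i - ?\<gamma> (real (\<tau> * N ^ m + 0) / real N ^ (n + m)) $ i\<bar> \<le> 5 * \<rho>"
  proof -
    define g where "g = ?\<gamma> (real (\<tau> * N ^ m + j) / real N ^ (n + m)) $ i - ?\<gamma> (real (\<tau> * N ^ m + 0) / real N ^ (n + m)) $ i"
    define s where "s = slope N ?\<gamma> n \<tau> $ i"
    have "\<bar>real N ^ (n + m) * g - real j * s\<bar> \<le> 1 / 16"
      unfolding g_def s_def by (rule curve_straight[OF osc jN])
    moreover have "\<bar>real j * s\<bar> \<le> 4 * real N ^ m / real N ^ m'"
    proof -
      have "real j \<le> real N ^ m"
        using jN by (metis of_nat_le_iff of_nat_power)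
      moreover have "\<bar>s\<bar> \<le> 4 / real N ^ m'"
        using gentle Npos by (simp add: s_def pos_le_divide_eq mult.commute)
      ultimately have "real j * \<bar>s\<bar> \<le> real N ^ m * (4 / real N ^ m')"
        by (intro mult_mono) auto
      then show ?thesis
        by (simp add: abs_mult mult.commute)
    qed
    ultimately have "\<bar>real N ^ (n + m) * g\<bar> \<le> 1 + 4 * real N ^ m / real N ^ m'"
      by linarith
    then have "real N ^ (n + m) * \<bar>g\<bar> \<le> 1 + 4 * real N ^ m / real N ^ m'"
      by (simp add: abs_mult)
    then have "\<bar>g\<bar> \<le> (1 + 4 * real N ^ m / real N ^ m') / real N ^ (n + m)"
      using Npos by (simp add: pos_le_divide_eq mult.commute)
    also have "\<dots> = 1 / real N ^ (n + m) + 4 * \<rho>"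
      using Npos by (simp add: \<rho>_def power_add field_simps)
    finally show ?thesis
      using \<rho> unfolding g_def by linarith
  qed
  have "(real (L * CARD('k) + L) + 5) * \<rho> = real (L * CARD('k)) * \<rho> + real L * \<rho> + 5 * \<rho>"
    by (simp add: distrib_right)
  then show ?thesis
    using 1 2 3 unfolding \<rho>_def[symmetric] by linarith
qed

text \<open>The cell splits into \<open>(N ^ m') ^ (CARD('k) - 1)\<close> columns along
  \<open>i0\<close>. Each has an image no larger than its width requires, which saves the factor
  \<open>N ^ m'\<close> from the length of the columns.\<close>

lemma collapse:
  assumes m': "m' \<le> m" and small: "C / real N ^ n \<le> \<delta>"
    and t0: "real N ^ n * t0 + real \<tau> = real_of_int (a i0)"
    and lines: "\<And>\<sigma>. \<sigma> \<in> subcells N m' a \<Longrightarrow> \<exists>y\<in>slab i0 0 (\<lambda>i. \<sigma> i * int N ^ r) (N ^ r).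
      oscillation N (curve (n + m' + r) y t0) n m \<tau> \<le> (1 / (16 * real N ^ m))\<^sup>2 \<and>
      (\<forall>i. real N ^ m' * \<bar>slope N (curve (n + m' + r) y t0) n \<tau> $ i\<bar> \<le> 4)"
  shows "H (cell N n a) \<le> ennreal (C ^ CARD('k) / real N ^ m' / (real N ^ n) ^ CARD('k))"
proof -
  \<comment> \<open>Fixing coordinate \<open>i0\<close> at the lowest admissible value picks one
    subcell per column, so \<open>lines\<close> applies to it.\<close>
  define S where "S = slab i0 (a i0 * int N ^ m') (\<lambda>i. a i * int N ^ m') (N ^ m')"
  define A where "A \<sigma> = {x \<in> cell N n a. \<forall>i. i \<noteq> i0 \<longrightarrow>
    real_of_int (\<sigma> i) \<le> real N ^ (n + m') * x $ i \<and> real N ^ (n + m') * x $ i \<le> real_of_int (\<sigma> i) + 1}" for \<sigma>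
  define \<rho> where "\<rho> = 1 / real N ^ (n + m')"
  have S_sub: "\<sigma> \<in> subcells N m' a" if "\<sigma> \<in> S" for \<sigma>
  proof -
    have "a i * int N ^ m' \<le> \<sigma> i \<and> \<sigma> i < (a i + 1) * int N ^ m'" for i
      using that Npos(1) by (cases "i = i0") (auto simp: S_def slab_def algebra_simps)
    then show ?thesis
      by (simp add: subcells_def)
  qed
  have cover: "cell N n a \<subseteq> (\<Union>\<sigma>\<in>S. A \<sigma>)"
  proof
    fix x assume x: "x \<in> cell N n a"
    then obtain \<sigma> where \<sigma>: "\<sigma> \<in> subcells N m' a" "x \<in> cell N (n + m') \<sigma>"
      using cell_subset_subcells[OF Npos(1), of n a m'] by blast
    then have "\<sigma>(i0 := a i0 * int N ^ m') \<in> S"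
      by (simp add: S_def slab_def subcells_def algebra_simps)
    moreover have "x \<in> A (\<sigma>(i0 := a i0 * int N ^ m'))"
      using x \<sigma>(2) by (simp add: A_def cell_def)
    ultimately show "x \<in> (\<Union>\<sigma>\<in>S. A \<sigma>)"
      by blast
  qed
  have \<rho>: "C * \<rho> \<le> \<delta>"
  proof -
    have "\<rho> \<le> 1 / real N ^ n"
      unfolding \<rho>_def using N by (intro divide_left_mono power_increasing) auto
    then have "C * \<rho> \<le> C * (1 / real N ^ n)"
      using C_pos by (rule mult_left_mono)
    then show ?thesis
      using small by simp
  qed
  have "H (A \<sigma>) \<le> ennreal ((C * \<rho>) ^ CARD('k))" if \<sigma>: "\<sigma> \<in> S" for \<sigma>
  proof -
    obtain y where y: "y \<in> slab i0 0 (\<lambda>i. \<sigma> i * int N ^ r) (N ^ r)"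
      "oscillation N (curve (n + m' + r) y t0) n m \<tau> \<le> (1 / (16 * real N ^ m))\<^sup>2"
      "\<And>i. real N ^ m' * \<bar>slope N (curve (n + m' + r) y t0) n \<tau> $ i\<bar> \<le> 4"
      using lines[OF S_sub[OF \<sigma>]] by blast
    show ?thesis
    proof (rule H_le_box[OF _ _ \<rho>])
      fix x i assume "x \<in> A \<sigma>"
      then show "\<bar>f x $ i - curve (n + m' + r) y t0 (real (\<tau> * N ^ m + 0) / real N ^ (n + m)) $ i\<bar>
          \<le> (real (L * CARD('k) + L) + 5) * \<rho>"
        unfolding \<rho>_def A_def by (intro thin_box_near_line[where a = a, OF m' y(1) t0 y(2) y(3)]) auto
    qed (simp add: \<rho>_def)
  qed
  then have "H (cell N n a) \<le> ennreal (\<Sum>\<sigma>\<in>S. (C * \<rho>) ^ CARD('k))"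
    using C_pos by (intro H_sum_le[OF _ cover]) (auto simp: S_def finite_slab \<rho>_def)
  also have "(\<Sum>\<sigma>\<in>S. (C * \<rho>) ^ CARD('k)) = real ((N ^ m') ^ (CARD('k) - 1)) * (C * \<rho>) ^ CARD('k)"
    by (simp add: S_def card_slab)
  also have "\<dots> = C ^ CARD('k) / real N ^ m' / (real N ^ n) ^ CARD('k)"
  proof -
    define M where "M = real N ^ m'"
    have M: "M > 0"
      using Npos by (simp add: M_def)
    obtain k where k: "CARD('k) = Suc k"
      by (metis card_gt_0_iff finite UNIV_not_empty gr0_conv_Suc)
    have "C * \<rho> = C / (M * real N ^ n)"
      by (simp add: \<rho>_def M_def power_add mult.commute)
    then show ?thesis
      using M by (simp add: k M_def[symmetric] power_divide power_mult_distrib)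
  qed
  finally show ?thesis .
qed

text \<open>The choice \<open>q = N ^ m'\<close> makes every line gentle for \<open>collapse\<close>
  or steep for \<open>hole_in_cell\<close>. A collapse gives \<epsilon>, a hole
  \<open>B - B / M\<close> with \<open>M\<close> the number of subcells;
  \<open>B - (B - \<epsilon>) / M\<close> dominates both.\<close>

lemma good_cell:
  assumes m': "m' \<le> m" and small: "C / real N ^ n \<le> \<delta>" and m3: "4 * (L * CARD('k)) \<le> N ^ m3"
    and t0: "real N ^ n * t0 + real \<tau> = real_of_int (a i0)"
    and lines: "\<And>\<sigma>. \<sigma> \<in> subcells N m' a \<Longrightarrow> \<exists>y\<in>slab i0 0 (\<lambda>i. \<sigma> i * int N ^ r) (N ^ r).
      oscillation N (curve (n + m' + r) y t0) n m \<tau> \<le> (1 / (16 * real N ^ m))\<^sup>2"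
    and not_bad: "\<not> bad N n m D (N ^ m') \<omega> (anchor n a)"
    and \<epsilon>: "0 < \<epsilon>" "\<epsilon> \<le> B" "C ^ CARD('k) / real N ^ m' \<le> \<epsilon>"
    and sub: "\<And>a'. H (cell N (n + (m + m3)) a') \<le> ennreal (B / (real N ^ (n + (m + m3))) ^ CARD('k))"
  shows "H (cell N n a) \<le> ennreal ((B - (B - \<epsilon>) / (real N ^ (m + m3)) ^ CARD('k)) / (real N ^ n) ^ CARD('k))"
proof -
  define M where "M = (real N ^ (m + m3)) ^ CARD('k)"
  have M1: "1 \<le> M"
    unfolding M_def using N by (intro one_le_power) auto
  have Nn: "(real N ^ n) ^ CARD('k) > 0"
    using Npos by simp
  have \<epsilon>_le: "\<epsilon> \<le> B - (B - \<epsilon>) / M"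
  proof -
    have "(B - \<epsilon>) / M \<le> (B - \<epsilon>) / 1"
      using M1 \<epsilon> by (intro divide_left_mono) auto
    then show ?thesis
      by simp
  qed
  show ?thesis
  proof (cases "\<forall>\<sigma>\<in>subcells N m' a. \<exists>y\<in>slab i0 0 (\<lambda>i. \<sigma> i * int N ^ r) (N ^ r).
      oscillation N (curve (n + m' + r) y t0) n m \<tau> \<le> (1 / (16 * real N ^ m))\<^sup>2 \<and>
      (\<forall>i. real N ^ m' * \<bar>slope N (curve (n + m' + r) y t0) n \<tau> $ i\<bar> \<le> 4)")
    case True
    then have "H (cell N n a) \<le> ennreal (C ^ CARD('k) / real N ^ m' / (real N ^ n) ^ CARD('k))"
      by (intro collapse[where a = a, OF m' small t0]) auto
    also have "\<dots> \<le> ennreal ((B - (B - \<epsilon>) / M) / (real N ^ n) ^ CARD('k))"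
      using \<epsilon>_le \<epsilon>(3) Nn by (intro ennreal_leI divide_right_mono) auto
    finally show ?thesis
      by (simp only: M_def)
  next
    case False
    then obtain \<sigma> y i where \<sigma>: "\<sigma> \<in> subcells N m' a" and y: "y \<in> slab i0 0 (\<lambda>i. \<sigma> i * int N ^ r) (N ^ r)"
      "oscillation N (curve (n + m' + r) y t0) n m \<tau> \<le> (1 / (16 * real N ^ m))\<^sup>2"
      "\<not> real N ^ m' * \<bar>slope N (curve (n + m' + r) y t0) n \<tau> $ i\<bar> \<le> 4"
      using lines by meson
    have y': "y \<in> slab i0 0 (\<lambda>i. a i * int N ^ (m' + r)) (N ^ (m' + r))"
      using slab_subcells_subset[OF Npos(1) \<sigma>] y(1) by blast
    have q: "N ^ m div N ^ m' > 0"
      using m' N by (simp add: div_greater_zero_iff power_increasing)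
    obtain a' where a': "a' \<in> subcells N (m + m3) a" "H (cell N (n + (m + m3)) a') = 0"
    proof (rule hole_in_cell[OF q m3 y' t0 _ _ not_bad, of i])
      show "oscillation N (curve (n + (m' + r)) y t0) n m \<tau> \<le> (1 / (16 * real N ^ m))\<^sup>2"
        using y(2) by (simp only: add.assoc)
      have "4 \<le> real N ^ m' * \<bar>slope N (curve (n + (m' + r)) y t0) n \<tau> $ i\<bar>"
        using y(3) by (simp only: add.assoc not_le less_imp_le)
      then show "4 \<le> real (N ^ m') * \<bar>slope N (curve (n + (m' + r)) y t0) n \<tau> $ i\<bar>"
        by simp
    qed
    define c where "c b = (if b = a' then 0 else B / (real N ^ (n + (m + m3))) ^ CARD('k))" for b
    have "H (cell N n a) \<le> ennreal (\<Sum>b\<in>subcells N (m + m3) a. c b)"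
      using a'(2) sub \<epsilon> by (intro H_sum_le[OF finite_subcells cell_subset_subcells[OF Npos(1)]]) (auto simp: c_def)
    also have "(\<Sum>b\<in>subcells N (m + m3) a. c b) = (M - 1) * (B / (real N ^ (n + (m + m3))) ^ CARD('k))"
    proof -
      have "(\<Sum>b\<in>subcells N (m + m3) a. c b) = (\<Sum>b\<in>subcells N (m + m3) a - {a'}. B / (real N ^ (n + (m + m3))) ^ CARD('k))"
        using a'(1) finite_subcells by (subst sum.remove[of _ a']) (auto simp: c_def)
      also have "\<dots> = real (card (subcells N (m + m3) a - {a'})) * (B / (real N ^ (n + (m + m3))) ^ CARD('k))"
        by simp
      also have "real (card (subcells N (m + m3) a - {a'})) = M - 1"
        using a'(1) finite_subcells[of N "m + m3" a] card_gt_0_iff[of "subcells N (m + m3) a"]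
        by (subst card_Diff_singleton) (auto simp: card_subcells M_def of_nat_diff Suc_le_eq)
      finally show ?thesis .
    qed
    also have "\<dots> = (B - B / M) / (real N ^ n) ^ CARD('k)"
    proof -
      have "(real N ^ (n + (m + m3))) ^ CARD('k) = (real N ^ n) ^ CARD('k) * M"
        by (simp only: power_add[of "real N" n] power_mult_distrib M_def)
      then show ?thesis
        using M1 by (simp add: field_simps)
    qed
    also have "ennreal \<dots> \<le> ennreal ((B - (B - \<epsilon>) / M) / (real N ^ n) ^ CARD('k))"
      using \<epsilon> M1 Nn by (intro ennreal_leI divide_right_mono) (auto simp: divide_right_mono)
    finally show ?thesis
      by (simp only: M_def)
  qed
qed

subsection \<open>Improving the bound for the image of a cell\<close>

text \<open>Anchors along a row of cells in direction \<open>i0\<close> thus form a chain to which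
  \<open>typical\<close> applies.\<close>

lemma anchor_step: "\<bar>anchor n (b(i0 := s + 1)) i - anchor n (b(i0 := s)) i\<bar> \<le> int D"
proof -
  have eq: "(\<chi> i. real_of_int ((b(i0 := s)) i) / real N ^ n) = line_point N n i0 b (real_of_int s / real N ^ n)" for s
    by (simp add: vec_eq_iff line_point_def)
  define u where "u s = real N ^ n * f (line_point N n i0 b (real_of_int s / real N ^ n)) $ i" for s
  have "\<bar>f (line_point N n i0 b (real_of_int (s + 1) / real N ^ n)) $ i - f (line_point N n i0 b (real_of_int s / real N ^ n)) $ i\<bar>
      \<le> real L * \<bar>real_of_int (s + 1) / real N ^ n - real_of_int s / real N ^ n\<bar>"
    using f_component[of "line_point N n i0 b (real_of_int (s + 1) / real N ^ n)" i "line_point N n i0 b (real_of_int s / real N ^ n)"]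
    unfolding dist_line_point .
  also have "real_of_int (s + 1) / real N ^ n - real_of_int s / real N ^ n = 1 / real N ^ n"
    by (simp add: diff_divide_distrib[symmetric])
  finally have "real N ^ n * \<bar>f (line_point N n i0 b (real_of_int (s + 1) / real N ^ n)) $ i - f (line_point N n i0 b (real_of_int s / real N ^ n)) $ i\<bar> \<le> real L"
    using Npos by (simp add: pos_le_divide_eq mult.commute)
  then have "\<bar>u (s + 1) - u s\<bar> \<le> real L"
    by (simp add: u_def right_diff_distrib[symmetric] abs_mult)
  then have "\<bar>real_of_int \<lfloor>u (s + 1)\<rfloor> - real_of_int \<lfloor>u s\<rfloor>\<bar> < real L + 1"
    using of_int_floor_le[of "u s"] of_int_floor_le[of "u (s + 1)"]
      real_of_int_floor_add_one_gt[of "u s"] real_of_int_floor_add_one_gt[of "u (s + 1)"] by linarith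
  then have "real_of_int \<bar>\<lfloor>u (s + 1)\<rfloor> - \<lfloor>u s\<rfloor>\<bar> < real_of_int (int L + 1)"
    by simp
  then have "\<bar>\<lfloor>u (s + 1)\<rfloor> - \<lfloor>u s\<rfloor>\<bar> \<le> int L"
    by (simp only: of_int_less_iff zless_add1_eq order_le_less)
  moreover have "L * 1 \<le> L * CARD('k)"
    by (intro mult_le_mono2) (simp add: Suc_le_eq)
  then have "int L \<le> int D"
    unfolding of_nat_le_iff D_def by linarith
  ultimately show ?thesis
    unfolding anchor_def eq u_def by linarith
qed

text \<open>The subcells split into \<open>(N ^ \<nu>) ^ (CARD('k) - 1)\<close> rows along
  \<open>i0\<close>; each row is a chain of length \<open>N ^ \<nu>\<close>, and the row bounds add
  up.\<close>

lemma card_bad_anchors_le: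
  assumes chain: "\<And>z :: nat \<Rightarrow> 'd \<Rightarrow> int. (\<forall>t i. Suc t < N ^ \<nu> \<longrightarrow> \<bar>z (Suc t) i - z t i\<bar> \<le> int D) \<Longrightarrow>
    T * card {z t | t. t < N ^ \<nu> \<and> bad N n m D q \<omega> (z t)} \<le> N ^ \<nu>"
  shows "T * card (anchor n ` {a \<in> subcells N \<nu> a0. bad N n m D q \<omega> (anchor n a)}) \<le> (N ^ \<nu>) ^ CARD('k)"
proof -
  define e where "e = a0 i0 * int N ^ \<nu>"
  define S where "S = slab i0 e (\<lambda>i. a0 i * int N ^ \<nu>) (N ^ \<nu>)"
  define z where "z b t = anchor n (b(i0 := e + int t))" for b t
  define Z where "Z b = {z b t | t. t < N ^ \<nu> \<and> bad N n m D q \<omega> (z b t)}" for b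
  have Z_le: "T * card (Z b) \<le> N ^ \<nu>" for b
    unfolding Z_def
  proof (intro chain allI impI)
    fix t i
    show "\<bar>z b (Suc t) i - z b t i\<bar> \<le> int D"
      using anchor_step[of n b "e + int t" i] by (simp add: z_def ac_simps)
  qed
  have "anchor n ` {a \<in> subcells N \<nu> a0. bad N n m D q \<omega> (anchor n a)} \<subseteq> (\<Union>b\<in>S. Z b)"
  proof clarify
    fix a assume a: "a \<in> subcells N \<nu> a0" "bad N n m D q \<omega> (anchor n a)"
    then have "e \<le> a i0" "a i0 < e + int N ^ \<nu>"
      by (auto simp: subcells_def e_def algebra_simps)
    then have t: "int (nat (a i0 - e)) = a i0 - e" "nat (a i0 - e) < N ^ \<nu>"
      by (simp_all add: nat_less_iff)
    then have "a = (a(i0 := e))(i0 := e + int (nat (a i0 - e)))"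
      by simp
    then have "z (a(i0 := e)) (nat (a i0 - e)) = anchor n a"
      unfolding z_def by simp
    then have "anchor n a \<in> Z (a(i0 := e))"
      unfolding Z_def using t(2) a(2) by (metis (mono_tags, lifting) mem_Collect_eq)
    moreover have "a(i0 := e) \<in> S"
      using a(1) by (simp add: S_def slab_def subcells_def algebra_simps)
    ultimately show "anchor n a \<in> (\<Union>b\<in>S. Z b)"
      by blast
  qed
  then have "card (anchor n ` {a \<in> subcells N \<nu> a0. bad N n m D q \<omega> (anchor n a)}) \<le> card (\<Union>b\<in>S. Z b)"
    by (intro card_mono) (auto simp: S_def finite_slab Z_def)
  also have "\<dots> \<le> (\<Sum>b\<in>S. card (Z b))"
    by (intro card_UN_le) (simp add: S_def finite_slab)
  finally have "card (anchor n ` {a \<in> subcells N \<nu> a0. bad N n m D q \<omega> (anchor n a)}) \<le> (\<Sum>b\<in>S. card (Z b))" .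
  then have "T * card (anchor n ` {a \<in> subcells N \<nu> a0. bad N n m D q \<omega> (anchor n a)}) \<le> (\<Sum>b\<in>S. T * card (Z b))"
    unfolding sum_distrib_left[symmetric] by (rule mult_le_mono2)
  also have "\<dots> \<le> (\<Sum>b\<in>S. N ^ \<nu>)"
    using Z_le by (rule sum_mono)
  also have "\<dots> = (N ^ \<nu>) ^ (CARD('k) - 1) * N ^ \<nu>"
    by (simp add: S_def card_slab)
  also have "\<dots> = (N ^ \<nu>) ^ CARD('k)"
    by (rule power_minus_mult) simp
  finally show ?thesis .
qed

text \<open>All cells with the same anchor have images in one box of radius \<open>D\<close> units,
  so the cost depends on the number of bad cubes and not on the number of cells near them.\<close>

lemma bad_cover:
  assumes chain: "\<And>z :: nat \<Rightarrow> 'd \<Rightarrow> int. (\<forall>t i. Suc t < N ^ \<nu> \<longrightarrow> \<bar>z (Suc t) i - z t i\<bar> \<le> int D) \<Longrightarrow>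
      T * card {z t | t. t < N ^ \<nu> \<and> bad N (n1 + \<nu>) m D q \<omega> (z t)} \<le> N ^ \<nu>"
    and T: "T > 0" and small: "C / real N ^ (n1 + \<nu>) \<le> \<delta>"
  shows "H (\<Union>a\<in>{a \<in> subcells N \<nu> a0. bad N (n1 + \<nu>) m D q \<omega> (anchor (n1 + \<nu>) a)}. cell N (n1 + \<nu>) a)
    \<le> ennreal (C ^ CARD('k) / real T / (real N ^ n1) ^ CARD('k))"
proof -
  let ?n = "n1 + \<nu>"
  let ?A = "{a \<in> subcells N \<nu> a0. bad N ?n m D q \<omega> (anchor ?n a)}"
  let ?Z = "anchor ?n ` ?A"
  define \<rho> where "\<rho> = 1 / real N ^ ?n"
  have "H (\<Union>a\<in>?A. cell N ?n a) \<le> ennreal (\<Sum>z\<in>?Z. (C * \<rho>) ^ CARD('k))"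
  proof (rule H_sum_le)
    show "finite ?Z"
      using finite_subcells[of N \<nu> a0] by simp
    show "(\<Union>a\<in>?A. cell N ?n a) \<subseteq> (\<Union>z\<in>?Z. \<Union>a\<in>{a \<in> ?A. anchor ?n a = z}. cell N ?n a)"
      by blast
    fix z
    show "H (\<Union>a\<in>{a \<in> ?A. anchor ?n a = z}. cell N ?n a) \<le> ennreal ((C * \<rho>) ^ CARD('k))"
    proof (rule H_le_box)
      fix x i assume "x \<in> (\<Union>a\<in>{a \<in> ?A. anchor ?n a = z}. cell N ?n a)"
      then obtain a where "x \<in> cell N ?n a" "anchor ?n a = z"
        by blast
      then have "\<bar>real N ^ ?n * f x $ i - real_of_int (z i)\<bar> \<le> real D"
        using near_anchor by blast
      moreover have "real N ^ ?n * f x $ i - real_of_int (z i) = real N ^ ?n * (f x $ i - real_of_int (z i) * \<rho>)"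
        using Npos by (simp add: \<rho>_def field_simps)
      ultimately have "real N ^ ?n * \<bar>f x $ i - real_of_int (z i) * \<rho>\<bar> \<le> real D"
        by (simp only: abs_mult power_abs abs_of_nat)
      then have "\<bar>f x $ i - real_of_int (z i) * \<rho>\<bar> \<le> real D * \<rho>"
        using Npos by (simp add: \<rho>_def pos_le_divide_eq mult.commute)
      also have "\<dots> \<le> (real (L * CARD('k) + L) + 5) * \<rho>"
        by (intro mult_right_mono) (auto simp: D_def \<rho>_def)
      finally show "\<bar>f x $ i - real_of_int (z i) * \<rho>\<bar> \<le> (real (L * CARD('k) + L) + 5) * \<rho>" .
    qed (use small in \<open>auto simp: \<rho>_def\<close>)
    show "0 \<le> (C * \<rho>) ^ CARD('k)"
      using C_pos by (simp add: \<rho>_def)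
  qed
  also have "(\<Sum>z\<in>?Z. (C * \<rho>) ^ CARD('k)) = real (card ?Z) * (C * \<rho>) ^ CARD('k)"
    by simp
  also have "ennreal \<dots> \<le> ennreal (C ^ CARD('k) / real T / (real N ^ n1) ^ CARD('k))"
  proof (rule ennreal_leI)
    define P where "P = (real N ^ \<nu>) ^ CARD('k)"
    have P: "P > 0"
      using Npos by (simp add: P_def)
    have "real (T * card ?Z) \<le> real ((N ^ \<nu>) ^ CARD('k))"
      using card_bad_anchors_le[OF chain, of a0] by (simp only: of_nat_le_iff)
    then have "real (card ?Z) \<le> P / real T"
      using T by (simp add: P_def pos_le_divide_eq mult.commute)
    then have "real (card ?Z) * (C * \<rho>) ^ CARD('k) \<le> P / real T * (C * \<rho>) ^ CARD('k)"
      using C_pos by (intro mult_right_mono) (auto simp: \<rho>_def)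
    also have "P / real T * (C * \<rho>) ^ CARD('k) = C ^ CARD('k) / real T / (real N ^ n1) ^ CARD('k)"
    proof -
      have "(C * \<rho>) ^ CARD('k) = C ^ CARD('k) / ((real N ^ n1) ^ CARD('k) * P)"
        by (simp add: \<rho>_def P_def power_add power_divide power_mult_distrib)
      then show ?thesis
        using P by simp
    qed
    finally show "real (card ?Z) * (C * \<rho>) ^ CARD('k) \<le> C ^ CARD('k) / real T / (real N ^ n1) ^ CARD('k)" .
  qed
  finally show ?thesis .
qed

text \<open>A Chebyshev estimate with \<open>g\<close> in the role of the oscillation: each cell of
  \<open>NS\<close> contains a full bundle of \<open>(N ^ r) ^ (CARD('k) - 1)\<close> lines on which
  \<open>g\<close> exceeds \<kappa>, and bundles of different cells are disjoint as sets of pairs of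
  line and interval.\<close>

lemma card_nonstraight_le:
  fixes g :: "('k \<Rightarrow> int) \<Rightarrow> nat \<Rightarrow> real"
  assumes g: "\<And>y \<tau>. 0 \<le> g y \<tau>" and \<kappa>: "0 \<le> \<kappa>"
    and V: "(\<Sum>y\<in>slab i0 0 (\<lambda>i. a0 i * int N ^ (\<nu> + (m' + r))) (N ^ (\<nu> + (m' + r))). \<Sum>\<tau><N ^ \<nu>. g y \<tau>) \<le> V"
  defines "NS \<equiv> {a \<in> subcells N \<nu> a0. \<exists>\<sigma>\<in>subcells N m' a. \<forall>y\<in>slab i0 0 (\<lambda>i. \<sigma> i * int N ^ r) (N ^ r).
      \<kappa> < g y (nat (a i0 - a0 i0 * int N ^ \<nu>))}"
  shows "real (card NS) * (real ((N ^ r) ^ (CARD('k) - 1)) * \<kappa>) \<le> V"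
proof -
  define \<tau> where "\<tau> a = nat (a i0 - a0 i0 * int N ^ \<nu>)" for a :: "'k \<Rightarrow> int"
  define Y where "Y = slab i0 0 (\<lambda>i. a0 i * int N ^ (\<nu> + (m' + r))) (N ^ (\<nu> + (m' + r)))"
  define Q where "Q a = slab i0 0 (\<lambda>i. a i * int N ^ (m' + r)) (N ^ (m' + r))" for a :: "'k \<Rightarrow> int"
  have "finite NS"
    unfolding NS_def using finite_subcells[of N \<nu> a0] by simp
  have \<tau>: "int (\<tau> a) = a i0 - a0 i0 * int N ^ \<nu>" "\<tau> a < N ^ \<nu>" if "a \<in> NS" for a
  proof -
    have "a0 i0 * int N ^ \<nu> \<le> a i0" "a i0 < a0 i0 * int N ^ \<nu> + int N ^ \<nu>"
      using that by (auto simp: NS_def subcells_def algebra_simps)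
    then show "int (\<tau> a) = a i0 - a0 i0 * int N ^ \<nu>" "\<tau> a < N ^ \<nu>"
      by (simp_all add: \<tau>_def nat_less_iff)
  qed
  have "real ((N ^ r) ^ (CARD('k) - 1)) * \<kappa> \<le> (\<Sum>y\<in>Q a. g y (\<tau> a))" if a: "a \<in> NS" for a
  proof -
    obtain \<sigma> where \<sigma>: "\<sigma> \<in> subcells N m' a"
      "\<And>y. y \<in> slab i0 0 (\<lambda>i. \<sigma> i * int N ^ r) (N ^ r) \<Longrightarrow> \<kappa> < g y (\<tau> a)"
      using a unfolding NS_def \<tau>_def by blast
    have "real ((N ^ r) ^ (CARD('k) - 1)) * \<kappa> = (\<Sum>y\<in>slab i0 0 (\<lambda>i. \<sigma> i * int N ^ r) (N ^ r). \<kappa>)"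
      by (simp add: card_slab)
    also have "\<dots> \<le> (\<Sum>y\<in>slab i0 0 (\<lambda>i. \<sigma> i * int N ^ r) (N ^ r). g y (\<tau> a))"
      using \<sigma>(2) by (intro sum_mono) (rule less_imp_le)
    also have "\<dots> \<le> (\<Sum>y\<in>Q a. g y (\<tau> a))"
      unfolding Q_def using slab_subcells_subset[OF Npos(1) \<sigma>(1)] g
      by (intro sum_mono2 finite_slab) auto
    finally show ?thesis .
  qed
  note weight = this
  \<comment> \<open>The interval number determines coordinate \<open>i0\<close> of the cell; integer
    division of the line index determines the others.\<close>
  have inj: "inj_on (\<lambda>(a, y). (y, \<tau> a)) (SIGMA a:NS. Q a)"
  proof (rule inj_onI)
    fix u v assume uv: "u \<in> (SIGMA a:NS. Q a)" "v \<in> (SIGMA a:NS. Q a)"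
      "(case u of (a, y) \<Rightarrow> (y, \<tau> a)) = (case v of (a, y) \<Rightarrow> (y, \<tau> a))"
    obtain a b y where u: "u = (a, y)" and v: "v = (b, y)"
      using uv(3) by (cases u, cases v) simp
    have ab: "a \<in> NS" "b \<in> NS" "y \<in> Q a" "y \<in> Q b" "\<tau> a = \<tau> b"
      using uv by (simp_all add: u v)
    have "a i = b i" for i
    proof (cases "i = i0")
      case True
      then show ?thesis
        using \<tau>(1)[OF ab(1)] \<tau>(1)[OF ab(2)] ab(5) by simp
    next
      case False
      define M where "M = int N ^ (m' + r)"
      have M: "M > 0"
        using Npos by (simp add: M_def)
      have "c i = y i div M" if "y \<in> Q c" for c
      proof -
        have "c i * M \<le> y i" "y i < c i * M + M"
          using that False by (simp_all add: Q_def slab_def M_def)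
        then have "y i = M * c i + (y i - c i * M)" "0 \<le> y i - c i * M" "y i - c i * M < M"
          by (auto simp: algebra_simps)
        then show ?thesis
          by (metis int_div_pos_eq)
      qed
      then show ?thesis
        using ab(3,4) by metis
    qed
    then show "u = v"
      unfolding u v by blast
  qed
  from weight have "(\<Sum>a\<in>NS. real ((N ^ r) ^ (CARD('k) - 1)) * \<kappa>) \<le> (\<Sum>a\<in>NS. \<Sum>y\<in>Q a. g y (\<tau> a))"
    by (rule sum_mono)
  also have "\<dots> = (\<Sum>(a, y)\<in>(SIGMA a:NS. Q a). g y (\<tau> a))"
    using \<open>finite NS\<close> by (intro sum.Sigma) (auto simp: Q_def finite_slab)
  also have "\<dots> = (\<Sum>(y, t)\<in>(\<lambda>(a, y). (y, \<tau> a)) ` (SIGMA a:NS. Q a). g y t)"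
    by (subst sum.reindex[OF inj]) (simp add: case_prod_beta comp_def)
  also have "\<dots> \<le> (\<Sum>(y, t)\<in>Y \<times> {..<N ^ \<nu>}. g y t)"
  proof (intro sum_mono2)
    show "finite (Y \<times> {..<N ^ \<nu>})"
      by (simp add: Y_def finite_slab)
    have "Q a \<subseteq> Y" if "a \<in> NS" for a
      unfolding Q_def Y_def using that by (intro slab_subcells_subset[OF Npos(1)]) (simp add: NS_def)
    then show "(\<lambda>(a, y). (y, \<tau> a)) ` (SIGMA a:NS. Q a) \<subseteq> Y \<times> {..<N ^ \<nu>}"
      using \<tau>(2) by auto
  qed (use g in auto)
  also have "\<dots> = (\<Sum>y\<in>Y. \<Sum>\<tau><N ^ \<nu>. g y \<tau>)"
    by (simp add: sum.cartesian_product)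
  also have "\<dots> \<le> V"
    using V unfolding Y_def .
  finally show ?thesis
    by simp
qed

lemma exists_mostly_straight_scale:
  assumes m': "m' \<le> m" and n: "n1 \<le> n2"
  obtains \<nu> r t0 where "n2 \<le> n1 + \<nu>" "real N ^ n1 * t0 = real_of_int (a0 i0)"
    "4 * card {a \<in> subcells N \<nu> a0. \<exists>\<sigma>\<in>subcells N m' a. \<forall>y\<in>slab i0 0 (\<lambda>i. \<sigma> i * int N ^ r) (N ^ r).
      (1 / (16 * real N ^ m))\<^sup>2 < oscillation N (curve (n1 + \<nu> + m' + r) y t0) (n1 + \<nu>) m (nat (a i0 - a0 i0 * int N ^ \<nu>))}
     \<le> (N ^ \<nu>) ^ CARD('k)"
proof -
  define k where "k = CARD('k) - 1"
  have k: "CARD('k) = Suc k"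
    unfolding k_def by simp
  \<comment> \<open>The powers of \<open>N\<close> lost: \<open>(N ^ m') ^ k\<close> because one
    column of lines must spoil a whole cell, \<open>N ^ m\<close> from the sum of oscillations, and
    \<open>(N ^ m)\<^sup>2\<close> from the threshold.\<close>
  define Q where "Q = (N ^ m') ^ k * N ^ m * (N ^ m)\<^sup>2"
  \<comment> \<open>\<open>1024 = 4 * 16\<^sup>2\<close>: the 16 is that of the threshold, and the 4
    makes the exceptional cells at most a quarter.\<close>
  define K where "K = Suc (1024 * L\<^sup>2 * Q)"
  have K: "K > 0"
    by (simp add: K_def)
  \<comment> \<open>The family of lines must be fixed before the pigeonhole selects
    \<open>i < K\<close>, so its mesh is fine enough for every candidate scale; \<open>r\<close> is
    the refinement left over.\<close>
  define h where "h = n2 + K * m"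
  define t0 where "t0 = real_of_int (a0 i0) / real N ^ n1"
  define Y where "Y = slab i0 0 (\<lambda>i. a0 i * int N ^ (h - n1)) (N ^ (h - n1))"
  have Y: "finite Y" "card Y = (N ^ (h - n1)) ^ k"
    by (simp_all add: Y_def finite_slab card_slab k_def)
  then have "Y \<noteq> {}"
    using Npos by (auto simp: card_gt_0_iff[symmetric])
  obtain i where i: "i < K"
    "(\<Sum>y\<in>Y. \<Sum>\<tau><N ^ (n2 + i * m - n1). oscillation N (curve h y t0) (n2 + i * m) m \<tau>)
      \<le> real (card Y) * (real L)\<^sup>2 * real N ^ (n2 + i * m + m - n1) / real K"
    by (rule exists_scale_small_oscillation[OF Npos(1) Y(1) \<open>Y \<noteq> {}\<close> lipschitz_line[OF lip] n K])
  define \<nu> where "\<nu> = n2 + i * m - n1"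
  define r where "r = h - (n1 + \<nu> + m')"
  have n\<nu>: "n1 + \<nu> = n2 + i * m"
    using n by (simp add: \<nu>_def)
  have "Suc i * m \<le> K * m"
    using i(1) by (intro mult_le_mono1) simp
  then have "n1 + \<nu> + m' \<le> h"
    using m' unfolding n\<nu> h_def by simp
  then have h: "h = n1 + \<nu> + m' + r"
    by (simp add: r_def)
  then have h': "h - n1 = \<nu> + (m' + r)"
    by simp
  define NS where "NS = {a \<in> subcells N \<nu> a0. \<exists>\<sigma>\<in>subcells N m' a. \<forall>y\<in>slab i0 0 (\<lambda>i. \<sigma> i * int N ^ r) (N ^ r).
      (1 / (16 * real N ^ m))\<^sup>2 < oscillation N (curve (n1 + \<nu> + m' + r) y t0) (n1 + \<nu>) m (nat (a i0 - a0 i0 * int N ^ \<nu>))}"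
  define V where "V = real (card Y) * (real L)\<^sup>2 * real N ^ (n2 + i * m + m - n1) / real K"
  define P where "P = real N ^ \<nu>"
  define R where "R = (real N ^ r) ^ k"
  have "real (card NS) * (real ((N ^ r) ^ (CARD('k) - 1)) * (1 / (16 * real N ^ m))\<^sup>2) \<le> V"
    unfolding NS_def
  proof (rule card_nonstraight_le)
    show "0 \<le> oscillation N (curve (n1 + \<nu> + m' + r) y t0) (n1 + \<nu>) m \<tau>" for y \<tau>
      by (simp add: oscillation_def sum_nonneg)
    show "(\<Sum>y\<in>slab i0 0 (\<lambda>i. a0 i * int N ^ (\<nu> + (m' + r))) (N ^ (\<nu> + (m' + r))).
        \<Sum>\<tau><N ^ \<nu>. oscillation N (curve (n1 + \<nu> + m' + r) y t0) (n1 + \<nu>) m \<tau>) \<le> V"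
      using i(2) unfolding V_def Y_def h'[symmetric] n\<nu> h[symmetric, unfolded n\<nu>] \<nu>_def[symmetric] .
  qed simp
  also have "V = (P * real N ^ m' * real N ^ r) ^ k * (real L)\<^sup>2 * (P * real N ^ m) / real K"
  proof -
    have "n2 + i * m + m - n1 = \<nu> + m"
      using n by (simp add: \<nu>_def)
    then show ?thesis
      by (simp only: V_def Y(2) h' P_def power_add of_nat_mult of_nat_power) (simp add: mult.assoc)
  qed
  also have "\<dots> = R * (P ^ CARD('k) * (real N ^ m') ^ k * (real L)\<^sup>2 * real N ^ m / real K)"
    by (simp add: R_def k power_mult_distrib)
  finally have "R * (real (card NS) * (1 / (16 * real N ^ m))\<^sup>2)
      \<le> R * (P ^ CARD('k) * (real N ^ m') ^ k * (real L)\<^sup>2 * real N ^ m / real K)"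
    by (simp add: R_def k_def mult.left_commute)
  moreover have "R > 0"
    using Npos by (simp add: R_def)
  ultimately have "real (card NS) * (1 / (16 * real N ^ m))\<^sup>2
      \<le> P ^ CARD('k) * (real N ^ m') ^ k * (real L)\<^sup>2 * real N ^ m / real K"
    by (simp only: mult_le_cancel_left_pos)
  then have "real (card NS) \<le> P ^ CARD('k) * (256 * (real L)\<^sup>2 * real Q / real K)"
    using Npos by (simp add: Q_def power_divide field_simps)
  moreover have "256 * (real L)\<^sup>2 * real Q / real K \<le> 1 / 4"
  proof -
    have "1024 * (real L)\<^sup>2 * real Q \<le> real K"
      by (simp add: K_def)
    then show ?thesis
      using K by (simp add: divide_le_eq)
  qed
  then have "P ^ CARD('k) * (256 * (real L)\<^sup>2 * real Q / real K) \<le> P ^ CARD('k) * (1 / 4)"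
    using Npos by (intro mult_left_mono) (auto simp: P_def)
  ultimately have "real (4 * card NS) \<le> real ((N ^ \<nu>) ^ CARD('k))"
    by (simp add: P_def)
  then have "4 * card NS \<le> (N ^ \<nu>) ^ CARD('k)"
    by (simp only: of_nat_le_iff)
  moreover have "n2 \<le> n1 + \<nu>"
    by (simp add: n\<nu>)
  moreover have "real N ^ n1 * t0 = real_of_int (a0 i0)"
    using Npos by (simp add: t0_def)
  ultimately show thesis
    unfolding NS_def by (intro that[of \<nu> t0 r])
qed

text \<open>The level at which the gain occurs is found only after \<open>f\<close> and \<omega>,
  somewhere beyond the threshold of \<open>typical\<close>. Hence \<open>bound\<close> is assumed,
  and improved, for all levels from \<open>n0\<close> on at once.\<close>

lemma improve_bound:
  assumes few_bad: "typical N \<omega> D (N ^ m') T m" and m': "m' \<le> m" and T: "T > 0"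
    and m3: "4 * (L * CARD('k)) \<le> N ^ m3"
    and small: "\<And>n. n \<ge> n0 \<Longrightarrow> C / real N ^ n \<le> \<delta>"
    and \<epsilon>: "0 < \<epsilon>" "\<epsilon> \<le> B" "C ^ CARD('k) / real N ^ m' \<le> \<epsilon>" "4 * (C ^ CARD('k) / real T) \<le> \<epsilon>"
    and bound: "\<And>n a. n \<ge> n0 \<Longrightarrow> H (cell N n a) \<le> ennreal (B / (real N ^ n) ^ CARD('k))"
    and n1: "n1 \<ge> n0"
  shows "H (cell N n1 a0) \<le> ennreal ((B - (B - \<epsilon>) / (4 * (real N ^ (m + m3)) ^ CARD('k))) / (real N ^ n1) ^ CARD('k))"
proof -
  have "\<forall>\<^sub>F n in sequentially. \<forall>z :: nat \<Rightarrow> 'd \<Rightarrow> int.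
    (\<forall>t i. Suc t < N ^ (n - n1) \<longrightarrow> \<bar>z (Suc t) i - z t i\<bar> \<le> int D) \<longrightarrow>
    T * card {z t | t. t < N ^ (n - n1) \<and> bad N n m D (N ^ m') \<omega> (z t)} \<le> N ^ (n - n1)"
    using few_bad unfolding typical_def by (rule spec)
  then obtain n2' where n2': "\<forall>n\<ge>n2'. \<forall>z :: nat \<Rightarrow> 'd \<Rightarrow> int.
    (\<forall>t i. Suc t < N ^ (n - n1) \<longrightarrow> \<bar>z (Suc t) i - z t i\<bar> \<le> int D) \<longrightarrow>
    T * card {z t | t. t < N ^ (n - n1) \<and> bad N n m D (N ^ m') \<omega> (z t)} \<le> N ^ (n - n1)"
    unfolding eventually_sequentially by (rule exE)
  obtain \<nu> r t0 where \<nu>: "max n1 n2' \<le> n1 + \<nu>" and t0: "real N ^ n1 * t0 = real_of_int (a0 i0)"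
    and NS: "4 * card {a \<in> subcells N \<nu> a0. \<exists>\<sigma>\<in>subcells N m' a. \<forall>y\<in>slab i0 0 (\<lambda>i. \<sigma> i * int N ^ r) (N ^ r).
      (1 / (16 * real N ^ m))\<^sup>2 < oscillation N (curve (n1 + \<nu> + m' + r) y t0) (n1 + \<nu>) m (nat (a i0 - a0 i0 * int N ^ \<nu>))}
     \<le> (N ^ \<nu>) ^ CARD('k)"
    by (rule exists_mostly_straight_scale[OF m', of n1 "max n1 n2'" a0]) auto
  define n where "n = n1 + \<nu>"
  define NS where "NS = {a \<in> subcells N \<nu> a0. \<exists>\<sigma>\<in>subcells N m' a. \<forall>y\<in>slab i0 0 (\<lambda>i. \<sigma> i * int N ^ r) (N ^ r).
      (1 / (16 * real N ^ m))\<^sup>2 < oscillation N (curve (n + m' + r) y t0) n m (nat (a i0 - a0 i0 * int N ^ \<nu>))}"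
  define Bad where "Bad = {a \<in> subcells N \<nu> a0. bad N n m D (N ^ m') \<omega> (anchor n a)}"
  define S where "S = subcells N \<nu> a0"
  define P where "P = (real N ^ \<nu>) ^ CARD('k)"
  define U where "U = (real N ^ n1) ^ CARD('k)"
  define M where "M = (real N ^ (m + m3)) ^ CARD('k)"
  have n_n0: "n \<ge> n0"
    using n1 by (simp add: n_def)
  have pos: "P > 0" "U > 0"
    using Npos by (simp_all add: P_def U_def)
  have M1: "1 \<le> M"
    unfolding M_def using N by (intro one_le_power) auto
  have Nn: "(real N ^ n) ^ CARD('k) = U * P"
    by (simp add: n_def U_def P_def power_add power_mult_distrib)
  have S: "finite S" "real (card S) = P"
    unfolding S_def using finite_subcells[of N \<nu> a0] by (simp_all add: card_subcells P_def)
  have sub: "Bad \<subseteq> S" "NS \<subseteq> S"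
    by (auto simp: Bad_def NS_def S_def)
  have cover: "cell N n1 a0 \<subseteq> (\<Union>a\<in>S. cell N n a)"
    unfolding S_def n_def using cell_subset_subcells[OF Npos(1)] .
  have B0: "0 \<le> B"
    using \<epsilon> by simp
  have cell_bound: "H (cell N n a) \<le> ennreal (B / (U * P))" for a
    using bound[OF n_n0] by (simp only: Nn)
  define G where "G = (B - (B - \<epsilon>) / (4 * M)) / U"
  have "H (cell N n1 a0) \<le> ennreal G"
  proof (cases "P \<le> 4 * real (card Bad)")
    case True
    \<comment> \<open>\<open>None\<close> stands for the union of all bad cells, covered jointly at
      cost at most \<epsilon>/4 relative to the volume; \<open>Some a\<close> stands for a single
      remaining cell.\<close>
    define A where "A x = (case x of None \<Rightarrow> (\<Union>a\<in>Bad. cell N n a) | Some a \<Rightarrow> cell N n a)" for x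
    define c where "c x = (case x of None \<Rightarrow> C ^ CARD('k) / real T / U | Some (a :: 'k \<Rightarrow> int) \<Rightarrow> B / (U * P))" for x
    have "H (cell N n1 a0) \<le> ennreal (\<Sum>x\<in>insert None (Some ` (S - Bad)). c x)"
    proof (rule H_sum_le[where A = A])
      show "finite (insert None (Some ` (S - Bad)))"
        using S by simp
      show "cell N n1 a0 \<subseteq> (\<Union>x\<in>insert None (Some ` (S - Bad)). A x)"
        using cover by (auto simp: A_def)
      have chain: "T * card {z t | t. t < N ^ \<nu> \<and> bad N (n1 + \<nu>) m D (N ^ m') \<omega> (z t)} \<le> N ^ \<nu>"
        if "\<forall>t i. Suc t < N ^ \<nu> \<longrightarrow> \<bar>z (Suc t) i - z t i\<bar> \<le> int D" for z :: "nat \<Rightarrow> 'd \<Rightarrow> int"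
        using n2'[THEN spec, of "n1 + \<nu>"] that \<nu> by simp
      have "H (\<Union>a\<in>Bad. cell N n a) \<le> ennreal (C ^ CARD('k) / real T / U)"
        unfolding Bad_def n_def U_def using chain T small[OF n_n0, unfolded n_def] by (rule bad_cover)
      then show "H (A x) \<le> ennreal (c x)" for x
        using cell_bound by (cases x) (simp_all add: A_def c_def)
      show "0 \<le> c x" for x
        using C_pos pos B0 by (cases x) (simp_all add: c_def)
    qed
    also have "(\<Sum>x\<in>insert None (Some ` (S - Bad)). c x) = C ^ CARD('k) / real T / U + real (card (S - Bad)) * (B / (U * P))"
      using S by (subst sum.insert) (auto simp: sum.reindex c_def)
    also have "\<dots> \<le> G"
    proof -
      have "real (card (S - Bad)) = P - real (card Bad)"
        using S sub(1) by (simp add: card_Diff_subset finite_subset of_nat_diff card_mono)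
      then have "real (card (S - Bad)) * (B / (U * P)) \<le> (3 / 4 * P) * (B / (U * P))"
        using True B0 pos by (intro mult_right_mono) auto
      also have "\<dots> = 3 / 4 * B / U"
        using pos by simp
      finally have "real (card (S - Bad)) * (B / (U * P)) \<le> 3 / 4 * B / U" .
      moreover have "C ^ CARD('k) / real T / U \<le> \<epsilon> / 4 / U"
        using \<epsilon>(4) pos by (intro divide_right_mono) linarith+
      ultimately have "C ^ CARD('k) / real T / U + real (card (S - Bad)) * (B / (U * P)) \<le> \<epsilon> / 4 / U + 3 / 4 * B / U"
        by linarith
      also have "\<dots> = (B - (B - \<epsilon>) / 4) / U"
        by (simp add: add_divide_distrib[symmetric] diff_divide_distrib)
      also have "\<dots> \<le> G"
      proof -
        have "(B - \<epsilon>) / (4 * M) \<le> (B - \<epsilon>) / 4"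
          using \<epsilon> M1 by (intro divide_left_mono) auto
        then show ?thesis
          unfolding G_def using pos by (intro divide_right_mono) auto
      qed
      finally show ?thesis .
    qed
    finally show ?thesis
      by (simp add: ennreal_leI)
  next
    case False
    \<comment> \<open>Less than a quarter of the cells lie in \<open>Bad\<close> and at most a
      quarter in \<open>NS\<close>. Only a quarter is claimed for \<open>X\<close>, which gives the
      4 in the improved bound.\<close>
    define X where "X = S - Bad - NS"
    define c where "c a = (if a \<in> X then (B - (B - \<epsilon>) / M) / (U * P) else B / (U * P))" for a
    have BM: "(B - \<epsilon>) / M \<le> B"
    proof -
      have "(B - \<epsilon>) / M \<le> (B - \<epsilon>) / 1"
        using M1 \<epsilon> by (intro divide_left_mono) auto
      then show ?thesis
        using \<epsilon> by simp
    qed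
    have good: "H (cell N n a) \<le> ennreal ((B - (B - \<epsilon>) / M) / (U * P))" if a: "a \<in> X" for a
    proof -
      have aS: "a \<in> subcells N \<nu> a0" and not_bad: "\<not> bad N n m D (N ^ m') \<omega> (anchor n a)" and notNS: "a \<notin> NS"
        using a by (auto simp: X_def S_def Bad_def)
      have "a0 i0 * int N ^ \<nu> \<le> a i0"
        using aS by (simp add: subcells_def)
      then have "real (nat (a i0 - a0 i0 * int N ^ \<nu>)) = real_of_int (a i0) - real_of_int (a0 i0) * real N ^ \<nu>"
        by simp
      then have t0': "real N ^ n * t0 + real (nat (a i0 - a0 i0 * int N ^ \<nu>)) = real_of_int (a i0)"
        by (simp add: n_def power_add t0[symmetric])
      have lines: "\<exists>y\<in>slab i0 0 (\<lambda>i. \<sigma> i * int N ^ r) (N ^ r).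
          oscillation N (curve (n + m' + r) y t0) n m (nat (a i0 - a0 i0 * int N ^ \<nu>)) \<le> (1 / (16 * real N ^ m))\<^sup>2"
        if "\<sigma> \<in> subcells N m' a" for \<sigma>
        using notNS aS that unfolding NS_def by (auto simp: not_less)
      show ?thesis
        unfolding M_def Nn[symmetric]
      proof (rule good_cell[OF m' small[OF n_n0] m3 t0' lines not_bad \<epsilon>(1-3)])
        fix a'
        show "H (cell N (n + (m + m3)) a') \<le> ennreal (B / (real N ^ (n + (m + m3))) ^ CARD('k))"
          using n_n0 by (intro bound) simp
      qed
    qed
    have "H (cell N n1 a0) \<le> ennreal (\<Sum>a\<in>S. c a)"
    proof (rule H_sum_le[OF S(1) cover])
      show "H (cell N n a) \<le> ennreal (c a)" for a
        using good cell_bound by (simp add: c_def)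
      show "0 \<le> c a" for a
        using BM B0 pos by (simp add: c_def)
    qed
    also have "(\<Sum>a\<in>S. c a) = (P * B - real (card X) * ((B - \<epsilon>) / M)) / (U * P)"
    proof -
      have "c a = B / (U * P) - (if a \<in> X then (B - \<epsilon>) / M / (U * P) else 0)" for a
        by (simp add: c_def diff_divide_distrib)
      then have "(\<Sum>a\<in>S. c a) = (\<Sum>a\<in>S. B / (U * P)) - (\<Sum>a\<in>S. if a \<in> X then (B - \<epsilon>) / M / (U * P) else 0)"
        by (simp only: sum_subtractf)
      also have "(\<Sum>a\<in>S. if a \<in> X then (B - \<epsilon>) / M / (U * P) else 0) = real (card X) * ((B - \<epsilon>) / M / (U * P))"
      proof -
        have "S \<inter> X = X"
          by (auto simp: X_def)
        then show ?thesis
          using S(1) by (simp add: sum.inter_restrict[symmetric])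
      qed
      finally show ?thesis
        by (simp only: sum_constant S(2) diff_divide_distrib[of "P * B"] times_divide_eq_right)
    qed
    also have "\<dots> \<le> G"
    proof -
      have "4 * real (card NS) \<le> P"
      proof -
        have "real (4 * card NS) \<le> real ((N ^ \<nu>) ^ CARD('k))"
          using NS unfolding NS_def n_def of_nat_le_iff .
        then show ?thesis
          by (simp add: P_def)
      qed
      moreover have "card S \<le> card X + card Bad + card NS"
      proof -
        have "S \<subseteq> X \<union> Bad \<union> NS"
          by (auto simp: X_def)
        then have "card S \<le> card (X \<union> Bad \<union> NS)"
          using S(1) sub by (intro card_mono) (auto simp: X_def intro: finite_subset)
        also have "\<dots> \<le> card (X \<union> Bad) + card NS"
          by (rule card_Un_le)
        also have "\<dots> \<le> card X + card Bad + card NS"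
          using card_Un_le[of X Bad] by simp
        finally show ?thesis .
      qed
      then have "real (card S) \<le> real (card X) + real (card Bad) + real (card NS)"
        by (simp only: of_nat_add[symmetric] of_nat_le_iff)
      ultimately have "P / 4 \<le> real (card X)"
        using False S(2) by linarith
      then have "P / 4 * ((B - \<epsilon>) / M) \<le> real (card X) * ((B - \<epsilon>) / M)"
        using \<epsilon> M1 by (intro mult_right_mono) auto
      then have "(P * B - real (card X) * ((B - \<epsilon>) / M)) / (U * P) \<le> (P * B - P / 4 * ((B - \<epsilon>) / M)) / (U * P)"
        using pos by (intro divide_right_mono) auto
      also have "\<dots> = (P * (B - (B - \<epsilon>) / (4 * M))) / (P * U)"
        by (simp add: right_diff_distrib mult.commute)
      also have "\<dots> = G"
        using pos unfolding G_def by simp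
      finally show ?thesis .
    qed
    finally show ?thesis
      by (simp add: ennreal_leI)
  qed
  then show ?thesis
    by (simp only: G_def U_def M_def)
qed

section \<open>Iteration of the bound and null images\<close>

lemma cell_bound_initial:
  assumes "C / real N ^ n \<le> \<delta>"
  shows "H (cell N n a) \<le> ennreal (C ^ CARD('k) / (real N ^ n) ^ CARD('k))"
proof -
  define \<rho> where "\<rho> = 1 / real N ^ n"
  have "H (cell N n a) \<le> ennreal ((C * \<rho>) ^ CARD('k))"
  proof (rule H_le_box)
    fix x i assume "x \<in> cell N n a"
    then have "\<bar>f x $ i - f (\<chi> i. real_of_int (a i) / real N ^ n) $ i\<bar> \<le> real (L * CARD('k)) * \<rho>"
      using f_component_cell[OF _ corner_in_cell] by (simp add: \<rho>_def)
    also have "\<dots> \<le> (real (L * CARD('k) + L) + 5) * \<rho>"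
      by (intro mult_right_mono) (auto simp: \<rho>_def)
    finally show "\<bar>f x $ i - f (\<chi> i. real_of_int (a i) / real N ^ n) $ i\<bar> \<le> (real (L * CARD('k) + L) + 5) * \<rho>" .
  qed (use assms in \<open>auto simp: \<rho>_def\<close>)
  then show ?thesis
    by (simp add: \<rho>_def power_divide)
qed

lemma exists_power_ge: "\<exists>m. x \<le> real N ^ m"
  using N real_arch_pow[of "real N" x] less_imp_le by fastforce

text \<open>The bound for all cells is iterated: its excess over \<open>\<epsilon>\<close> decays geometrically.\<close>

lemma cell_null:
  assumes few_bad: "\<And>q T m0. q > 0 \<Longrightarrow> T > 0 \<Longrightarrow> \<exists>m\<ge>m0. typical N \<omega> D q T m"
  obtains n0 where "\<And>n a. n \<ge> n0 \<Longrightarrow> H (cell N n a) = 0"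
proof -
  obtain n0 where n0: "C / \<delta> \<le> real N ^ n0"
    using exists_power_ge by blast
  have small: "C / real N ^ n \<le> \<delta>" if "n \<ge> n0" for n
  proof -
    have "C / \<delta> \<le> real N ^ n"
    proof -
      have "real N ^ n0 \<le> real N ^ n"
        using N by (intro power_increasing[OF that]) auto
      then show ?thesis
        using n0 by linarith
    qed
    then show ?thesis
      using \<delta> Npos by (simp add: pos_divide_le_eq mult.commute)
  qed
  have half: "H (cell N n a) \<le> ennreal (2 * \<epsilon> / (real N ^ n) ^ CARD('k))" if \<epsilon>: "\<epsilon> > 0" and n: "n \<ge> n0" for \<epsilon> n a
  proof -
    \<comment> \<open>\<open>T\<close> and \<open>m'\<close> depend on \<epsilon> alone;
      \<open>typical\<close> supplies \<open>m \<ge> m'\<close> only once they are fixed. Hence the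
      gain \<open>c\<close> may depend on \<epsilon>, but it is the same at every step of the
      iteration.\<close>
    obtain T :: nat where T: "4 * C ^ CARD('k) / \<epsilon> < real T"
      using reals_Archimedean2 by blast
    have "0 \<le> 4 * C ^ CARD('k) / \<epsilon>"
      using C_pos \<epsilon> by simp
    then have T0: "T > 0"
      using T by (cases T) auto
    then have T_le: "4 * (C ^ CARD('k) / real T) \<le> \<epsilon>"
      using T \<epsilon> by (simp add: field_simps)
    obtain m' where "C ^ CARD('k) / \<epsilon> \<le> real N ^ m'"
      using exists_power_ge by blast
    then have m'_le: "C ^ CARD('k) / real N ^ m' \<le> \<epsilon>"
      using \<epsilon> Npos by (simp add: field_simps)
    obtain m where m: "m \<ge> m'" "typical N \<omega> D (N ^ m') T m"
      using few_bad[of "N ^ m'" T m'] T0 Npos by auto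
    obtain m3 where "real (4 * (L * CARD('k))) \<le> real N ^ m3"
      using exists_power_ge by blast
    then have m3: "4 * (L * CARD('k)) \<le> N ^ m3"
      by (metis of_nat_le_iff of_nat_power)
    define c where "c = 1 / (4 * (real N ^ (m + m3)) ^ CARD('k))"
    have M1: "1 \<le> (real N ^ (m + m3)) ^ CARD('k)"
      using N by (intro one_le_power) auto
    then have c: "0 < c" "c < 1"
      by (auto simp: c_def divide_less_eq)
    define b where "b = C ^ CARD('k)"
    have b: "b \<ge> 0"
      using C_pos by (simp add: b_def)
    have iter: "H (cell N n a) \<le> ennreal ((\<epsilon> + (1 - c) ^ j * b) / (real N ^ n) ^ CARD('k))" if "n \<ge> n0" for j n a
      using that
    proof (induction j arbitrary: n a)
      case 0
      have "H (cell N n a) \<le> ennreal (b / (real N ^ n) ^ CARD('k))"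
        unfolding b_def using 0 by (intro cell_bound_initial small)
      also have "\<dots> \<le> ennreal ((\<epsilon> + (1 - c) ^ 0 * b) / (real N ^ n) ^ CARD('k))"
        using \<epsilon> by (intro ennreal_leI divide_right_mono) auto
      finally show ?case .
    next
      case (Suc j)
      define B where "B = \<epsilon> + (1 - c) ^ j * b"
      have "\<epsilon> \<le> B"
        using b c by (simp add: B_def)
      then have "H (cell N n a) \<le> ennreal ((B - (B - \<epsilon>) / (4 * (real N ^ (m + m3)) ^ CARD('k))) / (real N ^ n) ^ CARD('k))"
        using Suc.IH unfolding B_def[symmetric]
        by (intro improve_bound[OF m(2,1) T0 m3 small \<epsilon> _ m'_le T_le _ Suc.prems]) auto
      also have "B - (B - \<epsilon>) / (4 * (real N ^ (m + m3)) ^ CARD('k)) = B - (B - \<epsilon>) * c"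
        by (simp add: c_def)
      also have "\<dots> = \<epsilon> + (1 - c) ^ Suc j * b"
        by (simp add: B_def algebra_simps)
      finally show ?case .
    qed
    have "(\<lambda>j. (1 - c) ^ j * b) \<longlonglongrightarrow> 0"
      using c by (intro tendsto_mult_left_zero LIMSEQ_realpow_zero) auto
    then have "\<forall>\<^sub>F j in sequentially. (1 - c) ^ j * b < \<epsilon>"
      using \<epsilon> by (simp add: order_tendsto_iff)
    then obtain j where j: "(1 - c) ^ j * b < \<epsilon>"
      by (auto simp: eventually_sequentially)
    have "H (cell N n a) \<le> ennreal ((\<epsilon> + (1 - c) ^ j * b) / (real N ^ n) ^ CARD('k))"
      by (rule iter[OF n])
    also have "\<dots> \<le> ennreal (2 * \<epsilon> / (real N ^ n) ^ CARD('k))"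
      using j by (intro ennreal_leI divide_right_mono) auto
    finally show ?thesis .
  qed
  show thesis
  proof (rule that)
    fix n a assume n: "n \<ge> n0"
    have "H (cell N n a) \<le> 0"
    proof (rule ennreal_le_epsilon)
      fix e :: real
      assume e: "e > 0"
      have U: "(real N ^ n) ^ CARD('k) > 0"
        using Npos by simp
      have "H (cell N n a) \<le> ennreal (2 * (e * (real N ^ n) ^ CARD('k) / 2) / (real N ^ n) ^ CARD('k))"
        using e U n by (intro half) auto
      then show "H (cell N n a) \<le> 0 + ennreal e"
        using Npos by simp
    qed
    then show "H (cell N n a) = 0"
      by simp
  qed
qed

lemma hausdorff_premeasure_range_null:
  assumes few_bad: "\<And>q T m0. q > 0 \<Longrightarrow> T > 0 \<Longrightarrow> \<exists>m\<ge>m0. typical N \<omega> D q T m"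
  shows "hausdorff_premeasure CARD('k) \<delta> (range f \<inter> fractal_percolation N \<omega>) = 0"
proof -
  obtain n0 where n0: "\<And>n a. n \<ge> n0 \<Longrightarrow> H (cell N n a) = 0"
    using cell_null[OF few_bad] by blast
  have "UNIV = (\<Union>j. cell N n0 (from_nat j :: 'k \<Rightarrow> int))"
  proof (rule UNIV_eq_I)
    fix x
    obtain a :: "'k \<Rightarrow> int" where "x \<in> cell N n0 a"
      using exists_cell by blast
    then have "x \<in> cell N n0 (from_nat (to_nat a))"
      by simp
    then show "x \<in> (\<Union>j. cell N n0 (from_nat j))"
      by blast
  qed
  then have "range f \<inter> fractal_percolation N \<omega> = (\<Union>j. f ` cell N n0 (from_nat j :: 'k \<Rightarrow> int) \<inter> fractal_percolation N \<omega>)"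
    by blast
  then have "hausdorff_premeasure CARD('k) \<delta> (range f \<inter> fractal_percolation N \<omega>)
      \<le> (\<Sum>j. hausdorff_premeasure CARD('k) \<delta> (f ` cell N n0 (from_nat j :: 'k \<Rightarrow> int) \<inter> fractal_percolation N \<omega>))"
    by (simp only: hausdorff_premeasure_UN_le)
  also have "\<dots> = 0"
    using n0[of n0] by (simp add: H_def)
  finally show ?thesis
    by simp
qed

end

theorem corollary4p18:
  fixes N :: nat and p :: real
  assumes "CARD('d::finite) \<ge> 2"
    and "N \<ge> 2"
    and "0 \<le> p" and "p < 1"
  shows "AE \<omega> in (percolation_space N p :: ((real ^ 'd) set \<Rightarrow> bool) measure).
           purely_unrectifiable TYPE('k::finite) (fractal_percolation N \<omega>)"
proof -
  have "AE \<omega> in (percolation_product N p :: ((real ^ 'd) set \<Rightarrow> bool) measure).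
      q > 0 \<longrightarrow> T > 0 \<longrightarrow> (\<exists>m\<ge>m0. typical N \<omega> D q T m)" for D q T m0
  proof (cases "q > 0 \<and> T > 0")
    case True
    then obtain m where "m \<ge> m0" "AE \<omega> in (percolation_product N p :: ((real ^ 'd) set \<Rightarrow> bool) measure). typical N \<omega> D q T m"
      using AE_typical[OF assms(2-4)] by blast
    then show ?thesis
      by (auto elim: eventually_mono)
  qed auto
  \<comment> \<open>Only countably many parameters occur, so one null set is discarded before any
    map is chosen.\<close>
  then have "AE \<omega> in (percolation_product N p :: ((real ^ 'd) set \<Rightarrow> bool) measure).
      \<forall>D q T m0. q > 0 \<longrightarrow> T > 0 \<longrightarrow> (\<exists>m\<ge>m0. typical N \<omega> D q T m)"
    unfolding AE_all_countable by blast
  then have "AE \<omega> in (percolation_product N p :: ((real ^ 'd) set \<Rightarrow> bool) measure).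
      purely_unrectifiable TYPE('k) (fractal_percolation N \<omega>)"
  proof (rule eventually_mono)
    fix \<omega> :: "(real ^ 'd) set \<Rightarrow> bool"
    assume few_bad: "\<forall>D q T m0. q > 0 \<longrightarrow> T > 0 \<longrightarrow> (\<exists>m\<ge>m0. typical N \<omega> D q T m)"
    show "purely_unrectifiable TYPE('k) (fractal_percolation N \<omega>)"
      unfolding purely_unrectifiable_def
    proof (intro allI impI)
      fix f :: "real ^ 'k \<Rightarrow> real ^ 'd"
      assume "\<exists>L. L-lipschitz_on UNIV f"
      then obtain L where L: "L-lipschitz_on UNIV f"
        by blast
      obtain L' :: nat where "L \<le> real L'"
        using real_arch_simple by blast
      then have L': "(real L')-lipschitz_on UNIV f"
        using L lipschitz_on_mono by blast
      have "hausdorff_premeasure CARD('k) \<delta> (range f \<inter> fractal_percolation N \<omega>) = 0" if "\<delta> > 0" for \<delta>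
      proof -
        \<comment> \<open>Any coordinate direction serves as \<open>i0\<close>.\<close>
        interpret lipschitz_image N \<omega> f L' \<delta> "undefined :: 'k"
          by unfold_locales (use assms L' that in auto)
        show ?thesis
          using few_bad by (intro hausdorff_premeasure_range_null) blast
      qed
      then show "hausdorff_measure CARD('k) (range f \<inter> fractal_percolation N \<omega>) = 0"
        unfolding hausdorff_measure_def by (auto simp: SUP_eq_iff intro!: antisym SUP_least)
    qed
  qed
  then show ?thesis
    unfolding percolation_space_def by (rule AE_completion)
qed

end
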